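(* Consider a PCA on $\Omega_S=\{-1,+1\}^{\mathbb{Z}^d}$ with coefficients $(r_A)$ that is contractive, i.e. $\kappa=\big(\sum_{A\Subset\mathbb{Z}^d}|A|\,|r_A|\big)^2<1$. Let $\mu$ be a probability measure on $\Omega_S$ and let $\mathbb{P}_\mu$ be the corresponding path-space measure on $\Omega_{ST}=\{-1,+1\}^{\mathbb{Z}^d\times\mathbb{N}}$. Assume that $\mu$ satisfies $\mathrm{GCB}(C)$ for some $C>0$. Then there exists $C'$ such that $\mathbb{P}_\mu$ satisfies $\mathrm{GCB}(C')$. As a consequence, for the unique stationary measure $\nu$ of the PCA, the corresponding path-space measure $\mathbb{P}_\nu$ satisfies $\mathrm{GCB}(C')$ for some $C'$.
   Context: $\mathbb{N}=\{0,1,2,\dots\}$. $A\Subset\mathbb{Z}^d$ means $A$ is a finite subset of $\mathbb{Z}^d$. $\Omega_S=\{-1,+1\}^{\mathbb{Z}^d}$ and $\Omega_{ST}=\{-1,+1\}^{\mathbb{Z}^d\times\mathbb{N}}$ have the product topology and Borel $\sigma$-algebra. PCA: real coefficients $(r_A)_{A\Subset\mathbb{Z}^d}$ with $\sum_A|r_A|<\infty$ are given; for $\eta\in\Omega_S$ and $x\in\mathbb{Z}^d$ set $h_x(\eta)=\sum_{A\Subset\mathbb{Z}^d} r_A\,\eta_{A+x}$, where $\eta_B=\prod_{y\in B}\eta_y$, and assume $|h_x(\eta)|\le 1$ for all $\eta$ and $x$. Given $\eta$, $p(d\sigma|\eta)$ is the product probability measure on $\Omega_S$ with marginals $p(\sigma_x=s\,|\,\eta)=\frac12(1+s\,h_x(\eta))$,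 $s\in\{-1,+1\}$. The PCA is the discrete-time Markov chain $(\sigma_n)_{n\in\mathbb{N}}$ on $\Omega_S$ with transition kernel $p$; the path-space measure $\mathbb{P}_\mu$ is the law on $\Omega_{ST}$ of this chain started from $\sigma_0\sim\mu$. A probability measure $\nu$ is stationary if $\nu P=\nu$, where $\nu P(d\sigma)=\int p(d\sigma|\eta)\,\nu(d\eta)$. GCB: let $V$ be $\mathbb{Z}^d$ or $\mathbb{Z}^d\times\mathbb{N}$ and $\Omega=\{-1,+1\}^V$. A function is local if it depends on finitely many coordinates. For $f:\Omega\to\mathbb{R}$ and $v\in V$, $\delta_v f=\sup_{\sigma}\big(f(\sigma^{(v)})-f(\sigma)\big)$, where $\sigma^{(v)}$ is $\sigma$ with the spin at $v$ flipped, and $\|\delta f\|_2^2=\sum_{v\in V}(\delta_v f)^2$. A probability measure $\mu$ on $\Omega$ satisfies $\mathrm{GCB}(C)$, $C>0$, if for every local $f:\Omega\to\mathbb{R}$, $$\log\int e^{f-\int f\,d\mu}\,d\mu\le\frac{C}{2}\|\delta f\|_2^2 .$$ *)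

theory Defs
  imports "HOL-Probability.Probability"
begin

section \<open>Spin configurations\<close>

text \<open>
  A configuration on a site set \<open>V\<close> (a type) is a function \<open>V \<Rightarrow> real\<close> with values in \<open>{-1, 1}\<close>; all
  notions below depend only on the restriction of their arguments to such functions.
\<close>

definition configs :: "('v \<Rightarrow> real) set" where
  "configs = {\<sigma>. \<forall>v. \<sigma> v \<in> {-1, 1}}"

definition config_space :: "('v \<Rightarrow> real) measure" where
  "config_space = PiM UNIV (\<lambda>_. count_space {-1, 1})"

lemma space_config_space: "space config_space = configs"
  by (auto simp: config_space_def configs_def space_PiM PiE_UNIV_domain)

text \<open>The product \<open>\<sigma>\<close>-algebra is the Borel \<open>\<sigma>\<close>-algebra of the product topology.\<close>

lemma sets_config_space_eq_borel:
  "sets (config_space :: ('v::countable \<Rightarrow> real) measure) = sets (restrict_space borel configs)"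
proof (rule antisym)
  let ?B = "restrict_space borel configs :: ('v \<Rightarrow> real) measure"
  have 1: "(\<lambda>\<sigma>. \<sigma>) \<in> measurable ?B (config_space :: ('v \<Rightarrow> real) measure)"
    unfolding config_space_def
  proof (rule measurable_PiM_single')
    fix v :: 'v
    have "(\<lambda>\<sigma>. \<sigma> v) \<in> borel_measurable (borel :: ('v \<Rightarrow> real) measure)"
      by (intro borel_measurable_continuous_onI continuous_on_product_coordinates)
    then have m: "(\<lambda>\<sigma>. \<sigma> v) \<in> borel_measurable ?B"
      by (rule measurable_restrict_space1)
    show "(\<lambda>\<sigma>. \<sigma> v) \<in> measurable ?B (count_space {-1, 1})"
    proof (subst measurable_count_space_eq2, simp, intro conjI ballI)
      show "(\<lambda>\<sigma>. \<sigma> v) \<in> space ?B \<rightarrow> {-1, 1}"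
        by (auto simp: space_restrict_space configs_def)
      show "(\<lambda>\<sigma>. \<sigma> v) -` {a} \<inter> space ?B \<in> sets ?B" for a
        using m by (rule measurable_sets) simp
    qed
  qed (auto simp: space_restrict_space configs_def PiE_UNIV_domain)
  have 2: "(\<lambda>\<sigma>. \<sigma>) \<in> measurable (config_space :: ('v \<Rightarrow> real) measure) ?B"
  proof (rule measurable_restrict_space2)
    show "(\<lambda>\<sigma>. \<sigma>) \<in> space config_space \<rightarrow> (configs :: ('v \<Rightarrow> real) set)"
      by (simp add: space_config_space)
    have "(\<lambda>\<sigma>. \<sigma>) \<in> measurable config_space (PiM UNIV (\<lambda>_::'v. borel :: real measure))"
      unfolding config_space_def
      by (rule measurable_PiM_single')
         (auto intro: measurable_compose[OF measurable_component_singleton])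
    then show "(\<lambda>\<sigma>. \<sigma>) \<in> borel_measurable (config_space :: ('v \<Rightarrow> real) measure)"
      by (simp add: measurable_cong_sets[OF refl sets_PiM_equal_borel])
  qed
  have sp: "space ?B = configs" by (simp add: space_restrict_space)
  show "sets config_space \<subseteq> sets ?B"
  proof
    fix A :: "('v \<Rightarrow> real) set" assume A: "A \<in> sets config_space"
    have "A \<subseteq> configs" using sets.sets_into_space[OF A] by (simp add: space_config_space)
    then show "A \<in> sets ?B" using measurable_sets[OF 1 A] by (simp add: sp Int_absorb2)
  qed
  show "sets ?B \<subseteq> sets config_space"
  proof
    fix A assume A: "A \<in> sets ?B"
    have "A \<subseteq> configs" using sets.sets_into_space[OF A] by (simp add: sp)
    then show "A \<in> sets config_space"
      using measurable_sets[OF 2 A] by (simp add: space_config_space Int_absorb2)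
  qed
qed

definition flip :: "'v \<Rightarrow> ('v \<Rightarrow> real) \<Rightarrow> ('v \<Rightarrow> real)" where
  "flip v \<sigma> = \<sigma>(v := - \<sigma> v)"


section \<open>Gaussian concentration bound\<close>

definition local_function :: "(('v \<Rightarrow> real) \<Rightarrow> real) \<Rightarrow> bool" where
  "local_function f \<longleftrightarrow>
     (\<exists>\<Lambda>. finite \<Lambda> \<and> (\<forall>\<sigma>\<in>configs. \<forall>\<tau>\<in>configs. (\<forall>v\<in>\<Lambda>. \<sigma> v = \<tau> v) \<longrightarrow> f \<sigma> = f \<tau>))"

definition oscillation :: "'v \<Rightarrow> (('v \<Rightarrow> real) \<Rightarrow> real) \<Rightarrow> real" where
  "oscillation v f = (SUP \<sigma>\<in>configs. f (flip v \<sigma>) - f \<sigma>)"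

text \<open>For local \<open>f\<close> the supremum is over finitely many values and the sum has finite support.\<close>

definition osc_norm_sq :: "(('v \<Rightarrow> real) \<Rightarrow> real) \<Rightarrow> real" where
  "osc_norm_sq f = (\<Sum>\<^sub>\<infinity>v\<in>UNIV. (oscillation v f)\<^sup>2)"

definition GCB :: "real \<Rightarrow> ('v \<Rightarrow> real) measure \<Rightarrow> bool" where
  "GCB C \<mu> \<longleftrightarrow> C > 0 \<and>
     (\<forall>f. local_function f \<longrightarrow>
        ln (\<integral>\<sigma>. exp (f \<sigma> - (\<integral>\<tau>. f \<tau> \<partial>\<mu>)) \<partial>\<mu>) \<le> C / 2 * osc_norm_sq f)"


section \<open>Probabilistic cellular automata\<close>

definition local_field :: "((int ^ 'd) set \<Rightarrow> real) \<Rightarrow> int ^ 'd \<Rightarrow> (int ^ 'd \<Rightarrow> real) \<Rightarrow> real" where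
  "local_field r x \<eta> = (\<Sum>\<^sub>\<infinity>A\<in>{A. finite A}. r A * (\<Prod>y\<in>(\<lambda>a. a + x) ` A. \<eta> y))"

definition pca_coefficients :: "((int ^ 'd) set \<Rightarrow> real) \<Rightarrow> bool" where
  "pca_coefficients r \<longleftrightarrow>
     (\<lambda>A. \<bar>r A\<bar>) summable_on {A. finite A} \<and>
     (\<forall>\<eta>\<in>configs. \<forall>x. \<bar>local_field r x \<eta>\<bar> \<le> 1)"

text \<open>The summability condition is part of \<open>\<kappa> < 1\<close>: the value of a divergent infinite sum is \<open>0\<close>.\<close>

definition contractive :: "((int ^ 'd) set \<Rightarrow> real) \<Rightarrow> bool" where
  "contractive r \<longleftrightarrow>
     (\<lambda>A. real (card A) * \<bar>r A\<bar>) summable_on {A. finite A} \<and>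
     (\<Sum>\<^sub>\<infinity>A\<in>{A. finite A}. real (card A) * \<bar>r A\<bar>)\<^sup>2 < 1"

definition pca_kernel :: "((int ^ 'd) set \<Rightarrow> real) \<Rightarrow> (int ^ 'd \<Rightarrow> real) \<Rightarrow> (int ^ 'd \<Rightarrow> real) measure" where
  "pca_kernel r \<eta> =
     PiM UNIV (\<lambda>x. point_measure {-1, 1} (\<lambda>s. ennreal ((1 + s * local_field r x \<eta>) / 2)))"

definition stationary :: "((int ^ 'd) set \<Rightarrow> real) \<Rightarrow> (int ^ 'd \<Rightarrow> real) measure \<Rightarrow> bool" where
  "stationary r \<nu> \<longleftrightarrow> \<nu> \<in> space (prob_algebra config_space) \<and> \<nu> \<bind> pca_kernel r = \<nu>"

text \<open>
  The \<open>n\<close>-th kernel of the Ionescu-Tulcea construction gives the law of the state at time \<open>n\<close>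
  given the states at times \<open>0, \<dots>, n - 1\<close>; the law on sequences of configurations
  is then transported to configurations on space-time.
\<close>

definition step_kernel ::
  "((int ^ 'd) set \<Rightarrow> real) \<Rightarrow> (int ^ 'd \<Rightarrow> real) measure \<Rightarrow>
     nat \<Rightarrow> (nat \<Rightarrow> int ^ 'd \<Rightarrow> real) \<Rightarrow> (int ^ 'd \<Rightarrow> real) measure" where
  "step_kernel r \<mu> n \<omega> = (case n of 0 \<Rightarrow> \<mu> | Suc m \<Rightarrow> pca_kernel r (\<omega> m))"

definition path_measure ::
  "((int ^ 'd) set \<Rightarrow> real) \<Rightarrow> (int ^ 'd \<Rightarrow> real) measure \<Rightarrow> ((int ^ 'd) \<times> nat \<Rightarrow> real) measure" where
  "path_measure r \<mu> =
     distr
       (projective_family.lim UNIV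
         (Ionescu_Tulcea.CI (step_kernel r \<mu>) (\<lambda>_. config_space)) (\<lambda>_. config_space))
       config_space
       (\<lambda>\<omega> (x, n). \<omega> n x)"


section \<open>Well-definedness of the kernel and of the path-space measure\<close>

lemma countable_finite_sets: "countable {A :: (int ^ 'd::finite) set. finite A}"
  using countable_Collect_finite by blast

lemma abs_prod_configs: "\<eta> \<in> configs \<Longrightarrow> \<bar>\<Prod>y\<in>B. \<eta> y\<bar> = 1"
  unfolding abs_prod
proof (rule prod.neutral, rule ballI)
  fix y assume "\<eta> \<in> configs"
  then have "\<eta> y = - 1 \<or> \<eta> y = 1" by (simp add: configs_def)
  then show "\<bar>\<eta> y\<bar> = 1" by auto
qed

lemma measurable_config_coordinate [measurable]: "(\<lambda>\<eta>. \<eta> y) \<in> borel_measurable config_space"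
  unfolding config_space_def
  by (auto intro: measurable_compose[OF measurable_component_singleton])

lemma measurable_local_field:
  fixes r :: "(int ^ 'd::finite) set \<Rightarrow> real"
  assumes "pca_coefficients r"
  shows "local_field r x \<in> borel_measurable config_space"
proof -
  let ?F = "{A :: (int ^ 'd) set. finite A}"
  let ?t = "\<lambda>\<eta> A. r A * (\<Prod>y\<in>(\<lambda>a. a + x) ` A. \<eta> y)"
  have inf: "infinite ?F" 
  proof
    assume "finite ?F"
    then have "finite ((\<lambda>z. {z}) ` (UNIV :: (int^'d) set))" by (rule rev_finite_subset) auto
    then have "finite (UNIV :: (int^'d) set)" by (rule finite_imageD) (auto simp: inj_on_def)
    then have "finite ((\<lambda>k. (\<chi> i. k) :: int ^ 'd) ` (UNIV :: int set))" by (rule rev_finite_subset) auto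
    then have "finite (UNIV :: int set)" by (rule finite_imageD) (auto simp: inj_on_def vec_eq_iff)
    then show False by simp
  qed
  let ?e = "from_nat_into ?F"
  have bij: "bij_betw ?e UNIV ?F" 
    using countable_finite_sets inf by (rule bij_betw_from_nat_into)
  have "local_field r x \<eta> = (\<Sum>n. ?t \<eta> (?e n))" if "\<eta> \<in> configs" for \<eta>
  proof -
    have s: "(\<lambda>A. norm (?t \<eta> A)) summable_on ?F"
      using assms by (simp add: pca_coefficients_def abs_mult abs_prod_configs[OF that])
    then have "?t \<eta> summable_on ?F" by (rule abs_summable_summable)
    then have "(?t \<eta> has_sum local_field r x \<eta>) ?F"
      unfolding local_field_def by (rule has_sum_infsum)
    then have "((\<lambda>n. ?t \<eta> (?e n)) has_sum local_field r x \<eta>) UNIV"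
      using has_sum_reindex_bij_betw[OF bij, of "?t \<eta>"] by simp
    then show ?thesis by (auto dest: has_sum_imp_sums sums_unique)
  qed
  moreover have "(\<lambda>\<eta>. \<Sum>n. ?t \<eta> (?e n)) \<in> borel_measurable config_space"
    by measurable
  ultimately show ?thesis
    by (subst measurable_cong[where g="\<lambda>\<eta>. \<Sum>n. ?t \<eta> (?e n)"]) (auto simp: space_config_space)
qed

lemma prob_space_marginal:
  assumes "\<bar>h\<bar> \<le> (1::real)"
  shows "prob_space (point_measure {-1, 1} (\<lambda>s. ennreal ((1 + s * h) / 2)))"
    using assms
    by (intro prob_spaceI)
      (simp add: emeasure_point_measure_finite space_point_measure 
             flip: ennreal_plus add_divide_distrib)

lemma measurable_pca_kernel:
  assumes r: "pca_coefficients r"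
  shows "pca_kernel r \<in> measurable config_space (prob_algebra config_space)"
proof (rule measurable_prob_algebra_generated)
  let ?M = "\<lambda>_::int^'a. count_space {-1, 1::real}"
  show "sets config_space = sigma_sets (\<Pi>\<^sub>E i\<in>UNIV. space (?M i)) (prod_algebra UNIV ?M)"
    unfolding config_space_def by (rule sets_PiM)
  show "Int_stable (prod_algebra UNIV ?M)" by (rule Int_stable_prod_algebra)
  show "prod_algebra UNIV ?M \<subseteq> Pow (\<Pi>\<^sub>E i\<in>UNIV. space (?M i))"
    by (rule prod_algebra_sets_into_space)
  let ?N = "\<lambda>\<eta> x. point_measure {-1, 1} (\<lambda>s. ennreal ((1 + s * local_field r x \<eta>) / 2))"
  have P: "prob_space (?N \<eta> x)" if "\<eta> \<in> space config_space" for \<eta> x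
    using that r by (intro prob_space_marginal) (auto simp: pca_coefficients_def space_config_space)
  show "prob_space (pca_kernel r \<eta>)" if "\<eta> \<in> space config_space" for \<eta>
    unfolding pca_kernel_def using P[OF that] by (rule prob_space_PiM)
  show "sets (pca_kernel r \<eta>) = sets config_space" for \<eta>
    unfolding pca_kernel_def config_space_def by (rule sets_PiM_cong) (auto simp: sets_point_measure)
  fix A assume "A \<in> prod_algebra UNIV ?M"
  then obtain J E where J: "A = prod_emb UNIV ?M J (\<Pi>\<^sub>E j\<in>J. E j)" "finite J"
     "\<And>i. i \<in> J \<Longrightarrow> E i \<subseteq> {-1,1}"
    by (elim prod_algebraE) auto
  have "emeasure (pca_kernel r \<eta>) A = (\<Prod>i\<in>J. \<Sum>s\<in>E i. ennreal ((1 + s * local_field r i \<eta>) / 2))"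
    if "\<eta> \<in> space config_space" for \<eta>
  proof -
    have "A = prod_emb UNIV (?N \<eta>) J (\<Pi>\<^sub>E j\<in>J. E j)"
      unfolding J prod_emb_def by (simp add: space_point_measure)
    then have "emeasure (pca_kernel r \<eta>) A = (\<Prod>i\<in>J. emeasure (?N \<eta> i) (E i))"
      unfolding pca_kernel_def using J(2,3) P[OF that]
      by (simp add: emeasure_PiM_emb sets_point_measure)
    also have "\<dots> = (\<Prod>i\<in>J. \<Sum>s\<in>E i. ennreal ((1 + s * local_field r i \<eta>) / 2))"
      using J(3) by (intro prod.cong refl emeasure_point_measure_finite) auto
    finally show ?thesis .
  qed
  moreover note [measurable] = measurable_local_field[OF r]
  have "(\<lambda>\<eta>. \<Prod>i\<in>J. \<Sum>s\<in>E i. ennreal ((1 + s * local_field r i \<eta>) / 2)) \<in> borel_measurable config_space"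
    by measurable
  ultimately show "(\<lambda>\<eta>. emeasure (pca_kernel r \<eta>) A) \<in> borel_measurable config_space"
    by (subst measurable_cong) auto
qed

lemma Ionescu_Tulcea_step_kernel:
  assumes r: "pca_coefficients r" and mu: "\<mu> \<in> space (prob_algebra config_space)"
  shows "Ionescu_Tulcea (step_kernel r \<mu>) (\<lambda>_. config_space)"
proof -
  have "step_kernel r \<mu> n \<in> measurable (PiM {0..<n} (\<lambda>_. config_space)) (prob_algebra config_space)" for n
  proof (cases n)
    case 0 then show ?thesis using mu by (simp add: step_kernel_def[abs_def])
  next
    case (Suc m)
    have "(\<lambda>\<omega>. pca_kernel r (\<omega> m)) \<in> measurable (PiM {0..<n} (\<lambda>_. config_space)) (prob_algebra config_space)"
      by (rule measurable_compose[OF _ measurable_pca_kernel[OF r]], rule measurable_component_singleton) (simp add: Suc)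
    then show ?thesis by (simp add: Suc step_kernel_def[abs_def])
  qed
  note k = this
  have "prob_space (step_kernel r \<mu> n x)" if "x \<in> space (PiM {0..<n} (\<lambda>_. config_space))" for n x
    using measurable_space[OF k that] by (simp add: space_prob_algebra)
  with k show ?thesis
    by (intro Ionescu_Tulcea.intro measurable_prob_algebraD)
qed

lemma measurable_space_time:
   "(\<lambda>\<omega> (x, n). \<omega> n x) \<in> measurable (PiM (UNIV::nat set) (\<lambda>_. config_space :: ('v \<Rightarrow> real) measure)) config_space"
  apply (subst (2) config_space_def)
  apply (rule measurable_PiM_single')
   apply (auto simp: space_PiM PiE_UNIV_domain space_config_space split: prod.splits)
   apply (rule measurable_compose[OF measurable_component_singleton])
    apply simp
   apply (simp add: config_space_def)
   apply (auto simp: configs_def Pi_iff)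
  done

lemma path_measure_in_prob_algebra:
  assumes a: "pca_coefficients r" "\<mu> \<in> space (prob_algebra config_space)"
  shows "path_measure r \<mu> \<in> space (prob_algebra config_space)"
proof -
  interpret I: Ionescu_Tulcea "step_kernel r \<mu>" "\<lambda>_. config_space" by (rule Ionescu_Tulcea_step_kernel[OF a])
  have "emeasure I.PF.lim (space I.PF.lim) = 1"
  proof -
    have "I.PF.emb UNIV {} (space (PiM {} (\<lambda>_. config_space))) = space I.PF.lim"
      by (auto simp: prod_emb_def space_PiM)
    moreover have "emeasure (I.CI {}) (space (PiM {} (\<lambda>_. config_space))) = 1"
      using prob_space.emeasure_space_1[OF I.PF.prob_space_P[of "{}"]] by (simp add: I.CI_def)
    ultimately show ?thesis
      using I.lim[of "{}" "space (PiM {} (\<lambda>_. config_space))"] by (metis finite.emptyI sets.top)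
  qed
  then have "prob_space I.PF.lim" by (rule prob_spaceI)
  moreover have "(\<lambda>\<omega> (x, n). \<omega> n x) \<in> measurable I.PF.lim (config_space:: ((int^'a)\<times>nat\<Rightarrow>real) measure)"
    using measurable_space_time by (simp add: measurable_cong_sets[OF I.PF.sets_lim refl])
  ultimately show ?thesis
   unfolding path_measure_def space_prob_algebra
   by (auto intro!: prob_space.prob_space_distr)
qed

end

theory Submission
  imports Defs
begin

text \<open>
  Write \<open>\<gamma> = \<Sum>\<^sub>A |A| |r\<^sub>A| < 1\<close>. A product of biased spins satisfies a Gaussian bound with constant
  \<open>1/4\<close> (Hoeffding's lemma, resampling one site at a time), and one step of the PCA maps the oscillations
  \<open>d\<close> of a function to at most their convolution with the influences \<open>c z = \<Sum>\<^sub>A\<^sub>\<ni>\<^sub>z |r\<^sub>A|\<close>, which have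
  total mass \<open>\<gamma>\<close>. On path space, integrate out the times \<open>N, N - 1, \<dots>, 1\<close> successively. Removing time
  \<open>n + 1\<close> costs \<open>\<parallel>d\<^sub>n\<^sub>+\<^sub>1\<parallel>\<^sup>2 / 8\<close> and replaces \<open>d\<^sub>n\<close> by \<open>d\<^sub>n + c * d\<^sub>n\<^sub>+\<^sub>1\<close>, whose squared norm is at most
  \<open>\<parallel>d\<^sub>n\<parallel>\<^sup>2 / (1 - \<gamma>) + \<gamma> \<parallel>d\<^sub>n\<^sub>+\<^sub>1\<parallel>\<^sup>2\<close> by Cauchy-Schwarz; the bound closes up with the constant
  \<open>D / (1 - \<gamma>)\<close> as soon as \<open>D \<ge> C\<close> and \<open>4 D (1 - \<gamma>) \<ge> 1\<close>. Since the step does not preserve locality,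
  all bounds are carried by quasi-local functions, the uniform limits of local ones. The same contraction,
  in \<open>\<ell>\<^sup>1\<close>, shows that the laws started from the all-plus configuration converge to the unique stationary
  measure, which inherits their common constant \<open>1 / (4 (1 - \<gamma>))\<close>.
\<close>

section \<open>Local and quasi-local functions\<close>

text \<open>Given the past, only the newest slice is a product measure, so it is the one that can be
  integrated out, and its oscillations pass to the slice before it. Hence the slices are weighted
  unequally: the newest has weight 1, the earlier ones 1 / (1 - \<gamma>), because a slice pays this
  factor exactly once, when it absorbs its successor. The Cauchy-Schwarz step is balanced for this:
  the influences have mass \<gamma>, and the missing mass 1 - \<gamma> is placed on the value a / (1
  - \<gamma>), which makes a + c * d a mean under a probability. The condition 4 D (1 - \<gamma>)
  \<ge> 1 says 1/8 + \<gamma> D / 2 \<le> D / 2: the cost of the removed slice and what it hands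
  down fit into its own weight.

  The oscillations of an integrated function are only bounded, not computed. All estimates therefore
  quantify over square-summable profiles \<open>d\<close> dominating the oscillations; the exact
  oscillations enter only in passing to and from \<open>GCB\<close>.

  For the stationary measure the bound survives the limit because \<open>f\<close> and exp
  \<open>f\<close> are both local. Convergence of local means does not by itself give a limit
  measure; that comes from Kolmogorov extension.\<close>

definition determined_up_to :: "real \<Rightarrow> 'v set \<Rightarrow> (('v \<Rightarrow> real) \<Rightarrow> real) \<Rightarrow> bool" where
  "determined_up_to \<epsilon> \<Lambda> f \<longleftrightarrow>
     (\<forall>\<sigma>\<in>configs. \<forall>\<tau>\<in>configs. (\<forall>v\<in>\<Lambda>. \<sigma> v = \<tau> v) \<longrightarrow> \<bar>f \<sigma> - f \<tau>\<bar> \<le> \<epsilon>)"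

definition quasi_local :: "(('v \<Rightarrow> real) \<Rightarrow> real) \<Rightarrow> bool" where
  "quasi_local f \<longleftrightarrow> (\<forall>\<epsilon>>0. \<exists>\<Lambda>. finite \<Lambda> \<and> determined_up_to \<epsilon> \<Lambda> f)"

text \<open>A dominating profile stands in for the exact suprema. The absolute value costs nothing
  against the one-sided supremum, as \<open>flip\<close> is an involution.\<close>

definition osc_le :: "('v \<Rightarrow> real) \<Rightarrow> (('v \<Rightarrow> real) \<Rightarrow> real) \<Rightarrow> bool" where
  "osc_le d f \<longleftrightarrow> (\<forall>v. \<forall>\<sigma>\<in>configs. \<bar>f (flip v \<sigma>) - f \<sigma>\<bar> \<le> d v)"

text \<open>The canonical local approximation: composing with it increases no oscillation and
  changes a function by no more than its dependence outside \<open>\<Lambda>\<close>.\<close>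

definition freeze :: "'v set \<Rightarrow> ('v \<Rightarrow> real) \<Rightarrow> 'v \<Rightarrow> real" where
  "freeze \<Lambda> \<sigma> v = (if v \<in> \<Lambda> then \<sigma> v else 1)"

lemma one_in_configs [simp]: "(\<lambda>_. 1) \<in> configs"
  by (simp add: configs_def)

lemma flip_in_configs [simp]: "\<sigma> \<in> configs \<Longrightarrow> flip v \<sigma> \<in> configs"
  by (auto simp: configs_def flip_def)

lemma freeze_in_configs [simp]: "\<sigma> \<in> configs \<Longrightarrow> freeze \<Lambda> \<sigma> \<in> configs"
  by (auto simp: configs_def freeze_def)

lemma fun_upd_in_configs [simp]: "\<sigma> \<in> configs \<Longrightarrow> s \<in> {-1, 1} \<Longrightarrow> \<sigma>(v := s) \<in> configs"
  by (auto simp: configs_def)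

lemma fun_upd_eq_self_or_flip:
  assumes "\<sigma> \<in> configs" "s \<in> {-1, 1}"
  shows "\<sigma>(v := s) = \<sigma> \<or> \<sigma>(v := s) = flip v \<sigma>"
proof -
  have "\<sigma> v = -1 \<or> \<sigma> v = 1" using assms(1) by (auto simp: configs_def)
  then have "s = \<sigma> v \<or> s = - \<sigma> v" using assms(2) by auto
  then show ?thesis by (auto simp: flip_def)
qed

lemma determined_up_toD:
  "determined_up_to \<epsilon> \<Lambda> f \<Longrightarrow> \<sigma> \<in> configs \<Longrightarrow> \<tau> \<in> configs \<Longrightarrow> (\<And>v. v \<in> \<Lambda> \<Longrightarrow> \<sigma> v = \<tau> v) \<Longrightarrow>
     \<bar>f \<sigma> - f \<tau>\<bar> \<le> \<epsilon>"
  by (auto simp: determined_up_to_def)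

lemma determined_up_to_mono:
  "determined_up_to \<epsilon> \<Lambda> f \<Longrightarrow> \<epsilon> \<le> \<delta> \<Longrightarrow> \<Lambda> \<subseteq> \<Lambda>' \<Longrightarrow> determined_up_to \<delta> \<Lambda>' f"
  unfolding determined_up_to_def by (meson order_trans subsetD)

lemma quasi_localE:
  assumes "quasi_local f" "\<epsilon> > 0"
  obtains \<Lambda> where "finite \<Lambda>" "determined_up_to \<epsilon> \<Lambda> f"
  using assms by (auto simp: quasi_local_def)

lemma local_function_iff: "local_function f \<longleftrightarrow> (\<exists>\<Lambda>. finite \<Lambda> \<and> determined_up_to 0 \<Lambda> f)"
  by (simp add: local_function_def determined_up_to_def)

lemma quasi_local_local: "local_function f \<Longrightarrow> quasi_local f"
  unfolding local_function_iff quasi_local_def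
  by (meson determined_up_to_mono less_imp_le order_refl)

lemma osc_leD: "osc_le d f \<Longrightarrow> \<sigma> \<in> configs \<Longrightarrow> \<bar>f (flip v \<sigma>) - f \<sigma>\<bar> \<le> d v"
  by (auto simp: osc_le_def)

lemma osc_le_nonneg: "osc_le d f \<Longrightarrow> 0 \<le> d v"
  by (meson abs_ge_zero one_in_configs order_trans osc_leD)

lemma osc_le_fun_upd:
  assumes "osc_le d f" "\<sigma> \<in> configs" "s \<in> {-1, 1}"
  shows "\<bar>f (\<sigma>(v := s)) - f \<sigma>\<bar> \<le> d v"
  using fun_upd_eq_self_or_flip[OF assms(2,3), of v] osc_leD[OF assms(1,2), of v] osc_le_nonneg[OF assms(1)]
  by auto

text \<open>A flip inside \<open>\<Lambda>\<close> commutes with freezing, a flip outside is erased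
  by it.\<close>

lemma osc_le_freeze:
  assumes "osc_le d f"
  shows "osc_le d (\<lambda>\<sigma>. f (freeze \<Lambda> \<sigma>))"
  unfolding osc_le_def
proof (intro allI ballI)
  fix v and \<sigma> :: "'a \<Rightarrow> real" assume \<sigma>: "\<sigma> \<in> configs"
  show "\<bar>f (freeze \<Lambda> (flip v \<sigma>)) - f (freeze \<Lambda> \<sigma>)\<bar> \<le> d v"
  proof (cases "v \<in> \<Lambda>")
    case True
    then have "freeze \<Lambda> (flip v \<sigma>) = flip v (freeze \<Lambda> \<sigma>)" by (auto simp: freeze_def flip_def)
    then show ?thesis using osc_leD[OF assms, of "freeze \<Lambda> \<sigma>" v] \<sigma> by simp
  next
    case False
    then have "freeze \<Lambda> (flip v \<sigma>) = freeze \<Lambda> \<sigma>" by (auto simp: freeze_def flip_def)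
    then show ?thesis using osc_le_nonneg[OF assms] by simp
  qed
qed

lemma determined_up_to_freeze: "determined_up_to 0 \<Lambda> (\<lambda>\<sigma>. f (freeze \<Lambda> \<sigma>))"
proof -
  have "freeze \<Lambda> \<sigma> = freeze \<Lambda> \<tau>" if "\<forall>v\<in>\<Lambda>. \<sigma> v = \<tau> v" for \<sigma> \<tau> using that by (auto simp: freeze_def)
  then have "\<bar>f (freeze \<Lambda> \<sigma>) - f (freeze \<Lambda> \<tau>)\<bar> \<le> 0" if "\<forall>v\<in>\<Lambda>. \<sigma> v = \<tau> v" for \<sigma> \<tau>
    using that by fastforce
  then show ?thesis unfolding determined_up_to_def by blast
qed

lemma local_freeze: "finite \<Lambda> \<Longrightarrow> local_function (\<lambda>\<sigma>. f (freeze \<Lambda> \<sigma>))"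
  using determined_up_to_freeze local_function_iff by blast

lemma freeze_close:
  assumes "determined_up_to \<epsilon> \<Lambda> f" "\<sigma> \<in> configs"
  shows "\<bar>f (freeze \<Lambda> \<sigma>) - f \<sigma>\<bar> \<le> \<epsilon>"
  using assms(2) by (intro determined_up_toD[OF assms(1)]) (auto simp: freeze_def)

lemma finite_freeze_configs: "finite \<Lambda> \<Longrightarrow> finite (freeze \<Lambda> ` configs)"
proof (rule finite_subset)
  show "freeze \<Lambda> ` configs \<subseteq> (\<lambda>g v. if v \<in> \<Lambda> then g v else 1) ` (\<Pi>\<^sub>E v\<in>\<Lambda>. {-1, 1})"
  proof
    fix x assume "x \<in> freeze \<Lambda> ` configs"
    then obtain \<sigma> where \<sigma>: "\<sigma> \<in> configs" "x = freeze \<Lambda> \<sigma>" by auto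
    have "restrict \<sigma> \<Lambda> \<in> (\<Pi>\<^sub>E v\<in>\<Lambda>. {-1, 1})" using \<sigma>(1) by (auto simp: configs_def)
    moreover have "x = (\<lambda>v. if v \<in> \<Lambda> then restrict \<sigma> \<Lambda> v else 1)" using \<sigma>(2) by (auto simp: freeze_def)
    ultimately show "x \<in> (\<lambda>g v. if v \<in> \<Lambda> then g v else 1) ` (\<Pi>\<^sub>E v\<in>\<Lambda>. {-1, 1})" by blast
  qed
qed (simp add: finite_PiE)

text \<open>The composition factors through the restriction to \<open>\<Lambda>\<close>, which takes
  values in a finite discrete space, where every function is measurable.\<close>

lemma measurable_freeze:
  assumes "finite \<Lambda>"
  shows "(\<lambda>\<sigma>. f (freeze \<Lambda> \<sigma>)) \<in> measurable config_space (borel :: real measure)"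
proof -
  let ?R = "\<lambda>g v. if v \<in> \<Lambda> then g v else (1::real)"
  have "(\<lambda>\<sigma>. restrict \<sigma> \<Lambda>) \<in> measurable config_space (PiM \<Lambda> (\<lambda>_. count_space {-1, 1 :: real}))"
    unfolding config_space_def by (rule measurable_restrict_subset) simp
  moreover have "PiM \<Lambda> (\<lambda>_. count_space {-1, 1 :: real}) = count_space (\<Pi>\<^sub>E v\<in>\<Lambda>. {-1, 1})"
    using assms by (rule count_space_PiM_finite) simp
  ultimately have "(\<lambda>\<sigma>. restrict \<sigma> \<Lambda>) \<in> measurable config_space (count_space (\<Pi>\<^sub>E v\<in>\<Lambda>. {-1, 1::real}))"
    by simp
  then have "(\<lambda>\<sigma>. f (?R (restrict \<sigma> \<Lambda>))) \<in> borel_measurable config_space"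
    by (rule measurable_compose) simp
  moreover have "?R (restrict \<sigma> \<Lambda>) = freeze \<Lambda> \<sigma>" for \<sigma> by (auto simp: freeze_def)
  ultimately show ?thesis by simp
qed

text \<open>A pointwise limit of frozen versions with errors 1 / (n + 1).\<close>

lemma quasi_local_measurable:
  assumes "quasi_local f"
  shows "f \<in> borel_measurable config_space"
proof -
  have "\<exists>\<Lambda>. finite \<Lambda> \<and> determined_up_to (inverse (real (Suc n))) \<Lambda> f" for n
    using assms unfolding quasi_local_def by simp
  then obtain L where L: "\<And>n. finite (L n)" "\<And>n. determined_up_to (inverse (real (Suc n))) (L n) f"
    by metis
  show ?thesis
  proof (rule borel_measurable_LIMSEQ_real)
    show "(\<lambda>\<sigma>. f (freeze (L n) \<sigma>)) \<in> borel_measurable config_space" for n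
      using L(1) by (rule measurable_freeze)
    fix \<sigma> :: "'a \<Rightarrow> real" assume "\<sigma> \<in> space config_space"
    then have "\<bar>f (freeze (L n) \<sigma>) - f \<sigma>\<bar> \<le> inverse (real (Suc n))" for n
      using freeze_close[OF L(2)] by (simp add: space_config_space)
    then have "(\<lambda>n. f (freeze (L n) \<sigma>) - f \<sigma>) \<longlonglongrightarrow> 0"
      by (intro Lim_null_comparison[OF _ LIMSEQ_inverse_real_of_nat] always_eventually) auto
    then show "(\<lambda>n. f (freeze (L n) \<sigma>)) \<longlonglongrightarrow> f \<sigma>"
      by (rule LIM_zero_cancel)
  qed
qed

lemma quasi_local_bounded:
  assumes "quasi_local f"
  obtains B where "\<And>\<sigma>. \<sigma> \<in> configs \<Longrightarrow> \<bar>f \<sigma>\<bar> \<le> B"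
proof -
  obtain \<Lambda> where L: "finite \<Lambda>" "determined_up_to 1 \<Lambda> f" by (rule quasi_localE[OF assms zero_less_one])
  \<comment> \<open>Frozen configurations are finite in number, so the maximum exists; the tolerance
    1 accounts for the rest.\<close>
  let ?S = "(\<lambda>\<sigma>. \<bar>f \<sigma>\<bar>) ` freeze \<Lambda> ` configs"
  have fin: "finite ?S" using finite_freeze_configs[OF L(1)] by simp
  have "\<bar>f \<sigma>\<bar> \<le> Max ?S + 1" if "\<sigma> \<in> configs" for \<sigma>
  proof -
    have "\<bar>f (freeze \<Lambda> \<sigma>)\<bar> \<le> Max ?S" using fin that by (intro Max_ge) auto
    then show ?thesis using freeze_close[OF L(2) that] by linarith
  qed
  then show ?thesis by (rule that)
qed

lemma quasi_local_osc_le: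
  assumes "quasi_local f"
  obtains B where "osc_le (\<lambda>_. B) f"
proof -
  obtain B where B: "\<And>\<sigma>. \<sigma> \<in> configs \<Longrightarrow> \<bar>f \<sigma>\<bar> \<le> B" by (rule quasi_local_bounded[OF assms]) blast
  have "\<bar>f (flip v \<sigma>) - f \<sigma>\<bar> \<le> 2 * B" if "\<sigma> \<in> configs" for v \<sigma>
    using B[OF that] B[OF flip_in_configs[OF that, of v]] by linarith
  then have "osc_le (\<lambda>_. 2 * B) f" by (simp add: osc_le_def)
  then show ?thesis by (rule that)
qed

section \<open>Integrals of quasi-local functions\<close>

lemma prob_algebra_configD:
  assumes "\<mu> \<in> space (prob_algebra config_space)"
  shows "prob_space \<mu>" "sets \<mu> = sets config_space" "space \<mu> = configs"
  using assms sets_eq_imp_space_eq[of \<mu> config_space] by (auto simp: space_prob_algebra space_config_space)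

lemma integrable_bounded:
  fixes f :: "('v \<Rightarrow> real) \<Rightarrow> real"
  assumes \<mu>: "\<mu> \<in> space (prob_algebra config_space)"
    and f: "f \<in> borel_measurable config_space" "\<And>\<sigma>. \<sigma> \<in> configs \<Longrightarrow> \<bar>f \<sigma>\<bar> \<le> B"
  shows "integrable \<mu> f"
proof -
  interpret prob_space \<mu> by (rule prob_algebra_configD[OF \<mu>])
  show ?thesis
    using f prob_algebra_configD[OF \<mu>] by (intro integrable_const_bound[where B=B] AE_I2) (auto cong: measurable_cong_sets)
qed

lemma quasi_local_integrable:
  assumes "\<mu> \<in> space (prob_algebra config_space)" "quasi_local f"
  shows "integrable \<mu> f"
proof -
  obtain B where "\<And>\<sigma>. \<sigma> \<in> configs \<Longrightarrow> \<bar>f \<sigma>\<bar> \<le> B" by (rule quasi_local_bounded[OF assms(2)]) blast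
  then show ?thesis by (intro integrable_bounded assms quasi_local_measurable)
qed

lemma integral_diff_le:
  fixes f g :: "('v \<Rightarrow> real) \<Rightarrow> real"
  assumes \<mu>: "\<mu> \<in> space (prob_algebra config_space)"
    and f: "integrable \<mu> f" and g: "integrable \<mu> g"
    and le: "\<And>\<sigma>. \<sigma> \<in> configs \<Longrightarrow> \<bar>f \<sigma> - g \<sigma>\<bar> \<le> B"
  shows "\<bar>(\<integral>\<sigma>. f \<sigma> \<partial>\<mu>) - (\<integral>\<sigma>. g \<sigma> \<partial>\<mu>)\<bar> \<le> B"
proof -
  interpret prob_space \<mu> by (rule prob_algebra_configD[OF \<mu>])
  have "\<bar>(\<integral>\<sigma>. f \<sigma> \<partial>\<mu>) - (\<integral>\<sigma>. g \<sigma> \<partial>\<mu>)\<bar> = \<bar>\<integral>\<sigma>. f \<sigma> - g \<sigma> \<partial>\<mu>\<bar>" using f g by simp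
  also have "\<dots> \<le> (\<integral>\<sigma>. \<bar>f \<sigma> - g \<sigma>\<bar> \<partial>\<mu>)" using integral_norm_bound[of \<mu> "\<lambda>\<sigma>. f \<sigma> - g \<sigma>"] by simp
  also have "\<dots> \<le> (\<integral>\<sigma>. B \<partial>\<mu>)"
    using f g le by (intro integral_mono) (auto simp: prob_algebra_configD[OF \<mu>])
  finally show ?thesis by (simp add: prob_space)
qed

text \<open>With \<open>f\<close> bounded by \<open>B\<close>, the map exp (a + c) is Lipschitz on
  the range of \<open>f\<close> with constant exp (B + c).\<close>

lemma quasi_local_exp:
  assumes "quasi_local f"
  shows "quasi_local (\<lambda>\<sigma>. exp (f \<sigma> + c))"
proof -
  obtain B where B: "\<And>\<sigma>. \<sigma> \<in> configs \<Longrightarrow> \<bar>f \<sigma>\<bar> \<le> B" by (rule quasi_local_bounded[OF assms(1)]) blast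
  let ?K = "exp (B + c)"
  have lip: "\<bar>exp (a + c) - exp (b + c)\<bar> \<le> ?K * \<bar>a - b\<bar>" if "\<bar>a\<bar> \<le> B" "\<bar>b\<bar> \<le> B" for a b
  proof -
    \<comment> \<open>Factor out the larger exponential and use 1 - exp (- t) \<le> t.\<close>
    have *: "exp (x + c) - exp (y + c) \<le> ?K * (x - y)" if "x \<le> B" "y \<le> x" for x y :: real
    proof -
      have "exp (x + c) - exp (y + c) = exp (x + c) * (1 - exp (y - x))"
        by (simp add: algebra_simps flip: exp_add)
      also have "\<dots> \<le> exp (x + c) * (x - y)"
      proof (rule mult_left_mono)
        show "1 - exp (y - x) \<le> x - y" using exp_ge_add_one_self[of "y - x"] by linarith
      qed simp
      also have "\<dots> \<le> ?K * (x - y)"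
        using that by (intro mult_right_mono) auto
      finally show ?thesis .
    qed
    show ?thesis
    proof (cases "b \<le> a")
      case True
      then have "exp (b + c) \<le> exp (a + c)" by simp
      then show ?thesis using *[of a b] that True by (simp add: abs_le_iff)
    next
      case False
      then have "exp (a + c) \<le> exp (b + c)" by simp
      then show ?thesis using *[of b a] that False by (simp add: abs_le_iff abs_minus_commute)
    qed
  qed
  show ?thesis unfolding quasi_local_def
  proof (intro allI impI)
    fix \<epsilon> :: real assume "\<epsilon> > 0"
    then obtain \<Lambda> where L: "finite \<Lambda>" "determined_up_to (\<epsilon> / ?K) \<Lambda> f"
      using quasi_localE[OF assms, of "\<epsilon> / ?K"] by auto
    have "\<bar>exp (f \<sigma> + c) - exp (f \<tau> + c)\<bar> \<le> \<epsilon>"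
      if "\<sigma> \<in> configs" "\<tau> \<in> configs" "\<forall>v\<in>\<Lambda>. \<sigma> v = \<tau> v" for \<sigma> \<tau>
    proof -
      have "\<bar>exp (f \<sigma> + c) - exp (f \<tau> + c)\<bar> \<le> ?K * \<bar>f \<sigma> - f \<tau>\<bar>" using lip B that by blast
      also have "\<dots> \<le> ?K * (\<epsilon> / ?K)"
        using determined_up_toD[OF L(2) that(1,2)] that(3) by (intro mult_left_mono) auto
      finally show ?thesis by simp
    qed
    then show "\<exists>\<Lambda>. finite \<Lambda> \<and> determined_up_to \<epsilon> \<Lambda> (\<lambda>\<sigma>. exp (f \<sigma> + c))"
      using L(1) unfolding determined_up_to_def by blast
  qed
qed

lemma integrable_exp_quasi_local:
  assumes "\<mu> \<in> space (prob_algebra config_space)" "quasi_local f"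
  shows "integrable \<mu> (\<lambda>\<sigma>. exp (f \<sigma> - c))"
  using quasi_local_integrable[OF assms(1) quasi_local_exp[OF assms(2), of "- c"]] by simp

text \<open>Telescoping: \<open>\<tau>\<close> is turned into \<open>\<sigma>\<close> one site of
  \<open>\<Lambda>\<close> at a time, each change costing \<open>d\<close>; the sites outside cost
  \<open>\<epsilon>\<close> together.\<close>

lemma osc_le_sum:
  assumes f: "osc_le d f" and L: "finite \<Lambda>" "determined_up_to \<epsilon> \<Lambda> f" and \<sigma>: "\<sigma> \<in> configs" "\<tau> \<in> configs"
  shows "\<bar>f \<sigma> - f \<tau>\<bar> \<le> \<epsilon> + sum d \<Lambda>"
proof -
  have "\<bar>f (\<lambda>v. if v \<in> A then \<sigma> v else \<tau> v) - f \<tau>\<bar> \<le> sum d A" if "finite A" for A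
    using that
  proof induction
    case (insert a A)
    let ?m = "\<lambda>v. if v \<in> A then \<sigma> v else \<tau> v"
    have m: "?m \<in> configs" "\<sigma> a \<in> {-1, 1}" using \<sigma> by (auto simp: configs_def)
    have "(\<lambda>v. if v \<in> insert a A then \<sigma> v else \<tau> v) = ?m(a := \<sigma> a)" by auto
    then have "\<bar>f (\<lambda>v. if v \<in> insert a A then \<sigma> v else \<tau> v) - f ?m\<bar> \<le> d a"
      using osc_le_fun_upd[OF f m] by simp
    then show ?case using insert by simp
  qed simp
  note this[OF L(1)]
  moreover have "\<bar>f \<sigma> - f (\<lambda>v. if v \<in> \<Lambda> then \<sigma> v else \<tau> v)\<bar> \<le> \<epsilon>"
    using \<sigma> by (intro determined_up_toD[OF L(2)]) (auto simp: configs_def)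
  ultimately show ?thesis by linarith
qed

section \<open>Gaussian bounds for quasi-local functions\<close>

text \<open>The exponential form, rather than the logarithmic one of \<open>GCB\<close>, multiplies
  directly when kernels are integrated out one after the other.\<close>

definition quasi_GCB :: "real \<Rightarrow> ('v \<Rightarrow> real) measure \<Rightarrow> bool" where
  "quasi_GCB C \<mu> \<longleftrightarrow>
     (\<forall>g d. quasi_local g \<longrightarrow> osc_le d g \<longrightarrow> (\<lambda>v. (d v)\<^sup>2) summable_on UNIV \<longrightarrow>
        (\<integral>\<sigma>. exp (g \<sigma> - (\<integral>\<tau>. g \<tau> \<partial>\<mu>)) \<partial>\<mu>) \<le> exp (C / 2 * (\<Sum>\<^sub>\<infinity>v. (d v)\<^sup>2)))"

lemma ln_le_iff_le_exp:
  fixes x :: real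
  assumes "x > 0"
  shows "ln x \<le> a \<longleftrightarrow> x \<le> exp a"
  using assms by (metis exp_le_cancel_iff exp_ln)

lemma quasi_GCBD:
  "quasi_GCB C \<mu> \<Longrightarrow> quasi_local g \<Longrightarrow> osc_le d g \<Longrightarrow> (\<lambda>v. (d v)\<^sup>2) summable_on UNIV \<Longrightarrow>
     (\<integral>\<sigma>. exp (g \<sigma> - (\<integral>\<tau>. g \<tau> \<partial>\<mu>)) \<partial>\<mu>) \<le> exp (C / 2 * (\<Sum>\<^sub>\<infinity>v. (d v)\<^sup>2))"
  by (auto simp: quasi_GCB_def)

lemma exp_moment_pos:
  fixes f :: "('v \<Rightarrow> real) \<Rightarrow> real"
  assumes \<mu>: "\<mu> \<in> space (prob_algebra config_space)" and f: "quasi_local f"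
  shows "0 < (\<integral>\<sigma>. exp (f \<sigma> - c) \<partial>\<mu>)"
proof -
  interpret prob_space \<mu> by (rule prob_algebra_configD[OF \<mu>])
  obtain B where B: "\<And>\<sigma>. \<sigma> \<in> configs \<Longrightarrow> \<bar>f \<sigma>\<bar> \<le> B" by (rule quasi_local_bounded[OF f]) blast
  have "exp (- B - c) = (\<integral>\<sigma>. exp (- B - c) \<partial>\<mu>)" by (simp add: prob_space)
  also have "\<dots> \<le> (\<integral>\<sigma>. exp (f \<sigma> - c) \<partial>\<mu>)"
    using B integrable_exp_quasi_local[OF \<mu> f]
    by (intro integral_mono) (fastforce simp: prob_algebra_configD[OF \<mu>] abs_le_iff)+
  finally show ?thesis by (meson exp_gt_zero less_le_trans)
qed

text \<open>Freezing moves \<open>g\<close> and its mean by at most e / 2 each, hence the moment by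
  a factor of at most exp e, and e is arbitrary. This reduces exponential bounds to local
  functions.\<close>

lemma exp_moment_approx:
  assumes \<mu>: "\<mu> \<in> space (prob_algebra config_space)" and g: "quasi_local g"
    and bound: "\<And>\<Lambda>. finite \<Lambda> \<Longrightarrow>
      (\<integral>\<sigma>. exp (g (freeze \<Lambda> \<sigma>) - (\<integral>\<tau>. g (freeze \<Lambda> \<tau>) \<partial>\<mu>)) \<partial>\<mu>) \<le> exp a"
  shows "(\<integral>\<sigma>. exp (g \<sigma> - (\<integral>\<tau>. g \<tau> \<partial>\<mu>)) \<partial>\<mu>) \<le> exp a"
proof -
  let ?E = "\<integral>\<sigma>. exp (g \<sigma> - (\<integral>\<tau>. g \<tau> \<partial>\<mu>)) \<partial>\<mu>"
  have pos: "?E > 0" by (rule exp_moment_pos[OF \<mu> g])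
  have "ln ?E \<le> a"
  proof (rule field_le_epsilon)
    fix e :: real assume "e > 0"
    then obtain \<Lambda> where L: "finite \<Lambda>" "determined_up_to (e / 2) \<Lambda> g" using quasi_localE[OF g, of "e / 2"] by auto
    let ?g = "\<lambda>\<sigma>. g (freeze \<Lambda> \<sigma>)"
    have ql: "quasi_local ?g" using L(1) by (intro quasi_local_local local_freeze)
    have close: "\<bar>g \<sigma> - ?g \<sigma>\<bar> \<le> e / 2" if "\<sigma> \<in> configs" for \<sigma>
      using freeze_close[OF L(2) that] by (simp add: abs_minus_commute)
    have close': "\<bar>(\<integral>\<tau>. g \<tau> \<partial>\<mu>) - (\<integral>\<tau>. ?g \<tau> \<partial>\<mu>)\<bar> \<le> e / 2"
      using close by (intro integral_diff_le[OF \<mu>] quasi_local_integrable[OF \<mu>] g ql)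
    have "?E \<le> (\<integral>\<sigma>. exp e * exp (?g \<sigma> - (\<integral>\<tau>. ?g \<tau> \<partial>\<mu>)) \<partial>\<mu>)"
    proof (rule integral_mono)
      fix \<sigma> assume "\<sigma> \<in> space \<mu>"
      then have "\<bar>g \<sigma> - ?g \<sigma>\<bar> \<le> e / 2" using close by (simp add: prob_algebra_configD[OF \<mu>])
      then have "g \<sigma> - (\<integral>\<tau>. g \<tau> \<partial>\<mu>) \<le> e + (?g \<sigma> - (\<integral>\<tau>. ?g \<tau> \<partial>\<mu>))"
        using close' unfolding abs_le_iff by linarith
      then show "exp (g \<sigma> - (\<integral>\<tau>. g \<tau> \<partial>\<mu>)) \<le> exp e * exp (?g \<sigma> - (\<integral>\<tau>. ?g \<tau> \<partial>\<mu>))"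
        by (simp flip: exp_add)
    qed (auto intro: integrable_exp_quasi_local[OF \<mu>] g ql)
    also have "\<dots> \<le> exp e * exp a" using bound[OF L(1)] by simp
    finally have "?E \<le> exp (a + e)" by (simp add: exp_add mult.commute)
    then show "ln ?E \<le> a + e" using pos ln_le_iff_le_exp by blast
  qed
  then show ?thesis using pos by (simp add: ln_le_iff_le_exp)
qed

text \<open>Boundedness of \<open>f\<close> makes the real-valued \<open>SUP\<close> a genuine upper
  bound; applying it at \<sigma> and at the flipped \<sigma> bounds both signs.\<close>

lemma osc_le_oscillation:
  assumes "local_function f"
  shows "osc_le (\<lambda>v. oscillation v f) f"
  unfolding osc_le_def
proof (intro allI ballI)
  fix v and \<sigma> :: "'a \<Rightarrow> real" assume \<sigma>: "\<sigma> \<in> configs"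
  obtain B where B: "\<And>\<sigma>. \<sigma> \<in> configs \<Longrightarrow> \<bar>f \<sigma>\<bar> \<le> B"
    by (rule quasi_local_bounded[OF quasi_local_local[OF assms]]) blast
  have "f (flip v \<tau>) - f \<tau> \<le> 2 * B" if "\<tau> \<in> configs" for \<tau>
    using B[OF that] B[OF flip_in_configs[OF that, of v]] unfolding abs_le_iff by linarith
  then have bdd: "bdd_above ((\<lambda>\<sigma>. f (flip v \<sigma>) - f \<sigma>) ` configs)" by (rule bdd_aboveI2)
  have up: "f (flip v \<tau>) - f \<tau> \<le> oscillation v f" if "\<tau> \<in> configs" for \<tau>
    unfolding oscillation_def using that bdd by (rule cSUP_upper)
  have "flip v (flip v \<sigma>) = \<sigma>" by (simp add: flip_def)
  then show "\<bar>f (flip v \<sigma>) - f \<sigma>\<bar> \<le> oscillation v f"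
    using up[OF \<sigma>] up[OF flip_in_configs[OF \<sigma>, of v]] by (simp add: abs_le_iff)
qed

lemma oscillation_le: "osc_le d f \<Longrightarrow> oscillation v f \<le> d v"
  unfolding oscillation_def using one_in_configs osc_leD[of d f _ v]
  by (intro cSUP_least) (blast, force simp: abs_le_iff)

lemma oscillation_outside:
  assumes "determined_up_to 0 \<Lambda> f" "v \<notin> \<Lambda>"
  shows "oscillation v f = 0"
proof -
  have "f (flip v \<sigma>) - f \<sigma> = 0" if "\<sigma> \<in> configs" for \<sigma>
  proof -
    have "flip v \<sigma> u = \<sigma> u" if "u \<in> \<Lambda>" for u using that assms(2) by (auto simp: flip_def)
    then show ?thesis using determined_up_toD[OF assms(1), of "flip v \<sigma>" \<sigma>] that by simp
  qed
  moreover have "configs \<noteq> ({} :: ('a \<Rightarrow> real) set)" using one_in_configs by blast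
  ultimately show ?thesis unfolding oscillation_def by (simp cong: SUP_cong)
qed

lemma summable_oscillation_sq:
  assumes "local_function f"
  shows "(\<lambda>v. (oscillation v f)\<^sup>2) summable_on UNIV"
proof -
  obtain \<Lambda> where L: "finite \<Lambda>" "determined_up_to 0 \<Lambda> f" using assms by (auto simp: local_function_iff)
  have "(\<lambda>v. (oscillation v f)\<^sup>2) summable_on UNIV \<longleftrightarrow> (\<lambda>v. (oscillation v f)\<^sup>2) summable_on \<Lambda>"
    using oscillation_outside[OF L(2)] by (intro summable_on_cong_neutral) auto
  then show ?thesis using L(1) by simp
qed

lemma GCBD:
  "GCB C \<mu> \<Longrightarrow> local_function f \<Longrightarrow>
     ln (\<integral>\<sigma>. exp (f \<sigma> - (\<integral>\<tau>. f \<tau> \<partial>\<mu>)) \<partial>\<mu>) \<le> C / 2 * osc_norm_sq f"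
  by (simp add: GCB_def)

lemma GCB_imp_quasi_GCB:
  assumes \<mu>: "\<mu> \<in> space (prob_algebra config_space)" and "GCB C \<mu>"
  shows "quasi_GCB C \<mu>"
  unfolding quasi_GCB_def
proof (intro allI impI)
  fix g and d :: "'a \<Rightarrow> real" assume g: "quasi_local g" "osc_le d g" and d: "(\<lambda>v. (d v)\<^sup>2) summable_on UNIV"
  show "(\<integral>\<sigma>. exp (g \<sigma> - (\<integral>\<tau>. g \<tau> \<partial>\<mu>)) \<partial>\<mu>) \<le> exp (C / 2 * (\<Sum>\<^sub>\<infinity>v. (d v)\<^sup>2))"
  proof (rule exp_moment_approx[OF \<mu> g(1)])
    fix \<Lambda> :: "'a set" assume L: "finite \<Lambda>"
    let ?g = "\<lambda>\<sigma>. g (freeze \<Lambda> \<sigma>)"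
    let ?E = "\<integral>\<sigma>. exp (?g \<sigma> - (\<integral>\<tau>. ?g \<tau> \<partial>\<mu>)) \<partial>\<mu>"
    have loc: "local_function ?g" by (rule local_freeze[OF L])
    have pos: "?E > 0" by (rule exp_moment_pos[OF \<mu> quasi_local_local[OF loc]])
    have "osc_norm_sq ?g \<le> (\<Sum>\<^sub>\<infinity>v. (d v)\<^sup>2)"
      unfolding osc_norm_sq_def
      using oscillation_le[OF osc_le_freeze[OF g(2)], of _ \<Lambda>] osc_le_nonneg[OF osc_le_oscillation[OF loc]]
      by (intro infsum_mono summable_oscillation_sq loc d power_mono) auto
    then have "ln ?E \<le> C / 2 * (\<Sum>\<^sub>\<infinity>v. (d v)\<^sup>2)"
      using assms(2) by (intro order_trans[OF GCBD[OF assms(2) loc]] mult_left_mono) (simp_all add: GCB_def)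
    then show "?E \<le> exp (C / 2 * (\<Sum>\<^sub>\<infinity>v. (d v)\<^sup>2))" using pos ln_le_iff_le_exp by blast
  qed
qed

lemma GCB_I:
  assumes \<mu>: "\<mu> \<in> space (prob_algebra config_space)" and C: "C > 0"
    and bound: "\<And>f. local_function f \<Longrightarrow>
      (\<integral>\<sigma>. exp (f \<sigma> - (\<integral>\<tau>. f \<tau> \<partial>\<mu>)) \<partial>\<mu>) \<le> exp (C / 2 * osc_norm_sq f)"
  shows "GCB C \<mu>"
  unfolding GCB_def
  using bound exp_moment_pos[OF \<mu> quasi_local_local] C ln_le_iff_le_exp by blast

section \<open>Products of biased spins\<close>

definition spin :: "real \<Rightarrow> real measure" where
  "spin h = point_measure {-1, 1} (\<lambda>s. ennreal ((1 + s * h) / 2))"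

definition spin_product :: "('v \<Rightarrow> real) \<Rightarrow> ('v \<Rightarrow> real) measure" where
  "spin_product h = PiM UNIV (\<lambda>x. spin (h x))"

text \<open>The conditional mean of \<open>f\<close> given all spins but the one at
  \<open>x\<close>, when that spin is independent with mean \<open>h\<close>.\<close>

definition resample :: "'v \<Rightarrow> real \<Rightarrow> (('v \<Rightarrow> real) \<Rightarrow> real) \<Rightarrow> ('v \<Rightarrow> real) \<Rightarrow> real" where
  "resample x h f \<sigma> = (1 + h) / 2 * f (\<sigma>(x := 1)) + (1 - h) / 2 * f (\<sigma>(x := -1))"

lemma prob_space_spin: "\<bar>h\<bar> \<le> 1 \<Longrightarrow> prob_space (spin h)"
  unfolding spin_def by (rule prob_space_marginal)

lemma spin_product_in_prob_algebra:
  assumes "\<And>x. \<bar>h x\<bar> \<le> 1"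
  shows "spin_product h \<in> space (prob_algebra config_space)"
proof -
  have "prob_space (spin_product h)"
    unfolding spin_product_def using assms by (intro prob_space_PiM prob_space_spin)
  moreover have "sets (spin_product h) = sets config_space"
    unfolding spin_product_def config_space_def by (rule sets_PiM_cong) (auto simp: spin_def sets_point_measure)
  ultimately show ?thesis by (simp add: space_prob_algebra)
qed

lemma integral_spin:
  fixes f :: "real \<Rightarrow> real"
  assumes "\<bar>h\<bar> \<le> 1"
  shows "(\<integral>s. f s \<partial>spin h) = (1 + h) / 2 * f 1 + (1 - h) / 2 * f (-1)"
  unfolding spin_def using assms
  by (subst lebesgue_integral_point_measure_finite) (auto simp: abs_le_iff)

text \<open>Overwriting one coordinate by an independent copy leaves a product measure invariant;
  Fubini then averages that copy first.\<close>

lemma integral_resample: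
  fixes f :: "('v \<Rightarrow> real) \<Rightarrow> real"
  assumes h: "\<And>x. \<bar>h x\<bar> \<le> 1"
    and f: "f \<in> borel_measurable config_space" "\<And>\<sigma>. \<sigma> \<in> configs \<Longrightarrow> \<bar>f \<sigma>\<bar> \<le> B"
  shows "(\<integral>\<sigma>. f \<sigma> \<partial>spin_product h) = (\<integral>\<sigma>. resample x (h x) f \<sigma> \<partial>spin_product h)"
proof -
  let ?M = "\<lambda>x. spin (h x)" let ?P = "spin_product h"
  interpret S: prob_space "spin (h x)" by (rule prob_space_spin[OF h])
  interpret Q: prob_space ?P by (rule prob_algebra_configD(1)[OF spin_product_in_prob_algebra[OF h]])
  interpret pair_prob_space "spin (h x)" ?P ..
  have sP: "sets ?P = sets config_space" "space ?P = configs"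
    by (rule prob_algebra_configD[OF spin_product_in_prob_algebra[OF h]])+
  have sS: "space (spin (h x)) = {-1, 1}" by (simp add: spin_def space_point_measure)
  \<comment> \<open>Since \<open>insert x UNIV\<close> is \<open>UNIV\<close>, the gluing of a new
    coordinate becomes overwriting on one and the same space.\<close>
  have "distr (?M x \<Otimes>\<^sub>M PiM UNIV ?M) (PiM (insert x UNIV) ?M) (\<lambda>(s, X). X(x := s)) = PiM (insert x UNIV) ?M"
    using h by (intro distr_pair_PiM_eq_PiM prob_space_spin)
  then have eq: "distr (?M x \<Otimes>\<^sub>M ?P) ?P (\<lambda>(s, X). X(x := s)) = ?P"
    by (simp add: spin_product_def)
  have upd: "(\<lambda>(s, X). X(x := s)) \<in> measurable (?M x \<Otimes>\<^sub>M ?P) ?P"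
    unfolding spin_product_def
    unfolding case_prod_beta' by (intro measurable_fun_upd[where J=UNIV]) auto
  have fm: "f \<in> borel_measurable ?P" using f(1) by (simp cong: measurable_cong_sets add: sP)
  have "(\<integral>\<sigma>. f \<sigma> \<partial>?P) = (\<integral>\<sigma>. f \<sigma> \<partial>distr (?M x \<Otimes>\<^sub>M ?P) ?P (\<lambda>(s, X). X(x := s)))" by (simp only: eq)
  also have "\<dots> = (\<integral>z. (case z of (s, X) \<Rightarrow> f (X(x := s))) \<partial>(?M x \<Otimes>\<^sub>M ?P))"
    by (subst integral_distr[OF upd fm]) (simp add: case_prod_beta')
  also have "\<dots> = (\<integral>X. (\<integral>s. f (X(x := s)) \<partial>?M x) \<partial>?P)"
  proof (rule integral_snd[symmetric])
    have m: "(\<lambda>(s, X). f (X(x := s))) \<in> borel_measurable (?M x \<Otimes>\<^sub>M ?P)"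
      using measurable_compose[OF upd fm] by (simp add: case_prod_beta')
    show "integrable (?M x \<Otimes>\<^sub>M ?P) (\<lambda>(s, X). f (X(x := s)))"
      using f(2) by (intro integrable_const_bound[where B=B] AE_I2 m)
        (auto simp: space_pair_measure sP sS)
  qed
  also have "\<dots> = (\<integral>\<sigma>. resample x (h x) f \<sigma> \<partial>?P)"
    using h by (simp add: integral_spin resample_def)
  finally show ?thesis .
qed

lemma resample_determined:
  assumes f: "determined_up_to 0 (insert x \<Lambda>) f" and h: "\<bar>h\<bar> \<le> 1"
  shows "determined_up_to 0 \<Lambda> (resample x h f)"
  unfolding determined_up_to_def
proof (intro ballI impI)
  fix \<sigma> \<tau> :: "'a \<Rightarrow> real" assume *: "\<sigma> \<in> configs" "\<tau> \<in> configs" "\<forall>v\<in>\<Lambda>. \<sigma> v = \<tau> v"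
  have "f (\<sigma>(x := s)) = f (\<tau>(x := s))" if "s \<in> {-1, 1}" for s
  proof -
    have "\<bar>f (\<sigma>(x := s)) - f (\<tau>(x := s))\<bar> \<le> 0"
      using * that by (intro determined_up_toD[OF f]) auto
    then show ?thesis by simp
  qed
  then show "\<bar>resample x h f \<sigma> - resample x h f \<tau>\<bar> \<le> 0" by (simp add: resample_def)
qed

text \<open>Away from \<open>x\<close> the flip commutes with the update, so the change is a convex
  combination of changes of \<open>f\<close>; at \<open>x\<close> the flip is invisible.\<close>

lemma osc_le_resample:
  assumes f: "osc_le d f" and h: "\<bar>h\<bar> \<le> 1"
  shows "osc_le d (resample x h f)"
  unfolding osc_le_def
proof (intro allI ballI)
  fix v and \<sigma> :: "'a \<Rightarrow> real" assume \<sigma>: "\<sigma> \<in> configs"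
  show "\<bar>resample x h f (flip v \<sigma>) - resample x h f \<sigma>\<bar> \<le> d v"
  proof (cases "v = x")
    case True
    then show ?thesis using osc_le_nonneg[OF f] by (simp add: resample_def flip_def)
  next
    case False
    have b: "\<bar>f ((flip v \<sigma>)(x := s)) - f (\<sigma>(x := s))\<bar> \<le> d v" if "s \<in> {-1, 1}" for s
    proof -
      have "(flip v \<sigma>)(x := s) = flip v (\<sigma>(x := s))" using False by (auto simp: flip_def)
      then show ?thesis using osc_leD[OF f, of "\<sigma>(x := s)" v] \<sigma> that by simp
    qed
    have "\<bar>resample x h f (flip v \<sigma>) - resample x h f \<sigma>\<bar> =
        \<bar>(1 + h) / 2 * (f ((flip v \<sigma>)(x := 1)) - f (\<sigma>(x := 1))) +
         (1 - h) / 2 * (f ((flip v \<sigma>)(x := -1)) - f (\<sigma>(x := -1)))\<bar>"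
      by (simp add: resample_def algebra_simps)
    also have "\<dots> \<le> (1 + h) / 2 * d v + (1 - h) / 2 * d v"
      using b[of 1] b[of "-1"] h
      by (intro order_trans[OF abs_triangle_ineq] add_mono) (auto simp: abs_mult abs_le_iff intro!: mult_left_mono)
    also have "\<dots> = d v" by (simp add: field_simps)
    finally show ?thesis .
  qed
qed

text \<open>Hoeffding's lemma for a variable with the two values \<open>a\<close> and
  \<open>b\<close>, uncentred: its range is at most \<open>d\<close>, which gives d\<twosuperior> /
  8 in the exponent.\<close>

lemma Hoeffding_two_point:
  fixes a b d h :: real
  assumes "\<bar>a - b\<bar> \<le> d" "\<bar>h\<bar> \<le> 1"
  shows "(1 + h) / 2 * exp a + (1 - h) / 2 * exp b \<le> exp (d\<^sup>2 / 8) * exp ((1 + h) / 2 * a + (1 - h) / 2 * b)"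
proof -
  have *: "p * exp x + (1 - p) * exp y \<le> exp (d\<^sup>2 / 8) * exp (p * x + (1 - p) * y)"
    if "0 \<le> p" "y \<le> x" "x - y \<le> d" for p x y :: real
  proof -
    let ?u = "x - y"
    have e: "1 + p * (exp ?u - 1) \<ge> 1" using that by simp
    have "- ?u * p + ln (1 + p * (exp ?u - 1)) \<le> ?u\<^sup>2 / 8"
      using that by (intro Hoeffdings_lemma_aux) auto
    also have "\<dots> \<le> d\<^sup>2 / 8" using that by (simp add: power_mono)
    finally have "ln (1 + p * (exp ?u - 1)) \<le> d\<^sup>2 / 8 + ?u * p" by linarith
    then have "1 + p * (exp ?u - 1) \<le> exp (d\<^sup>2 / 8 + ?u * p)" using e by (simp add: ln_le_iff_le_exp)
    then have "exp y * (1 + p * (exp ?u - 1)) \<le> exp y * exp (d\<^sup>2 / 8 + ?u * p)" by simp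
    moreover have "exp y * (1 + p * (exp ?u - 1)) = p * exp x + (1 - p) * exp y"
      by (simp add: algebra_simps flip: exp_add)
    moreover have "exp y * exp (d\<^sup>2 / 8 + ?u * p) = exp (d\<^sup>2 / 8) * exp (p * x + (1 - p) * y)"
      by (simp add: algebra_simps flip: exp_add)
    ultimately show ?thesis by simp
  qed
  have c: "1 - (1 + h) / 2 = (1 - h) / 2" "1 - (1 - h) / 2 = (1 + h) / 2" by (simp_all add: field_simps)
  \<comment> \<open>The inequality above orders its two points; the opposite order exchanges them
    together with their probabilities.\<close>
  show ?thesis
  proof (cases "b \<le> a")
    case True
    then show ?thesis using *[of "(1 + h) / 2" b a] assms c by (auto simp: abs_le_iff)
  next
    case False
    then show ?thesis using *[of "(1 - h) / 2" a b] assms c by (auto simp: abs_le_iff add.commute)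
  qed
qed

lemma determined_empty_const:
  assumes "determined_up_to 0 {} f" "\<sigma> \<in> configs"
  shows "f \<sigma> = f (\<lambda>_. 1)"
proof -
  have "\<bar>f \<sigma> - f (\<lambda>_. 1)\<bar> \<le> 0"
    by (rule determined_up_toD[OF assms(1,2) one_in_configs]) simp
  then show ?thesis by simp
qed

lemma local_functionI: "finite \<Lambda> \<Longrightarrow> determined_up_to 0 \<Lambda> f \<Longrightarrow> local_function f"
  by (auto simp: local_function_iff)

lemma integral_resample_quasi_local:
  assumes "\<And>x. \<bar>h x\<bar> \<le> 1" "quasi_local f"
  shows "(\<integral>\<sigma>. f \<sigma> \<partial>spin_product h) = (\<integral>\<sigma>. resample x (h x) f \<sigma> \<partial>spin_product h)"
proof -
  obtain B where "\<And>\<sigma>. \<sigma> \<in> configs \<Longrightarrow> \<bar>f \<sigma>\<bar> \<le> B" by (rule quasi_local_bounded[OF assms(2)]) blast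
  then show ?thesis by (intro integral_resample assms quasi_local_measurable)
qed

lemma osc_le_two_point:
  assumes "osc_le d f" "\<sigma> \<in> configs"
  shows "\<bar>f (\<sigma>(x := 1)) - f (\<sigma>(x := -1))\<bar> \<le> d x"
proof -
  have "flip x (\<sigma>(x := -1)) = \<sigma>(x := 1)" by (simp add: flip_def)
  then show ?thesis using osc_leD[OF assms(1), of "\<sigma>(x := -1)" x] assms(2) by simp
qed

lemma convex_shift:
  fixes a b h m :: real
  shows "(1 + h) / 2 * (a - m) + (1 - h) / 2 * (b - m) = (1 + h) / 2 * a + (1 - h) / 2 * b - m"
  by (simp add: field_simps)

text \<open>Induction on the support: averaging the spin at \<open>x\<close> costs the factor of the
  two-point bound and leaves the exponential of the resampled function, which depends on one site
  fewer.\<close>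

lemma spin_product_exp_moment_local:
  assumes h: "\<And>x. \<bar>h x\<bar> \<le> 1" and "finite \<Lambda>" "determined_up_to 0 \<Lambda> f" "osc_le d f"
  shows "(\<integral>\<sigma>. exp (f \<sigma> - (\<integral>\<tau>. f \<tau> \<partial>spin_product h)) \<partial>spin_product h) \<le> exp (1 / 8 * (\<Sum>v\<in>\<Lambda>. (d v)\<^sup>2))"
  using assms(2-)
proof (induction \<Lambda> arbitrary: f rule: finite_induct)
  let ?P = "spin_product h"
  have P: "?P \<in> space (prob_algebra config_space)" by (rule spin_product_in_prob_algebra[OF h])
  interpret prob_space ?P by (rule prob_algebra_configD(1)[OF P])
  {
    case empty
    have c: "f \<sigma> = f (\<lambda>_. 1)" if "\<sigma> \<in> space ?P" for \<sigma>
      by (rule determined_empty_const[OF empty(1)]) (use that in \<open>simp add: prob_algebra_configD(3)[OF P]\<close>)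
    have "(\<integral>\<tau>. f \<tau> \<partial>?P) = (\<integral>\<tau>. f (\<lambda>_. 1) \<partial>?P)" by (rule Bochner_Integration.integral_cong[OF refl]) (rule c)
    then have m: "(\<integral>\<tau>. f \<tau> \<partial>?P) = f (\<lambda>_. 1)" by (simp add: prob_space)
    have "(\<integral>\<sigma>. exp (f \<sigma> - f (\<lambda>_. 1)) \<partial>?P) = (\<integral>\<sigma>. exp (f (\<lambda>_. 1) - f (\<lambda>_. 1)) \<partial>?P)"
      by (rule Bochner_Integration.integral_cong[OF refl]) (simp only: c)
    then show ?case by (simp add: m prob_space)
  next
    case (insert x \<Lambda>)
    let ?f = "resample x (h x) f" let ?m = "\<integral>\<tau>. f \<tau> \<partial>?P"
    have det: "determined_up_to 0 \<Lambda> ?f" by (rule resample_determined[OF insert.prems(1) h])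
    have ql: "quasi_local f" "quasi_local ?f"
      using quasi_local_local[OF local_functionI[OF _ insert.prems(1)]]
        quasi_local_local[OF local_functionI[OF insert.hyps(1) det]] insert.hyps(1) by simp_all
    \<comment> \<open>Resampling preserves the mean, so the centring constant is the right one for
      the induction hypothesis as well.\<close>
    have m: "(\<integral>\<tau>. ?f \<tau> \<partial>?P) = ?m" by (rule integral_resample_quasi_local[OF h ql(1), symmetric])
    have "(\<integral>\<sigma>. exp (f \<sigma> - ?m) \<partial>?P) = (\<integral>\<sigma>. resample x (h x) (\<lambda>\<sigma>. exp (f \<sigma> - ?m)) \<sigma> \<partial>?P)"
      using quasi_local_exp[OF ql(1), of "- ?m"] by (intro integral_resample_quasi_local h) simp
    also have "\<dots> \<le> (\<integral>\<sigma>. exp ((d x)\<^sup>2 / 8) * exp (?f \<sigma> - ?m) \<partial>?P)"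
    proof (rule integral_mono')
      show "integrable ?P (\<lambda>\<sigma>. exp ((d x)\<^sup>2 / 8) * exp (?f \<sigma> - ?m))"
        using integrable_exp_quasi_local[OF P ql(2)] by simp
      show "0 \<le> exp ((d x)\<^sup>2 / 8) * exp (?f \<sigma> - ?m)" for \<sigma> by simp
      fix \<sigma> assume "\<sigma> \<in> space ?P"
      then have \<sigma>: "\<sigma> \<in> configs" by (simp add: prob_algebra_configD[OF P])
      have "\<bar>f (\<sigma>(x := 1)) - f (\<sigma>(x := -1))\<bar> \<le> d x"
        by (rule osc_le_two_point[OF insert.prems(2) \<sigma>])
      then have "resample x (h x) (\<lambda>\<sigma>. exp (f \<sigma> - ?m)) \<sigma> \<le> exp ((d x)\<^sup>2 / 8) *
          exp ((1 + h x) / 2 * (f (\<sigma>(x := 1)) - ?m) + (1 - h x) / 2 * (f (\<sigma>(x := -1)) - ?m))"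
        unfolding resample_def by (intro Hoeffding_two_point h) simp
      also have "(1 + h x) / 2 * (f (\<sigma>(x := 1)) - ?m) + (1 - h x) / 2 * (f (\<sigma>(x := -1)) - ?m) = ?f \<sigma> - ?m"
        unfolding resample_def by (rule convex_shift)
      finally show "resample x (h x) (\<lambda>\<sigma>. exp (f \<sigma> - ?m)) \<sigma> \<le> exp ((d x)\<^sup>2 / 8) * exp (?f \<sigma> - ?m)" .
    qed
    also have "\<dots> \<le> exp ((d x)\<^sup>2 / 8) * exp (1 / 8 * (\<Sum>v\<in>\<Lambda>. (d v)\<^sup>2))"
      using insert.IH[OF det osc_le_resample[OF insert.prems(2) h]] by (simp add: m)
    also have "\<dots> = exp (1 / 8 * (\<Sum>v\<in>insert x \<Lambda>. (d v)\<^sup>2))"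
      using insert.hyps by (simp add: distrib_left flip: exp_add)
    finally show ?case .
  }
qed

lemma spin_product_exp_moment:
  assumes h: "\<And>x. \<bar>h x\<bar> \<le> 1" and f: "quasi_local f" "osc_le d f" and d: "(\<lambda>v. (d v)\<^sup>2) summable_on UNIV"
  shows "(\<integral>\<sigma>. exp (f \<sigma> - (\<integral>\<tau>. f \<tau> \<partial>spin_product h)) \<partial>spin_product h) \<le> exp (1 / 8 * (\<Sum>\<^sub>\<infinity>v. (d v)\<^sup>2))"
proof (rule exp_moment_approx[OF spin_product_in_prob_algebra[OF h] f(1)])
  fix \<Lambda> :: "'a set" assume L: "finite \<Lambda>"
  have "(\<Sum>v\<in>\<Lambda>. (d v)\<^sup>2) \<le> (\<Sum>\<^sub>\<infinity>v. (d v)\<^sup>2)" using L d by (intro finite_sum_le_infsum) auto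
  then have "exp (1 / 8 * (\<Sum>v\<in>\<Lambda>. (d v)\<^sup>2)) \<le> exp (1 / 8 * (\<Sum>\<^sub>\<infinity>v. (d v)\<^sup>2))" by simp
  then show "(\<integral>\<sigma>. exp (f (freeze \<Lambda> \<sigma>) - (\<integral>\<tau>. f (freeze \<Lambda> \<tau>) \<partial>spin_product h)) \<partial>spin_product h)
      \<le> exp (1 / 8 * (\<Sum>\<^sub>\<infinity>v. (d v)\<^sup>2))"
    by (rule order_trans[OF spin_product_exp_moment_local[OF h L determined_up_to_freeze osc_le_freeze[OF f(2)]]])
qed

text \<open>Two spins of means h and h' are at total variation distance \<bar>h - h'\<bar> / 2; the
  biases are exchanged one site at a time.\<close>

lemma spin_product_diff_local:
  assumes h: "\<And>x. \<bar>h x\<bar> \<le> 1" "\<And>x. \<bar>h' x\<bar> \<le> 1" and "finite \<Lambda>" "determined_up_to 0 \<Lambda> f" "osc_le d f"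
  shows "\<bar>(\<integral>\<sigma>. f \<sigma> \<partial>spin_product h) - (\<integral>\<sigma>. f \<sigma> \<partial>spin_product h')\<bar> \<le> (\<Sum>v\<in>\<Lambda>. d v * (\<bar>h v - h' v\<bar> / 2))"
  using assms(3-)
proof (induction \<Lambda> arbitrary: f rule: finite_induct)
  let ?P = "spin_product h" let ?P' = "spin_product h'"
  have P: "?P \<in> space (prob_algebra config_space)" "?P' \<in> space (prob_algebra config_space)"
    by (rule spin_product_in_prob_algebra[OF h(1)] spin_product_in_prob_algebra[OF h(2)])+
  interpret P: prob_space ?P by (rule prob_algebra_configD(1)[OF P(1)])
  interpret P': prob_space ?P' by (rule prob_algebra_configD(1)[OF P(2)])
  {
    case empty
    have "(\<integral>\<tau>. f \<tau> \<partial>Q) = (\<integral>\<tau>. f (\<lambda>_. 1) \<partial>Q)"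
      if "Q \<in> space (prob_algebra config_space)" for Q
      by (rule Bochner_Integration.integral_cong[OF refl], rule determined_empty_const[OF empty(1)])
        (simp add: prob_algebra_configD(3)[OF that])
    note this[OF P(1)] this[OF P(2)]
    then show ?case by (simp add: P.prob_space P'.prob_space)
  next
    case (insert x \<Lambda>)
    let ?f = "resample x (h x) f" let ?f' = "resample x (h' x) f"
    have det: "determined_up_to 0 \<Lambda> ?f" "determined_up_to 0 \<Lambda> ?f'"
      by (rule resample_determined[OF insert.prems(1)], rule h)+
    have ql: "quasi_local f" "quasi_local ?f" "quasi_local ?f'"
      using quasi_local_local[OF local_functionI[OF _ insert.prems(1)]]
        quasi_local_local[OF local_functionI[OF insert.hyps(1) det(1)]]
        quasi_local_local[OF local_functionI[OF insert.hyps(1) det(2)]] insert.hyps(1) by simp_all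
    \<comment> \<open>Intermediate term: the mean of \<open>?f\<close> under \<open>?P'\<close>.
      Going there from \<open>?P\<close> is the induction hypothesis; going on to \<open>?f'\<close>
      changes only the bias at \<open>x\<close>.\<close>
    have "\<bar>(\<integral>\<sigma>. ?f \<sigma> \<partial>?P') - (\<integral>\<sigma>. ?f' \<sigma> \<partial>?P')\<bar> \<le> d x * (\<bar>h x - h' x\<bar> / 2)"
    proof (intro integral_diff_le[OF P(2)] quasi_local_integrable[OF P(2)] ql)
      fix \<sigma> :: "'a \<Rightarrow> real" assume \<sigma>: "\<sigma> \<in> configs"
      have "\<bar>f (\<sigma>(x := 1)) - f (\<sigma>(x := -1))\<bar> \<le> d x"
        by (rule osc_le_two_point[OF insert.prems(2) \<sigma>])
      moreover have "?f \<sigma> - ?f' \<sigma> = (f (\<sigma>(x := 1)) - f (\<sigma>(x := -1))) * ((h x - h' x) / 2)"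
        by (simp add: resample_def field_simps)
      ultimately show "\<bar>?f \<sigma> - ?f' \<sigma>\<bar> \<le> d x * (\<bar>h x - h' x\<bar> / 2)"
        using mult_right_mono[of _ "d x" "\<bar>(h x - h' x) / 2\<bar>"] by (simp only: abs_mult abs_divide abs_numeral) simp
    qed
    moreover have "\<bar>(\<integral>\<sigma>. ?f \<sigma> \<partial>?P) - (\<integral>\<sigma>. ?f \<sigma> \<partial>?P')\<bar> \<le> (\<Sum>v\<in>\<Lambda>. d v * (\<bar>h v - h' v\<bar> / 2))"
      by (rule insert.IH[OF det(1) osc_le_resample[OF insert.prems(2) h(1)]])
    moreover have "(\<integral>\<sigma>. f \<sigma> \<partial>?P) = (\<integral>\<sigma>. ?f \<sigma> \<partial>?P)" "(\<integral>\<sigma>. f \<sigma> \<partial>?P') = (\<integral>\<sigma>. ?f' \<sigma> \<partial>?P')"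
      by (rule integral_resample_quasi_local, rule h, rule ql)+
    moreover have "(\<Sum>v\<in>insert x \<Lambda>. d v * (\<bar>h v - h' v\<bar> / 2)) =
        d x * (\<bar>h x - h' x\<bar> / 2) + (\<Sum>v\<in>\<Lambda>. d v * (\<bar>h v - h' v\<bar> / 2))"
      using insert.hyps by simp
    ultimately show ?case by linarith
  }
qed

lemma spin_product_diff:
  assumes h: "\<And>x. \<bar>h x\<bar> \<le> 1" "\<And>x. \<bar>h' x\<bar> \<le> 1"
    and f: "quasi_local f" "osc_le d f" and L: "finite \<Lambda>" "determined_up_to \<epsilon> \<Lambda> f"
  shows "\<bar>(\<integral>\<sigma>. f \<sigma> \<partial>spin_product h) - (\<integral>\<sigma>. f \<sigma> \<partial>spin_product h')\<bar> \<le> 2 * \<epsilon> + (\<Sum>v\<in>\<Lambda>. d v * (\<bar>h v - h' v\<bar> / 2))"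
proof -
  have P: "spin_product h \<in> space (prob_algebra config_space)" "spin_product h' \<in> space (prob_algebra config_space)"
    by (rule spin_product_in_prob_algebra[OF h(1)] spin_product_in_prob_algebra[OF h(2)])+
  let ?g = "\<lambda>\<sigma>. f (freeze \<Lambda> \<sigma>)"
  have "quasi_local ?g" using L(1) by (intro quasi_local_local local_freeze)
  then have "\<bar>(\<integral>\<sigma>. ?g \<sigma> \<partial>Q) - (\<integral>\<sigma>. f \<sigma> \<partial>Q)\<bar> \<le> \<epsilon>"
    if "Q \<in> space (prob_algebra config_space)" for Q
    by (rule integral_diff_le[OF that quasi_local_integrable[OF that] quasi_local_integrable[OF that f(1)]])
      (rule freeze_close[OF L(2)])
  note this[OF P(1)] this[OF P(2)]
  moreover have "\<bar>(\<integral>\<sigma>. ?g \<sigma> \<partial>spin_product h) - (\<integral>\<sigma>. ?g \<sigma> \<partial>spin_product h')\<bar> \<le> (\<Sum>v\<in>\<Lambda>. d v * (\<bar>h v - h' v\<bar> / 2))"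
    by (intro spin_product_diff_local h L(1) determined_up_to_freeze osc_le_freeze f(2))
  ultimately show ?thesis by linarith
qed

section \<open>Kernels with quasi-local fields\<close>

text \<open>The first argument drives the kernel, the second is integrated out. The site types
  differ because on path space the first is a space-time configuration and the second a single
  slice.\<close>

definition jointly_determined_up_to ::
  "real \<Rightarrow> 'u set \<Rightarrow> 'v set \<Rightarrow> (('u \<Rightarrow> real) \<Rightarrow> ('v \<Rightarrow> real) \<Rightarrow> real) \<Rightarrow> bool" where
  "jointly_determined_up_to \<epsilon> \<Lambda> \<Lambda>' F \<longleftrightarrow>
     (\<forall>\<tau>\<in>configs. \<forall>\<tau>'\<in>configs. \<forall>\<sigma>\<in>configs. \<forall>\<sigma>'\<in>configs.
        (\<forall>u\<in>\<Lambda>. \<tau> u = \<tau>' u) \<longrightarrow> (\<forall>v\<in>\<Lambda>'. \<sigma> v = \<sigma>' v) \<longrightarrow> \<bar>F \<tau> \<sigma> - F \<tau>' \<sigma>'\<bar> \<le> \<epsilon>)"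

definition jointly_quasi_local :: "(('u \<Rightarrow> real) \<Rightarrow> ('v \<Rightarrow> real) \<Rightarrow> real) \<Rightarrow> bool" where
  "jointly_quasi_local F \<longleftrightarrow>
     (\<forall>\<epsilon>>0. \<exists>\<Lambda> \<Lambda>'. finite \<Lambda> \<and> finite \<Lambda>' \<and> jointly_determined_up_to \<epsilon> \<Lambda> \<Lambda>' F)"

lemma jointly_determined_up_toD:
  "jointly_determined_up_to \<epsilon> \<Lambda> \<Lambda>' F \<Longrightarrow>
     \<tau> \<in> configs \<Longrightarrow> \<tau>' \<in> configs \<Longrightarrow> \<sigma> \<in> configs \<Longrightarrow> \<sigma>' \<in> configs \<Longrightarrow>
     (\<And>u. u \<in> \<Lambda> \<Longrightarrow> \<tau> u = \<tau>' u) \<Longrightarrow> (\<And>v. v \<in> \<Lambda>' \<Longrightarrow> \<sigma> v = \<sigma>' v) \<Longrightarrow> \<bar>F \<tau> \<sigma> - F \<tau>' \<sigma>'\<bar> \<le> \<epsilon>"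
  by (simp add: jointly_determined_up_to_def)

lemma jointly_quasi_localE:
  assumes "jointly_quasi_local F" "\<epsilon> > 0"
  obtains \<Lambda> \<Lambda>' where "finite \<Lambda>" "finite \<Lambda>'" "jointly_determined_up_to \<epsilon> \<Lambda> \<Lambda>' F"
  using assms unfolding jointly_quasi_local_def by blast

lemma jointly_determined_section:
  assumes "jointly_determined_up_to \<epsilon> \<Lambda> \<Lambda>' F" "\<tau> \<in> configs"
  shows "determined_up_to \<epsilon> \<Lambda>' (F \<tau>)"
  unfolding determined_up_to_def
proof (intro ballI impI)
  fix \<sigma> \<sigma>' :: "'b \<Rightarrow> real" assume "\<sigma> \<in> configs" "\<sigma>' \<in> configs" "\<forall>v\<in>\<Lambda>'. \<sigma> v = \<sigma>' v"
  then show "\<bar>F \<tau> \<sigma> - F \<tau> \<sigma>'\<bar> \<le> \<epsilon>"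
    by (intro jointly_determined_up_toD[OF assms(1,2,2)]) simp_all
qed

lemma jointly_quasi_local_section:
  assumes "jointly_quasi_local F" "\<tau> \<in> configs"
  shows "quasi_local (F \<tau>)"
  unfolding quasi_local_def
proof (intro allI impI)
  fix \<epsilon> :: real assume "\<epsilon> > 0"
  then obtain \<Lambda> \<Lambda>' where "finite \<Lambda>'" "jointly_determined_up_to \<epsilon> \<Lambda> \<Lambda>' F"
    by (rule jointly_quasi_localE[OF assms(1)])
  then show "\<exists>\<Lambda>. finite \<Lambda> \<and> determined_up_to \<epsilon> \<Lambda> (F \<tau>)"
    using jointly_determined_section[OF _ assms(2)] by blast
qed

text \<open>Common to the one-step operator and to path space. Up to a small error, finitely many
  sites of the integrated configuration matter, hence finitely many biases, each of them
  quasi-local.\<close>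

lemma kernel_quasi_local:
  assumes F: "jointly_quasi_local F" and b: "\<And>\<tau>. \<tau> \<in> configs \<Longrightarrow> osc_le b (F \<tau>)"
    and H: "\<And>\<tau> v. \<tau> \<in> configs \<Longrightarrow> \<bar>H \<tau> v\<bar> \<le> 1" "\<And>v. quasi_local (\<lambda>\<tau>. H \<tau> v)"
  shows "quasi_local (\<lambda>\<tau>. \<integral>\<sigma>. F \<tau> \<sigma> \<partial>spin_product (H \<tau>))"
  unfolding quasi_local_def
proof (intro allI impI)
  fix \<epsilon> :: real assume e: "\<epsilon> > 0"
  obtain \<Lambda> \<Lambda>' where L: "finite \<Lambda>" "finite \<Lambda>'"
    "jointly_determined_up_to (\<epsilon> / 4) \<Lambda> \<Lambda>' F"
    by (rule jointly_quasi_localE[OF F, of "\<epsilon> / 4"]) (use e in auto)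
  have b0: "b v \<ge> 0" for v by (rule osc_le_nonneg[OF b[OF one_in_configs]])
  \<comment> \<open>The biases then contribute at most \<epsilon> / 4, next to \<epsilon> / 4 from
    \<open>F\<close> and twice \<epsilon> / 4 from freezing; the summand 1 avoids a zero
    denominator.\<close>
  define \<delta> where "\<delta> = \<epsilon> / (2 * (1 + sum b \<Lambda>'))"
  have S: "0 \<le> sum b \<Lambda>'" using b0 by (simp add: sum_nonneg)
  then have \<delta>: "\<delta> > 0" using e by (simp add: \<delta>_def)
  have "\<exists>M. finite M \<and> determined_up_to \<delta> M (\<lambda>\<tau>. H \<tau> v)" for v
    using H(2) \<delta> by (auto simp: quasi_local_def)
  then obtain M where M: "\<And>v. finite (M v)" "\<And>v. determined_up_to \<delta> (M v) (\<lambda>\<tau>. H \<tau> v)" by metis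
  have "determined_up_to \<epsilon> (\<Lambda> \<union> (\<Union>v\<in>\<Lambda>'. M v)) (\<lambda>\<tau>. \<integral>\<sigma>. F \<tau> \<sigma> \<partial>spin_product (H \<tau>))"
    unfolding determined_up_to_def
  proof (intro ballI impI)
    fix \<tau> \<tau>' :: "'a \<Rightarrow> real"
    assume \<tau>: "\<tau> \<in> configs" "\<tau>' \<in> configs" "\<forall>v\<in>\<Lambda> \<union> (\<Union>v\<in>\<Lambda>'. M v). \<tau> v = \<tau>' v"
    have P: "spin_product (H \<tau>) \<in> space (prob_algebra config_space)"
      by (rule spin_product_in_prob_algebra[OF H(1)[OF \<tau>(1)]])
    have ql: "quasi_local (F \<tau>)" "quasi_local (F \<tau>')"
      by (rule jointly_quasi_local_section[OF F], fact)+
    have "\<bar>(\<integral>\<sigma>. F \<tau> \<sigma> \<partial>spin_product (H \<tau>)) - (\<integral>\<sigma>. F \<tau>' \<sigma> \<partial>spin_product (H \<tau>))\<bar> \<le> \<epsilon> / 4"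
      using \<tau> by (intro integral_diff_le[OF P] quasi_local_integrable[OF P] ql jointly_determined_up_toD[OF L(3)]) auto
    moreover have "\<bar>(\<integral>\<sigma>. F \<tau>' \<sigma> \<partial>spin_product (H \<tau>)) - (\<integral>\<sigma>. F \<tau>' \<sigma> \<partial>spin_product (H \<tau>'))\<bar>
        \<le> 2 * (\<epsilon> / 4) + (\<Sum>v\<in>\<Lambda>'. b v * (\<bar>H \<tau> v - H \<tau>' v\<bar> / 2))"
      by (rule spin_product_diff[OF H(1)[OF \<tau>(1)] H(1)[OF \<tau>(2)] ql(2) b[OF \<tau>(2)] L(2)
        jointly_determined_section[OF L(3) \<tau>(2)]])
    moreover have "(\<Sum>v\<in>\<Lambda>'. b v * (\<bar>H \<tau> v - H \<tau>' v\<bar> / 2)) \<le> (\<Sum>v\<in>\<Lambda>'. b v * (\<delta> / 2))"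
    proof (intro sum_mono mult_left_mono b0 divide_right_mono)
      fix v assume "v \<in> \<Lambda>'"
      then show "\<bar>H \<tau> v - H \<tau>' v\<bar> \<le> \<delta>" using \<tau> by (intro determined_up_toD[OF M(2)]) auto
    qed simp
    moreover have "(\<Sum>v\<in>\<Lambda>'. b v * (\<delta> / 2)) = sum b \<Lambda>' * \<delta> / 2" by (simp add: sum_distrib_right)
    moreover have "sum b \<Lambda>' * \<delta> / 2 \<le> \<epsilon> / 4"
      using S e by (simp add: \<delta>_def field_simps)
    ultimately show "\<bar>(\<integral>\<sigma>. F \<tau> \<sigma> \<partial>spin_product (H \<tau>)) - (\<integral>\<sigma>. F \<tau>' \<sigma> \<partial>spin_product (H \<tau>'))\<bar> \<le> \<epsilon>"
      by linarith
  qed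
  moreover have "finite (\<Lambda> \<union> (\<Union>v\<in>\<Lambda>'. M v))" using L M by auto
  ultimately show "\<exists>\<Lambda>. finite \<Lambda> \<and> determined_up_to \<epsilon> \<Lambda> (\<lambda>\<tau>. \<integral>\<sigma>. F \<tau> \<sigma> \<partial>spin_product (H \<tau>))" by blast
qed

text \<open>Flipping \<open>u\<close> acts directly through \<open>F\<close>, which costs
  \<open>a\<close>, and through the kernel. A bias change of up to \<open>2 * c u v\<close> is a
  total variation change of up to \<open>c u v\<close>, whence the factor 2 in the
  hypothesis.\<close>

lemma kernel_osc_le:
  assumes F: "jointly_quasi_local F" and b: "\<And>\<tau>. \<tau> \<in> configs \<Longrightarrow> osc_le b (F \<tau>)"
    and a: "\<And>\<sigma>. \<sigma> \<in> configs \<Longrightarrow> osc_le a (\<lambda>\<tau>. F \<tau> \<sigma>)"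
    and H: "\<And>\<tau> v. \<tau> \<in> configs \<Longrightarrow> \<bar>H \<tau> v\<bar> \<le> 1" "\<And>v. osc_le (\<lambda>u. 2 * c u v) (\<lambda>\<tau>. H \<tau> v)"
    and sum: "\<And>u. (\<lambda>v. c u v * b v) summable_on UNIV"
  shows "osc_le (\<lambda>u. a u + (\<Sum>\<^sub>\<infinity>v. c u v * b v)) (\<lambda>\<tau>. \<integral>\<sigma>. F \<tau> \<sigma> \<partial>spin_product (H \<tau>))"
  unfolding osc_le_def
proof (intro allI ballI)
  fix u and \<tau> :: "'a \<Rightarrow> real" assume \<tau>: "\<tau> \<in> configs"
  let ?\<tau> = "flip u \<tau>"
  have \<tau>': "?\<tau> \<in> configs" using \<tau> by simp
  have b0: "b v \<ge> 0" for v by (rule osc_le_nonneg[OF b[OF one_in_configs]])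
  have c0: "c u v \<ge> 0" for v using osc_le_nonneg[OF H(2)[of v], of u] by simp
  have ql: "quasi_local (F \<tau>)" "quasi_local (F ?\<tau>)"
    by (rule jointly_quasi_local_section[OF F], fact)+
  have P: "spin_product (H ?\<tau>) \<in> space (prob_algebra config_space)"
    by (rule spin_product_in_prob_algebra[OF H(1)[OF \<tau>']])
  have 1: "\<bar>(\<integral>\<sigma>. F ?\<tau> \<sigma> \<partial>spin_product (H ?\<tau>)) - (\<integral>\<sigma>. F \<tau> \<sigma> \<partial>spin_product (H ?\<tau>))\<bar> \<le> a u"
    by (rule integral_diff_le[OF P quasi_local_integrable[OF P ql(2)] quasi_local_integrable[OF P ql(1)]])
      (rule osc_leD[OF a \<tau>])
  have 2: "\<bar>(\<integral>\<sigma>. F \<tau> \<sigma> \<partial>spin_product (H ?\<tau>)) - (\<integral>\<sigma>. F \<tau> \<sigma> \<partial>spin_product (H \<tau>))\<bar>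
      \<le> (\<Sum>\<^sub>\<infinity>v. c u v * b v)"
  proof (rule field_le_epsilon)
    fix e :: real assume "e > 0"
    then have "e / 2 > 0" by simp
    then obtain \<Lambda> where L: "finite \<Lambda>" "determined_up_to (e / 2) \<Lambda> (F \<tau>)"
      by (rule quasi_localE[OF ql(1)])
    have "\<bar>(\<integral>\<sigma>. F \<tau> \<sigma> \<partial>spin_product (H ?\<tau>)) - (\<integral>\<sigma>. F \<tau> \<sigma> \<partial>spin_product (H \<tau>))\<bar>
      \<le> 2 * (e / 2) + (\<Sum>v\<in>\<Lambda>. b v * (\<bar>H ?\<tau> v - H \<tau> v\<bar> / 2))"
      by (rule spin_product_diff[OF H(1)[OF \<tau>'] H(1)[OF \<tau>] ql(1) b[OF \<tau>] L])
    also have "(\<Sum>v\<in>\<Lambda>. b v * (\<bar>H ?\<tau> v - H \<tau> v\<bar> / 2)) \<le> (\<Sum>v\<in>\<Lambda>. c u v * b v)"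
    proof (rule sum_mono)
      fix v
      have "b v * (\<bar>H ?\<tau> v - H \<tau> v\<bar> / 2) \<le> b v * c u v"
        using osc_leD[OF H(2)[of v] \<tau>, of u] by (intro mult_left_mono b0) simp
      then show "b v * (\<bar>H ?\<tau> v - H \<tau> v\<bar> / 2) \<le> c u v * b v" by (simp add: mult.commute)
    qed
    also have "\<dots> \<le> (\<Sum>\<^sub>\<infinity>v. c u v * b v)"
      using b0 c0 L(1) sum by (intro finite_sum_le_infsum) auto
    finally show "\<bar>(\<integral>\<sigma>. F \<tau> \<sigma> \<partial>spin_product (H ?\<tau>)) - (\<integral>\<sigma>. F \<tau> \<sigma> \<partial>spin_product (H \<tau>))\<bar>
      \<le> (\<Sum>\<^sub>\<infinity>v. c u v * b v) + e" by simp
  qed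
  show "\<bar>(\<integral>\<sigma>. F ?\<tau> \<sigma> \<partial>spin_product (H ?\<tau>)) - (\<integral>\<sigma>. F \<tau> \<sigma> \<partial>spin_product (H \<tau>))\<bar>
      \<le> a u + (\<Sum>\<^sub>\<infinity>v. c u v * b v)"
    using 1 2 by linarith
qed

section \<open>Convolution with a summable kernel\<close>

text \<open>Tonelli for unordered sums; summability of the columns is part of the conclusion, not an
  assumption.\<close>

lemma nonneg_has_sum_swap:
  fixes f :: "'a \<Rightarrow> 'b \<Rightarrow> real"
  assumes row: "\<And>x. x \<in> A \<Longrightarrow> (f x has_sum g x) B" and g: "(g has_sum S) A"
    and nonneg: "\<And>x y. x \<in> A \<Longrightarrow> y \<in> B \<Longrightarrow> 0 \<le> f x y"
  shows "\<And>y. y \<in> B \<Longrightarrow> (\<lambda>x. f x y) summable_on A" "((\<lambda>y. \<Sum>\<^sub>\<infinity>x\<in>A. f x y) has_sum S) B"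
proof -
  let ?F = "\<lambda>(x, y). f x y"
  have "?F summable_on A \<times> B"
    using row has_sum_imp_summable[OF g] nonneg by (intro summable_on_SigmaI[where g=g]) auto
  then have "(?F has_sum S) (A \<times> B)"
    using row g by (intro has_sum_SigmaI) auto
  then have sw: "((\<lambda>(y, x). f x y) has_sum S) (B \<times> A)"
    using has_sum_swap[where f="?F" and S=S and A=A and B=B] by simp
  have col: "(\<lambda>x. f x y) summable_on A" if "y \<in> B" for y
    using summable_on_SigmaD1[OF has_sum_imp_summable[OF sw] that] .
  show "y \<in> B \<Longrightarrow> (\<lambda>x. f x y) summable_on A" for y by (rule col)
  show "((\<lambda>y. \<Sum>\<^sub>\<infinity>x\<in>A. f x y) has_sum S) B"
    by (rule has_sum_SigmaD[OF sw]) (use col in auto)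
qed

text \<open>Translation invariance gives every row the mass \<open>\<gamma> * e x\<close>; then
  swap. It serves both for the contraction of summable profiles and, applied to squares, for the
  square-summable ones.\<close>

lemma convolution_has_sum:
  fixes c e :: "'a::ab_group_add \<Rightarrow> real"
  assumes c: "(c has_sum \<gamma>) UNIV" "\<And>x. 0 \<le> c x" and e: "(e has_sum E) UNIV" "\<And>x. 0 \<le> e x"
  shows "\<And>y. (\<lambda>x. c (y - x) * e x) summable_on UNIV"
    "((\<lambda>y. \<Sum>\<^sub>\<infinity>x. c (y - x) * e x) has_sum \<gamma> * E) UNIV"
proof -
  have row: "((\<lambda>y. c (y - x) * e x) has_sum \<gamma> * e x) UNIV" for x
  proof (rule has_sum_cmult_left)
    have "bij_betw (\<lambda>y. y - x) UNIV UNIV"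
      by (rule bij_betw_byWitness[where f'="\<lambda>y. y + x"]) auto
    then show "((\<lambda>y. c (y - x)) has_sum \<gamma>) UNIV"
      using c(1) by (simp add: has_sum_reindex_bij_betw[where f=c])
  qed
  have tot: "((\<lambda>x. \<gamma> * e x) has_sum \<gamma> * E) UNIV" by (rule has_sum_cmult_right[OF e(1)])
  note sw = nonneg_has_sum_swap[where f="\<lambda>x y. c (y - x) * e x", OF row tot]
  show "(\<lambda>x. c (y - x) * e x) summable_on UNIV" for y
    using c(2) e(2) by (intro sw(1)) auto
  show "((\<lambda>y. \<Sum>\<^sub>\<infinity>x. c (y - x) * e x) has_sum \<gamma> * E) UNIV"
    using c(2) e(2) by (intro sw(2)) auto
qed

text \<open>Jensen for the square under the probability giving mass \<open>w x\<close> to the value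
  \<open>d x\<close> and mass 1 - \<gamma> to the value a / (1 - \<gamma>), whose mean is the
  left-hand side before squaring.\<close>

lemma weighted_sum_square_le:
  fixes w d :: "'a \<Rightarrow> real"
  assumes w: "(w has_sum \<gamma>) UNIV" "\<And>x. 0 \<le> w x" and \<gamma>: "\<gamma> < 1"
    and wd2: "(\<lambda>x. w x * (d x)\<^sup>2) summable_on UNIV" and d: "\<And>x. 0 \<le> d x"
  shows "(\<lambda>x. w x * d x) summable_on UNIV"
    "(a + (\<Sum>\<^sub>\<infinity>x. w x * d x))\<^sup>2 \<le> a\<^sup>2 / (1 - \<gamma>) + (\<Sum>\<^sub>\<infinity>x. w x * (d x)\<^sup>2)"
proof -
  have "(\<lambda>x. w x + w x * (d x)\<^sup>2) summable_on UNIV"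
    using has_sum_imp_summable[OF w(1)] wd2 by (rule summable_on_add)
  then show wd: "(\<lambda>x. w x * d x) summable_on UNIV"
  proof (rule summable_on_comparison_test)
    fix x
    \<comment> \<open>From (d - 1/2)\<twosuperior> \<ge> 0; thus w d is dominated by the summable w
      + w d\<twosuperior>.\<close>
    have "d x \<le> 1 + (d x)\<^sup>2" using zero_le_power2[of "d x - 1 / 2"] by (simp add: power2_eq_square algebra_simps)
    then have "w x * d x \<le> w x * (1 + (d x)\<^sup>2)" using w(2) by (rule mult_left_mono)
    then show "w x * d x \<le> w x + w x * (d x)\<^sup>2" by (simp add: algebra_simps)
  qed (simp add: w d)
  define S where "S = (\<Sum>\<^sub>\<infinity>x. w x * d x)"
  define Q where "Q = (\<Sum>\<^sub>\<infinity>x. w x * (d x)\<^sup>2)"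
  \<comment> \<open>\<open>T\<close> is the mean in question; the claim is that the variance around
    it, split into the part from \<open>w\<close> and the part from the extra mass, is
    nonnegative.\<close>
  define T where "T = a + S"
  have "((\<lambda>x. w x * (d x)\<^sup>2 + ((- 2 * T) * (w x * d x) + T\<^sup>2 * w x)) has_sum (Q + ((- 2 * T) * S + T\<^sup>2 * \<gamma>))) UNIV"
    unfolding Q_def S_def using wd wd2 w(1)
    by (intro has_sum_add has_sum_cmult_right has_sum_infsum) auto
  moreover have "0 \<le> w x * (d x)\<^sup>2 + ((- 2 * T) * (w x * d x) + T\<^sup>2 * w x)" for x
  proof -
    have "0 \<le> w x * (d x - T)\<^sup>2" using w(2) by simp
    also have "\<dots> = w x * (d x)\<^sup>2 + ((- 2 * T) * (w x * d x) + T\<^sup>2 * w x)"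
      by (simp add: power2_eq_square algebra_simps)
    finally show ?thesis .
  qed
  ultimately have "0 \<le> Q + ((- 2 * T) * S + T\<^sup>2 * \<gamma>)" by (rule has_sum_nonneg) 
  moreover have "a\<^sup>2 / (1 - \<gamma>) - 2 * T * a + (1 - \<gamma>) * T\<^sup>2 = (a - (1 - \<gamma>) * T)\<^sup>2 / (1 - \<gamma>)"
    using \<gamma> by (simp add: power2_eq_square field_simps)
  moreover have "0 \<le> (a - (1 - \<gamma>) * T)\<^sup>2 / (1 - \<gamma>)" using \<gamma> by simp
  moreover have "2 * T * S = 2 * T\<^sup>2 - 2 * T * a" by (simp add: T_def power2_eq_square algebra_simps)
  moreover have "(1 - \<gamma>) * T\<^sup>2 = T\<^sup>2 - T\<^sup>2 * \<gamma>" by (simp add: algebra_simps)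
  ultimately have "T\<^sup>2 \<le> a\<^sup>2 / (1 - \<gamma>) + Q" by linarith
  then show "(a + (\<Sum>\<^sub>\<infinity>x. w x * d x))\<^sup>2 \<le> a\<^sup>2 / (1 - \<gamma>) + (\<Sum>\<^sub>\<infinity>x. w x * (d x)\<^sup>2)"
    by (simp add: T_def S_def Q_def)
qed

text \<open>The pointwise bound with weights \<open>c (y - x)\<close>, summed over y: the
  convolution with the squares of \<open>d\<close> has mass \<gamma> times their sum.\<close>

lemma convolution_square_sum:
  fixes a c d :: "'a::ab_group_add \<Rightarrow> real"
  assumes c: "(c has_sum \<gamma>) UNIV" "\<And>x. 0 \<le> c x" and \<gamma>: "\<gamma> < 1"
    and a: "(\<lambda>x. (a x)\<^sup>2) summable_on UNIV"
    and d: "(\<lambda>x. (d x)\<^sup>2) summable_on UNIV" "\<And>x. 0 \<le> d x"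
  shows "\<And>y. (\<lambda>x. c (y - x) * d x) summable_on UNIV"
    "(\<lambda>y. (a y + (\<Sum>\<^sub>\<infinity>x. c (y - x) * d x))\<^sup>2) summable_on UNIV"
    "(\<Sum>\<^sub>\<infinity>y. (a y + (\<Sum>\<^sub>\<infinity>x. c (y - x) * d x))\<^sup>2) \<le> (\<Sum>\<^sub>\<infinity>y. (a y)\<^sup>2) / (1 - \<gamma>) + \<gamma> * (\<Sum>\<^sub>\<infinity>y. (d y)\<^sup>2)"
proof -
  have cy: "((\<lambda>x. c (y - x)) has_sum \<gamma>) UNIV" for y
  proof -
    have "bij_betw (\<lambda>x. y - x) UNIV UNIV"
      by (rule bij_betw_byWitness[where f'="\<lambda>x. y - x"]) auto
    then show ?thesis using c(1) by (simp add: has_sum_reindex_bij_betw[where f=c])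
  qed
  note cv = convolution_has_sum[OF c has_sum_infsum[OF d(1)] zero_le_power2]
  note sq = weighted_sum_square_le[OF cy c(2) \<gamma> cv(1) d(2)]
  show "(\<lambda>x. c (y - x) * d x) summable_on UNIV" for y by (rule sq(1))
  have bd: "((\<lambda>y. (a y)\<^sup>2 / (1 - \<gamma>) + (\<Sum>\<^sub>\<infinity>x. c (y - x) * (d x)\<^sup>2)) has_sum
      ((\<Sum>\<^sub>\<infinity>y. (a y)\<^sup>2) / (1 - \<gamma>) + \<gamma> * (\<Sum>\<^sub>\<infinity>y. (d y)\<^sup>2))) UNIV"
    by (intro has_sum_add cv(2) has_sum_divide_const has_sum_infsum a)
  show s: "(\<lambda>y. (a y + (\<Sum>\<^sub>\<infinity>x. c (y - x) * d x))\<^sup>2) summable_on UNIV"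
    by (rule summable_on_comparison_test[OF has_sum_imp_summable[OF bd] sq(2)]) simp
  show "(\<Sum>\<^sub>\<infinity>y. (a y + (\<Sum>\<^sub>\<infinity>x. c (y - x) * d x))\<^sup>2) \<le> (\<Sum>\<^sub>\<infinity>y. (a y)\<^sup>2) / (1 - \<gamma>) + \<gamma> * (\<Sum>\<^sub>\<infinity>y. (d y)\<^sup>2)"
    by (rule has_sum_mono[OF has_sum_infsum[OF s] bd sq(2)])
qed

section \<open>The local field\<close>

definition influence :: "((int ^ 'd) set \<Rightarrow> real) \<Rightarrow> int ^ 'd \<Rightarrow> real" where
  "influence r z = (\<Sum>\<^sub>\<infinity>A\<in>{A. finite A}. of_bool (z \<in> A) * \<bar>r A\<bar>)"

definition total_influence :: "((int ^ 'd) set \<Rightarrow> real) \<Rightarrow> real" where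
  "total_influence r = (\<Sum>\<^sub>\<infinity>A\<in>{A. finite A}. real (card A) * \<bar>r A\<bar>)"

lemma total_influence_less_1:
  assumes "contractive r"
  shows "total_influence r < 1"
  using assms abs_square_less_1[of "total_influence r"] by (simp add: contractive_def total_influence_def)

text \<open>Double counting: a set \<open>A\<close> is counted once for each of its
  \<open>card A\<close> elements.\<close>

lemma influence_has_sum:
  assumes "contractive r"
  shows "(influence r has_sum total_influence r) UNIV"
proof -
  have row: "((\<lambda>z. of_bool (z \<in> A) * \<bar>r A\<bar>) has_sum real (card A) * \<bar>r A\<bar>) UNIV" if "A \<in> {A. finite A}" for A
    using that by (intro has_sum_finite_neutralI[where B=A]) auto
  have "((\<lambda>A. real (card A) * \<bar>r A\<bar>) has_sum total_influence r) {A. finite A}"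
    unfolding total_influence_def using assms by (intro has_sum_infsum) (simp add: contractive_def)
  from nonneg_has_sum_swap(2)[OF row this] show ?thesis
    by (simp add: influence_def[abs_def])
qed

lemma influence_nonneg: "0 \<le> influence r z"
  unfolding influence_def by (intro infsum_nonneg) auto

lemma total_influence_nonneg: "0 \<le> total_influence r"
  unfolding total_influence_def by (intro infsum_nonneg) auto

text \<open>Terms whose translated set meets no discrepancy cancel; any other term moves by at most
  twice its coefficient. Both the flip estimate and quasi-locality follow from this.\<close>

lemma local_field_diff:
  fixes r :: "(int ^ 'd::finite) set \<Rightarrow> real"
  assumes r: "(\<lambda>A. \<bar>r A\<bar>) summable_on {A. finite A}" and \<eta>: "\<eta> \<in> configs" "\<eta>' \<in> configs"
  shows "\<bar>local_field r x \<eta> - local_field r x \<eta>'\<bar>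
    \<le> 2 * (\<Sum>\<^sub>\<infinity>A\<in>{A. finite A}. of_bool (\<exists>a\<in>A. \<eta> (a + x) \<noteq> \<eta>' (a + x)) * \<bar>r A\<bar>)"
proof -
  let ?t = "\<lambda>\<eta> A. r A * (\<Prod>y\<in>(\<lambda>a. a + x) ` A. \<eta> y)"
  let ?b = "\<lambda>A. of_bool (\<exists>a\<in>A. \<eta> (a + x) \<noteq> \<eta>' (a + x)) * \<bar>r A\<bar>"
  have t: "?t \<zeta> summable_on {A. finite A}" if "\<zeta> \<in> configs" for \<zeta>
    by (rule abs_summable_summable) (simp add: abs_mult abs_prod_configs[OF that] r)
  have b: "?b summable_on {A. finite A}"
    by (rule summable_on_comparison_test[OF r]) auto
  have "((\<lambda>A. ?t \<eta> A - ?t \<eta>' A) has_sum (local_field r x \<eta> - local_field r x \<eta>')) {A. finite A}"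
    unfolding local_field_def diff_conv_add_uminus
    by (intro has_sum_add iffD2[OF has_sum_uminus] has_sum_infsum) (simp_all add: t \<eta>)
  moreover have "((\<lambda>A. 2 * ?b A) has_sum (2 * (\<Sum>\<^sub>\<infinity>A\<in>{A. finite A}. ?b A))) {A. finite A}"
    by (intro has_sum_cmult_right has_sum_infsum b)
  moreover have "norm (?t \<eta> A - ?t \<eta>' A) \<le> 2 * ?b A" for A
  proof (cases "\<exists>a\<in>A. \<eta> (a + x) \<noteq> \<eta>' (a + x)")
    case True
    have "\<bar>?t \<eta> A - ?t \<eta>' A\<bar> \<le> \<bar>?t \<eta> A\<bar> + \<bar>?t \<eta>' A\<bar>" by (rule abs_triangle_ineq4)
    also have "\<dots> = 2 * \<bar>r A\<bar>" by (simp add: abs_mult abs_prod_configs \<eta>)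
    finally show ?thesis using True by simp
  next
    case False
    then have "(\<Prod>y\<in>(\<lambda>a. a + x) ` A. \<eta> y) = (\<Prod>y\<in>(\<lambda>a. a + x) ` A. \<eta>' y)"
      by (intro prod.cong) auto
    then show ?thesis by simp
  qed
  ultimately show ?thesis using norm_infsum_le by fastforce
qed

text \<open>The spin at \<open>y\<close> enters the field at \<open>x\<close> through the sets
  containing \<open>y - x\<close>; a flip reverses the sign of those terms, whence the factor
  2.\<close>

lemma osc_le_local_field:
  fixes r :: "(int ^ 'd::finite) set \<Rightarrow> real"
  assumes "pca_coefficients r"
  shows "osc_le (\<lambda>y. 2 * influence r (y - x)) (local_field r x)"
  unfolding osc_le_def
proof (intro allI ballI)
  fix y and \<eta> :: "int ^ 'd \<Rightarrow> real" assume \<eta>: "\<eta> \<in> configs"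
  have r: "(\<lambda>A. \<bar>r A\<bar>) summable_on {A. finite A}" using assms by (simp add: pca_coefficients_def)
  have "\<bar>local_field r x (flip y \<eta>) - local_field r x \<eta>\<bar>
    \<le> 2 * (\<Sum>\<^sub>\<infinity>A\<in>{A. finite A}. of_bool (\<exists>a\<in>A. flip y \<eta> (a + x) \<noteq> \<eta> (a + x)) * \<bar>r A\<bar>)"
    using \<eta> by (intro local_field_diff r) auto
  also have "\<dots> \<le> 2 * influence r (y - x)"
    unfolding influence_def
  proof (intro mult_left_mono infsum_mono)
    show "(\<lambda>A. of_bool (\<exists>a\<in>A. flip y \<eta> (a + x) \<noteq> \<eta> (a + x)) * \<bar>r A\<bar>) summable_on {A. finite A}"
      "(\<lambda>A. of_bool (y - x \<in> A) * \<bar>r A\<bar>) summable_on {A. finite A}"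
      by (auto intro!: summable_on_comparison_test[OF r])
    fix A :: "(int ^ 'd) set"
    have "y - x \<in> A" if "a \<in> A" "flip y \<eta> (a + x) \<noteq> \<eta> (a + x)" for a
      using that by (auto simp: flip_def split: if_splits)
    then show "of_bool (\<exists>a\<in>A. flip y \<eta> (a + x) \<noteq> \<eta> (a + x)) * \<bar>r A\<bar> \<le> of_bool (y - x \<in> A) * \<bar>r A\<bar>"
      by (intro mult_right_mono) auto
  qed simp
  finally show "\<bar>local_field r x (flip y \<eta>) - local_field r x \<eta>\<bar> \<le> 2 * influence r (y - x)" .
qed

lemma quasi_local_local_field:
  fixes r :: "(int ^ 'd::finite) set \<Rightarrow> real"
  assumes "pca_coefficients r"
  shows "quasi_local (local_field r x)"
  unfolding quasi_local_def
proof (intro allI impI)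
  fix \<epsilon> :: real assume e: "\<epsilon> > 0"
  let ?F = "{A :: (int ^ 'd) set. finite A}"
  have r: "(\<lambda>A. \<bar>r A\<bar>) summable_on ?F" using assms by (simp add: pca_coefficients_def)
  \<comment> \<open>All but \<epsilon> / 2 of the total coefficient mass sits on \<open>G\<close>;
    the tail enters the field difference with the factor 2.\<close>
  obtain G where G: "finite G" "G \<subseteq> ?F" "dist (\<Sum>A\<in>G. \<bar>r A\<bar>) (\<Sum>\<^sub>\<infinity>A\<in>?F. \<bar>r A\<bar>) \<le> \<epsilon> / 2"
    using infsum_finite_approximation[OF r, of "\<epsilon> / 2"] e by auto
  have "(\<Sum>\<^sub>\<infinity>A\<in>?F - G. \<bar>r A\<bar>) = (\<Sum>\<^sub>\<infinity>A\<in>?F. \<bar>r A\<bar>) - (\<Sum>A\<in>G. \<bar>r A\<bar>)"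
    using G by (subst infsum_Diff[OF r]) auto
  then have tail: "(\<Sum>\<^sub>\<infinity>A\<in>?F - G. \<bar>r A\<bar>) \<le> \<epsilon> / 2" using G(3) unfolding dist_real_def by linarith
  let ?\<Lambda> = "\<Union>A\<in>G. (\<lambda>a. a + x) ` A"
  have "determined_up_to \<epsilon> ?\<Lambda> (local_field r x)"
    unfolding determined_up_to_def
  proof (intro ballI impI)
    fix \<eta> \<eta>' :: "int ^ 'd \<Rightarrow> real" assume \<eta>: "\<eta> \<in> configs" "\<eta>' \<in> configs" "\<forall>v\<in>?\<Lambda>. \<eta> v = \<eta>' v"
    let ?b = "\<lambda>A. of_bool (\<exists>a\<in>A. \<eta> (a + x) \<noteq> \<eta>' (a + x)) * \<bar>r A\<bar>"
    have "(\<Sum>\<^sub>\<infinity>A\<in>?F. ?b A) \<le> (\<Sum>\<^sub>\<infinity>A\<in>?F - G. \<bar>r A\<bar>)"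
    proof (rule infsum_mono_neutral)
      show "?b summable_on ?F" by (rule summable_on_comparison_test[OF r]) auto
      show "(\<lambda>A. \<bar>r A\<bar>) summable_on ?F - G" by (rule summable_on_subset[OF r]) auto
      show "?b A \<le> 0" if "A \<in> ?F - (?F - G)" for A using that \<eta>(3) by auto
    qed auto
    then show "\<bar>local_field r x \<eta> - local_field r x \<eta>'\<bar> \<le> \<epsilon>"
      using local_field_diff[OF r \<eta>(1,2), of x] tail by linarith
  qed
  moreover have "finite ?\<Lambda>" using G by auto
  ultimately show "\<exists>\<Lambda>. finite \<Lambda> \<and> determined_up_to \<epsilon> \<Lambda> (local_field r x)" by blast
qed

section \<open>The one-step operator\<close>

lemma pca_kernel_eq: "pca_kernel r \<eta> = spin_product (\<lambda>x. local_field r x \<eta>)"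
  by (simp add: pca_kernel_def spin_product_def spin_def)

lemma abs_local_field_le: "pca_coefficients r \<Longrightarrow> \<eta> \<in> configs \<Longrightarrow> \<bar>local_field r x \<eta>\<bar> \<le> 1"
  by (simp add: pca_coefficients_def)

definition pca_step :: "((int ^ 'd) set \<Rightarrow> real) \<Rightarrow> ((int ^ 'd \<Rightarrow> real) \<Rightarrow> real) \<Rightarrow> (int ^ 'd \<Rightarrow> real) \<Rightarrow> real" where
  "pca_step r g \<eta> = (\<integral>\<sigma>. g \<sigma> \<partial>pca_kernel r \<eta>)"

lemma jointly_quasi_local_const:
  assumes "quasi_local g"
  shows "jointly_quasi_local (\<lambda>_. g)"
  using assms unfolding jointly_quasi_local_def jointly_determined_up_to_def quasi_local_def determined_up_to_def
  by (metis finite.emptyI)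

lemma quasi_local_pca_step:
  fixes r :: "(int ^ 'd::finite) set \<Rightarrow> real"
  assumes r: "pca_coefficients r" and g: "quasi_local g"
  shows "quasi_local (pca_step r g)"
proof -
  obtain B where "osc_le (\<lambda>_. B) g" by (rule quasi_local_osc_le[OF g])
  then have "quasi_local (\<lambda>\<eta>. \<integral>\<sigma>. g \<sigma> \<partial>spin_product ((\<lambda>\<eta> x. local_field r x \<eta>) \<eta>))"
    using r g by (intro kernel_quasi_local jointly_quasi_local_const quasi_local_local_field abs_local_field_le) auto
  then show ?thesis by (simp add: pca_step_def[abs_def] pca_kernel_eq)
qed

text \<open>The integrand does not see the conditioning configuration, so the direct term of the
  kernel estimate is 0.\<close>

lemma osc_le_pca_step:
  fixes r :: "(int ^ 'd::finite) set \<Rightarrow> real"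
  assumes r: "pca_coefficients r" and g: "quasi_local g" "osc_le d g"
    and d: "\<And>y. (\<lambda>x. influence r (y - x) * d x) summable_on UNIV"
  shows "osc_le (\<lambda>y. \<Sum>\<^sub>\<infinity>x. influence r (y - x) * d x) (pca_step r g)"
proof -
  have "osc_le (\<lambda>y. 0 + (\<Sum>\<^sub>\<infinity>x. (\<lambda>y x. influence r (y - x)) y x * d x))
    (\<lambda>\<eta>. \<integral>\<sigma>. (\<lambda>_. g) \<eta> \<sigma> \<partial>spin_product ((\<lambda>\<eta> x. local_field r x \<eta>) \<eta>))"
    by (rule kernel_osc_le)
      (use r g d in \<open>auto intro: jointly_quasi_local_const osc_le_local_field abs_local_field_le simp: osc_le_def[of "\<lambda>_. 0"]\<close>)
  then show ?thesis by (simp add: pca_step_def[abs_def] pca_kernel_eq)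
qed

lemma pca_kernel_in_prob_algebra:
  "pca_coefficients r \<Longrightarrow> \<eta> \<in> configs \<Longrightarrow> pca_kernel r \<eta> \<in> space (prob_algebra config_space)"
  unfolding pca_kernel_eq by (intro spin_product_in_prob_algebra abs_local_field_le)

lemma bind_pca_kernel_in_prob_algebra:
  fixes r :: "(int ^ 'd::finite) set \<Rightarrow> real"
  assumes "pca_coefficients r" "\<mu> \<in> space (prob_algebra config_space)"
  shows "\<mu> \<bind> pca_kernel r \<in> space (prob_algebra config_space)"
proof -
  have "(\<lambda>x. bind (id x) (pca_kernel r)) \<in> measurable (prob_algebra config_space) (prob_algebra config_space)"
    by (rule measurable_bind_prob_space[OF _ measurable_pca_kernel[OF assms(1)]]) simp
  from measurable_space[OF this assms(2)] show ?thesis by simp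
qed

lemma integral_bind_pca_kernel:
  fixes r :: "(int ^ 'd::finite) set \<Rightarrow> real"
  assumes r: "pca_coefficients r" and \<mu>: "\<mu> \<in> space (prob_algebra config_space)" and g: "quasi_local g"
  shows "(\<integral>\<sigma>. g \<sigma> \<partial>(\<mu> \<bind> pca_kernel r)) = (\<integral>\<eta>. pca_step r g \<eta> \<partial>\<mu>)"
proof -
  obtain B where B: "\<And>\<sigma>. \<sigma> \<in> configs \<Longrightarrow> \<bar>g \<sigma>\<bar> \<le> B" by (rule quasi_local_bounded[OF g]) blast
  interpret prob_space \<mu> by (rule prob_algebra_configD[OF \<mu>])
  have K: "pca_kernel r \<in> measurable \<mu> (subprob_algebra config_space)"
    using measurable_prob_algebraD[OF measurable_pca_kernel[OF r]] prob_algebra_configD(2)[OF \<mu>]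
    by (simp cong: measurable_cong_sets)
  have "emeasure (pca_kernel r \<eta>) (space (pca_kernel r \<eta>)) \<le> ennreal 1" if "\<eta> \<in> space \<mu>" for \<eta>
  proof -
    interpret Q: prob_space "pca_kernel r \<eta>"
      using that by (intro prob_algebra_configD(1)[OF pca_kernel_in_prob_algebra[OF r]]) (simp add: prob_algebra_configD[OF \<mu>])
    show ?thesis by (simp add: Q.emeasure_space_1)
  qed
  then show ?thesis
    unfolding pca_step_def using B
    by (intro integral_bind[OF quasi_local_measurable[OF g] _ K finite_measure_axioms, where B=B and B'=1])
      (auto simp: space_config_space)
qed

text \<open>One step preserves the constant: the fresh randomness costs 1/8 and the initial
  fluctuation shrinks to \<gamma> C / 2, both times the squared norm, and the hypothesis on
  \<open>C\<close> says that they add up to at most C / 2.\<close>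

lemma quasi_GCB_bind_pca_kernel:
  fixes r :: "(int ^ 'd::finite) set \<Rightarrow> real"
  assumes r: "pca_coefficients r" "contractive r" and \<mu>: "\<mu> \<in> space (prob_algebra config_space)"
    and gcb: "quasi_GCB C \<mu>" and C: "1 \<le> 4 * C * (1 - total_influence r)"
  shows "quasi_GCB C (\<mu> \<bind> pca_kernel r)"
  unfolding quasi_GCB_def
proof (intro allI impI)
  fix g and d :: "int ^ 'd \<Rightarrow> real"
  assume g: "quasi_local g" "osc_le d g" and d: "(\<lambda>v. (d v)\<^sup>2) summable_on UNIV"
  let ?\<gamma> = "total_influence r" and ?D = "\<Sum>\<^sub>\<infinity>v. (d v)\<^sup>2"
  let ?d' = "\<lambda>y. \<Sum>\<^sub>\<infinity>x. influence r (y - x) * d x"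
  note cs = convolution_square_sum[OF influence_has_sum[OF r(2)] influence_nonneg total_influence_less_1[OF r(2)]
      _ d osc_le_nonneg[OF g(2)], of "\<lambda>_. 0", simplified]
  have Pg: "quasi_local (pca_step r g)" "osc_le ?d' (pca_step r g)"
    by (rule quasi_local_pca_step[OF r(1) g(1)] osc_le_pca_step[OF r(1) g cs(1)])+
  let ?m = "\<integral>\<tau>. g \<tau> \<partial>(\<mu> \<bind> pca_kernel r)"
  have m: "?m = (\<integral>\<eta>. pca_step r g \<eta> \<partial>\<mu>)" by (rule integral_bind_pca_kernel[OF r(1) \<mu> g(1)])
  have "C > 0"
  proof (rule ccontr)
    assume "\<not> C > 0"
    then have "4 * C * (1 - ?\<gamma>) \<le> 0"
      using total_influence_less_1[OF r(2)] mult_nonpos_nonneg[of "4 * C" "1 - ?\<gamma>"] by simp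
    then show False using C by simp
  qed
  have ex: "quasi_local (\<lambda>\<sigma>. exp (g \<sigma> - ?m))" using quasi_local_exp[OF g(1), of "- ?m"] by simp
  have int1: "integrable \<mu> (\<lambda>\<eta>. exp (1 / 8 * ?D) * exp (pca_step r g \<eta> - ?m))"
    using integrable_exp_quasi_local[OF \<mu> Pg(1)] by simp
  have "(\<integral>\<sigma>. exp (g \<sigma> - ?m) \<partial>(\<mu> \<bind> pca_kernel r)) = (\<integral>\<eta>. pca_step r (\<lambda>\<sigma>. exp (g \<sigma> - ?m)) \<eta> \<partial>\<mu>)"
    by (rule integral_bind_pca_kernel[OF r(1) \<mu> ex])
  also have "\<dots> \<le> (\<integral>\<eta>. exp (1 / 8 * ?D) * exp (pca_step r g \<eta> - ?m) \<partial>\<mu>)"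
  proof (rule integral_mono'[OF int1])
    fix \<eta> assume "\<eta> \<in> space \<mu>"
    then have \<eta>: "\<eta> \<in> configs" by (simp add: prob_algebra_configD[OF \<mu>])
    \<comment> \<open>Recentre at the conditional mean: the product bound controls the first factor,
      and the second no longer depends on the integrated configuration.\<close>
    have "pca_step r (\<lambda>\<sigma>. exp (g \<sigma> - ?m)) \<eta> =
      (\<integral>\<sigma>. exp (g \<sigma> - pca_step r g \<eta>) * exp (pca_step r g \<eta> - ?m) \<partial>pca_kernel r \<eta>)"
      unfolding pca_step_def[of r "\<lambda>\<sigma>. exp (g \<sigma> - ?m)"] by (simp flip: exp_add)
    also have "\<dots> = exp (pca_step r g \<eta> - ?m) * (\<integral>\<sigma>. exp (g \<sigma> - pca_step r g \<eta>) \<partial>pca_kernel r \<eta>)"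
      by simp
    also have "\<dots> \<le> exp (pca_step r g \<eta> - ?m) * exp (1 / 8 * ?D)"
      unfolding pca_step_def pca_kernel_eq
      by (intro mult_left_mono spin_product_exp_moment abs_local_field_le r(1) \<eta> g d) simp
    finally show "pca_step r (\<lambda>\<sigma>. exp (g \<sigma> - ?m)) \<eta> \<le> exp (1 / 8 * ?D) * exp (pca_step r g \<eta> - ?m)"
      by (simp add: mult.commute)
  qed simp
  also have "\<dots> = exp (1 / 8 * ?D) * (\<integral>\<eta>. exp (pca_step r g \<eta> - (\<integral>\<tau>. pca_step r g \<tau> \<partial>\<mu>)) \<partial>\<mu>)"
    by (simp add: m)
  also have "\<dots> \<le> exp (1 / 8 * ?D) * exp (C / 2 * (\<Sum>\<^sub>\<infinity>y. (?d' y)\<^sup>2))"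
    by (intro mult_left_mono quasi_GCBD[OF gcb Pg cs(2)]) simp
  also have "\<dots> \<le> exp (1 / 8 * ?D) * exp (C / 2 * (?\<gamma> * ?D))"
    using cs(3) \<open>C > 0\<close> by simp
  also have "\<dots> \<le> exp (C / 2 * ?D)"
  proof -
    have "0 \<le> ?D" by (intro infsum_nonneg) simp
    then have "?D \<le> (4 * C * (1 - ?\<gamma>)) * ?D" using mult_right_mono[OF C] by simp
    then show ?thesis by (simp add: algebra_simps flip: exp_add)
  qed
  finally show "(\<integral>\<sigma>. exp (g \<sigma> - ?m) \<partial>(\<mu> \<bind> pca_kernel r)) \<le> exp (C / 2 * ?D)" .
qed

section \<open>Convergence to equilibrium\<close>

text \<open>A summable profile bounds the variation over the whole space: telescoping on a large
  finite set, with an arbitrarily small rest.\<close>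

lemma osc_le_total:
  assumes f: "quasi_local f" "osc_le d f" and d: "(d has_sum s) UNIV" and \<sigma>: "\<sigma> \<in> configs" "\<tau> \<in> configs"
  shows "\<bar>f \<sigma> - f \<tau>\<bar> \<le> s"
proof (rule field_le_epsilon)
  fix e :: real assume "e > 0"
  then obtain \<Lambda> where L: "finite \<Lambda>" "determined_up_to e \<Lambda> f" by (rule quasi_localE[OF f(1)])
  have "sum d \<Lambda> \<le> s"
    by (rule finite_sum_le_has_sum[OF d L(1)]) (auto simp: osc_le_nonneg[OF f(2)])
  then show "\<bar>f \<sigma> - f \<tau>\<bar> \<le> s + e" using osc_le_sum[OF f(2) L \<sigma>] by linarith
qed

text \<open>Each step convolves the profile with the influences and so multiplies its mass by
  \<gamma>.\<close>

lemma pca_step_iterate_osc: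
  fixes r :: "(int ^ 'd::finite) set \<Rightarrow> real"
  assumes r: "pca_coefficients r" "contractive r"
    and g: "quasi_local g" "osc_le d g" and d: "(d has_sum s) UNIV"
  shows "quasi_local ((pca_step r ^^ n) g) \<and>
    (\<exists>d'. osc_le d' ((pca_step r ^^ n) g) \<and> (d' has_sum total_influence r ^ n * s) UNIV)"
proof (induction n)
  case 0
  then show ?case using g d by auto
next
  case (Suc n)
  then obtain d' where ql: "quasi_local ((pca_step r ^^ n) g)"
    and d': "osc_le d' ((pca_step r ^^ n) g)" "(d' has_sum total_influence r ^ n * s) UNIV" by blast
  note cv = convolution_has_sum[OF influence_has_sum[OF r(2)] influence_nonneg d'(2) osc_le_nonneg[OF d'(1)]]
  show ?case
    using quasi_local_pca_step[OF r(1) ql] osc_le_pca_step[OF r(1) ql d'(1) cv(1)] cv(2)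
    by (auto simp: mult.assoc)
qed

text \<open>The iterate varies by at most \<open>total_influence r ^ n * s\<close> in all. The
  estimate is uniform in \<open>\<mu>\<close>, which is what forgetting the initial law
  means.\<close>

lemma pca_step_iterate_near_const:
  fixes r :: "(int ^ 'd::finite) set \<Rightarrow> real"
  assumes r: "pca_coefficients r" "contractive r"
    and g: "quasi_local g" "osc_le d g" and d: "(d has_sum s) UNIV"
    and \<mu>: "\<mu> \<in> space (prob_algebra config_space)"
  shows "\<bar>(\<integral>\<eta>. (pca_step r ^^ n) g \<eta> \<partial>\<mu>) - (pca_step r ^^ n) g (\<lambda>_. 1)\<bar> \<le> total_influence r ^ n * s"
proof -
  obtain d' where ql: "quasi_local ((pca_step r ^^ n) g)"
    and d': "osc_le d' ((pca_step r ^^ n) g)" "(d' has_sum total_influence r ^ n * s) UNIV"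
    using pca_step_iterate_osc[OF r g d] by blast
  interpret prob_space \<mu> by (rule prob_algebra_configD[OF \<mu>])
  have "\<bar>(\<integral>\<eta>. (pca_step r ^^ n) g \<eta> \<partial>\<mu>) - (\<integral>\<eta>. (pca_step r ^^ n) g (\<lambda>_. 1) \<partial>\<mu>)\<bar> \<le> total_influence r ^ n * s"
    by (rule integral_diff_le[OF \<mu> quasi_local_integrable[OF \<mu> ql]]) (simp_all add: osc_le_total[OF ql d'])
  then show ?thesis by (simp add: prob_space)
qed

text \<open>A point mass has no fluctuation, so the Gaussian bound starts with any positive
  constant.\<close>

primrec pca_law :: "((int ^ 'd) set \<Rightarrow> real) \<Rightarrow> nat \<Rightarrow> (int ^ 'd \<Rightarrow> real) measure" where
  "pca_law r 0 = return config_space (\<lambda>_. 1)"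
| "pca_law r (Suc n) = pca_law r n \<bind> pca_kernel r"

lemma pca_law_in_prob_algebra:
  fixes r :: "(int ^ 'd::finite) set \<Rightarrow> real"
  assumes "pca_coefficients r"
  shows "pca_law r n \<in> space (prob_algebra config_space)"
proof (induction n)
  case 0
  have "(\<lambda>_. 1) \<in> space (config_space :: (int ^ 'd \<Rightarrow> real) measure)" by (simp add: space_config_space)
  from measurable_space[OF measurable_return_prob_space this] show ?case by simp
next
  case (Suc n)
  then show ?case using bind_pca_kernel_in_prob_algebra[OF assms] by simp
qed

lemma integral_pca_law:
  fixes r :: "(int ^ 'd::finite) set \<Rightarrow> real"
  assumes r: "pca_coefficients r" "contractive r"
    and g: "quasi_local g" "osc_le d g" and d: "(d has_sum s) UNIV"
  shows "(\<integral>\<sigma>. g \<sigma> \<partial>pca_law r n) = (pca_step r ^^ n) g (\<lambda>_. 1)"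
  using g d
proof (induction n arbitrary: g d s)
  case 0
  then show ?case
    using integral_return[OF _ quasi_local_measurable[OF 0(1)]] by (simp add: space_config_space)
next
  case (Suc n)
  have "(\<integral>\<sigma>. g \<sigma> \<partial>pca_law r (Suc n)) = (\<integral>\<eta>. pca_step r g \<eta> \<partial>pca_law r n)"
    using integral_bind_pca_kernel[OF r(1) pca_law_in_prob_algebra[OF r(1)] Suc.prems(1)] by simp
  \<comment> \<open>The recursion of the laws peels off the last time step, hence the operator next
    to \<open>g\<close>; the induction runs over all functions with a summable profile.\<close>
  also have "\<dots> = (pca_step r ^^ n) (pca_step r g) (\<lambda>_. 1)"
    using pca_step_iterate_osc[OF r Suc.prems, of 1] Suc.IH by auto
  finally show ?case by (simp add: funpow_swap1)
qed

text \<open>The mean of \<open>g\<close> at time k + n is the mean at time k of the n-th iterate,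
  which is nearly constant.\<close>

lemma pca_law_Cauchy:
  fixes r :: "(int ^ 'd::finite) set \<Rightarrow> real"
  assumes r: "pca_coefficients r" "contractive r"
    and g: "quasi_local g" "osc_le d g" and d: "(d has_sum s) UNIV"
  shows "\<bar>(\<integral>\<sigma>. g \<sigma> \<partial>pca_law r (k + n)) - (\<integral>\<sigma>. g \<sigma> \<partial>pca_law r n)\<bar> \<le> total_influence r ^ n * s"
proof -
  obtain d' where ql: "quasi_local ((pca_step r ^^ n) g)"
    and d': "osc_le d' ((pca_step r ^^ n) g)" "(d' has_sum total_influence r ^ n * s) UNIV"
    using pca_step_iterate_osc[OF r g d] by blast
  have "(\<integral>\<sigma>. g \<sigma> \<partial>pca_law r (k + n)) = (pca_step r ^^ k) ((pca_step r ^^ n) g) (\<lambda>_. 1)"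
    by (simp add: integral_pca_law[OF r g d] funpow_add)
  also have "\<dots> = (\<integral>\<eta>. (pca_step r ^^ n) g \<eta> \<partial>pca_law r k)"
    by (rule integral_pca_law[OF r ql d', symmetric])
  finally show ?thesis
    using pca_step_iterate_near_const[OF r g d pca_law_in_prob_algebra[OF r(1)], where n=n, of k]
    by (simp add: integral_pca_law[OF r g d])
qed

lemma tendsto_zero_total_influence:
  assumes "contractive r"
  shows "(\<lambda>n. total_influence r ^ n * s) \<longlonglongrightarrow> 0"
  using LIMSEQ_realpow_zero[OF total_influence_nonneg total_influence_less_1[OF assms]]
  by (rule tendsto_mult_left_zero)

lemma local_function_osc_has_sum:
  assumes "local_function f"
  shows "((\<lambda>v. oscillation v f) has_sum (\<Sum>\<^sub>\<infinity>v. oscillation v f)) UNIV"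
proof -
  obtain \<Lambda> where L: "finite \<Lambda>" "determined_up_to 0 \<Lambda> f" using assms by (auto simp: local_function_iff)
  have "((\<lambda>v. oscillation v f) has_sum (\<Sum>v\<in>\<Lambda>. oscillation v f)) UNIV"
    using oscillation_outside[OF L(2)] by (intro has_sum_finite_neutralI[OF L(1)]) auto
  then show ?thesis by (simp add: has_sum_infsum has_sum_imp_summable)
qed

lemma pca_law_convergent:
  fixes r :: "(int ^ 'd::finite) set \<Rightarrow> real"
  assumes r: "pca_coefficients r" "contractive r" and f: "local_function f"
  shows "convergent (\<lambda>n. \<integral>\<sigma>. f \<sigma> \<partial>pca_law r n)"
proof (rule Cauchy_convergent, rule metric_CauchyI)
  fix e :: real assume e: "e > 0"
  let ?s = "\<Sum>\<^sub>\<infinity>v. oscillation v f" and ?I = "\<lambda>n. \<integral>\<sigma>. f \<sigma> \<partial>pca_law r n"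
  obtain N where N: "total_influence r ^ N * ?s < e / 2"
    using order_tendstoD(2)[OF tendsto_zero_total_influence[OF r(2), of ?s], of "e / 2"] e
    by (auto simp: eventually_sequentially)
  note c = pca_law_Cauchy[OF r quasi_local_local[OF f] osc_le_oscillation[OF f] local_function_osc_has_sum[OF f], of _ N]
  have "dist (?I m) (?I n) < e" if "m \<ge> N" "n \<ge> N" for m n
    using c[of "m - N"] c[of "n - N"] N that unfolding dist_real_def by simp
  then show "\<exists>M. \<forall>m\<ge>M. \<forall>n\<ge>M. dist (?I m) (?I n) < e" by blast
qed

text \<open>Invariance replaces \<open>f\<close> by its n-th iterate, whose mean is close to its
  value at all plus, that is, to the mean of \<open>f\<close> under \<open>pca_law r n\<close>.
  Uniqueness is an immediate consequence.\<close>

lemma stationary_limit: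
  fixes r :: "(int ^ 'd::finite) set \<Rightarrow> real"
  assumes r: "pca_coefficients r" "contractive r" and \<nu>: "stationary r \<nu>" and f: "local_function f"
  shows "(\<lambda>n. \<integral>\<sigma>. f \<sigma> \<partial>pca_law r n) \<longlonglongrightarrow> (\<integral>\<sigma>. f \<sigma> \<partial>\<nu>)"
proof -
  let ?s = "\<Sum>\<^sub>\<infinity>v. oscillation v f"
  have \<nu>': "\<nu> \<in> space (prob_algebra config_space)" "\<nu> \<bind> pca_kernel r = \<nu>"
    using \<nu> by (simp_all add: stationary_def)
  note g = quasi_local_local[OF f] osc_le_oscillation[OF f] local_function_osc_has_sum[OF f]
  have inv: "(\<integral>\<sigma>. (pca_step r ^^ n) f \<sigma> \<partial>\<nu>) = (\<integral>\<sigma>. f \<sigma> \<partial>\<nu>)" for n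
  proof (induction n)
    case (Suc n)
    have "quasi_local ((pca_step r ^^ n) f)" using pca_step_iterate_osc[OF r g] by blast
    then show ?case using integral_bind_pca_kernel[OF r(1) \<nu>'(1)] Suc \<nu>'(2) by simp
  qed simp
  have "(\<lambda>n. (\<integral>\<sigma>. f \<sigma> \<partial>pca_law r n) - (\<integral>\<sigma>. f \<sigma> \<partial>\<nu>)) \<longlonglongrightarrow> 0"
  proof (rule Lim_null_comparison[OF _ tendsto_zero_total_influence[OF r(2), of ?s]], rule always_eventually, rule allI)
    fix n
    show "norm ((\<integral>\<sigma>. f \<sigma> \<partial>pca_law r n) - (\<integral>\<sigma>. f \<sigma> \<partial>\<nu>)) \<le> total_influence r ^ n * ?s"
      using pca_step_iterate_near_const[OF r g \<nu>'(1), of n]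
      by (simp add: inv integral_pca_law[OF r g] abs_minus_commute)
  qed
  then show ?thesis by (rule LIM_zero_cancel)
qed

lemma quasi_GCB_pca_law:
  fixes r :: "(int ^ 'd::finite) set \<Rightarrow> real"
  assumes r: "pca_coefficients r" "contractive r" and C: "1 \<le> 4 * C * (1 - total_influence r)" "C > 0"
  shows "quasi_GCB C (pca_law r n)"
proof (induction n)
  case 0
  show ?case unfolding quasi_GCB_def
  proof (intro allI impI)
    fix g :: "(int ^ 'd \<Rightarrow> real) \<Rightarrow> real" and d :: "int ^ 'd \<Rightarrow> real" assume g: "quasi_local g"
    have "0 \<le> (\<Sum>\<^sub>\<infinity>v. (d v)\<^sup>2)" by (intro infsum_nonneg) simp
    moreover have i: "(\<integral>\<sigma>. g' \<sigma> \<partial>pca_law r 0) = g' (\<lambda>_. 1)" if "quasi_local g'"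
      for g' :: "(int ^ 'd \<Rightarrow> real) \<Rightarrow> real"
      using integral_return[OF _ quasi_local_measurable[OF that]] by (simp add: space_config_space)
    ultimately show "(\<integral>\<sigma>. exp (g \<sigma> - (\<integral>\<tau>. g \<tau> \<partial>pca_law r 0)) \<partial>pca_law r 0) \<le> exp (C / 2 * (\<Sum>\<^sub>\<infinity>v. (d v)\<^sup>2))"
      using i[OF g] i[OF quasi_local_exp[OF g, of "- g (\<lambda>_. 1)"]] C(2) by simp
  qed
next
  case (Suc n)
  then show ?case
    using quasi_GCB_bind_pca_kernel[OF r pca_law_in_prob_algebra[OF r(1)] _ C(1)] by simp
qed

text \<open>The laws from all plus satisfy the bound with one common constant, and it passes to the
  limit.\<close>

lemma GCB_stationary:
  fixes r :: "(int ^ 'd::finite) set \<Rightarrow> real"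
  assumes r: "pca_coefficients r" "contractive r" and \<nu>: "stationary r \<nu>"
    and C: "1 \<le> 4 * C * (1 - total_influence r)" "C > 0"
  shows "GCB C \<nu>"
proof (rule GCB_I)
  show "\<nu> \<in> space (prob_algebra config_space)" using \<nu> by (simp add: stationary_def)
  show "C > 0" by (rule C)
  fix f :: "(int ^ 'd \<Rightarrow> real) \<Rightarrow> real" assume f: "local_function f"
  let ?I = "\<lambda>n. \<integral>\<sigma>. f \<sigma> \<partial>pca_law r n" and ?E = "\<lambda>n. \<integral>\<sigma>. exp (f \<sigma>) \<partial>pca_law r n"
  have loc: "local_function (\<lambda>\<sigma>. exp (f \<sigma>))"
    using f unfolding local_function_def by metis
  \<comment> \<open>The centring depends on the measure; taken out as a factor, it leaves means of
    two fixed local functions, both of which converge.\<close>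
  have split: "(\<integral>\<sigma>. exp (f \<sigma> - c) \<partial>\<mu>) = exp (- c) * (\<integral>\<sigma>. exp (f \<sigma>) \<partial>\<mu>)" for \<mu> c
    by (simp add: exp_diff exp_minus field_simps)
  have "(\<lambda>n. exp (- ?I n) * ?E n) \<longlonglongrightarrow> exp (- (\<integral>\<sigma>. f \<sigma> \<partial>\<nu>)) * (\<integral>\<sigma>. exp (f \<sigma>) \<partial>\<nu>)"
    by (intro tendsto_intros stationary_limit[OF r \<nu>] f loc)
  moreover have "exp (- ?I n) * ?E n \<le> exp (C / 2 * osc_norm_sq f)" for n
    using quasi_GCBD[OF quasi_GCB_pca_law[OF r C] quasi_local_local[OF f] osc_le_oscillation[OF f]
        summable_oscillation_sq[OF f], of n]
    by (simp add: split osc_norm_sq_def)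
  ultimately have "exp (- (\<integral>\<sigma>. f \<sigma> \<partial>\<nu>)) * (\<integral>\<sigma>. exp (f \<sigma>) \<partial>\<nu>) \<le> exp (C / 2 * osc_norm_sq f)"
    by (intro LIMSEQ_le_const2) auto
  then show "(\<integral>\<sigma>. exp (f \<sigma> - (\<integral>\<tau>. f \<tau> \<partial>\<nu>)) \<partial>\<nu>) \<le> exp (C / 2 * osc_norm_sq f)"
    by (simp add: split)
qed

section \<open>Compactness\<close>

definition cylinder :: "'v set \<Rightarrow> ('v \<Rightarrow> real) \<Rightarrow> ('v \<Rightarrow> real) set" where
  "cylinder \<Lambda> \<xi> = {\<sigma> \<in> configs. \<forall>v\<in>\<Lambda>. \<sigma> v = \<xi> v}"

abbreviation patterns :: "'v set \<Rightarrow> ('v \<Rightarrow> real) set" where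
  "patterns \<Lambda> \<equiv> \<Pi>\<^sub>E v\<in>\<Lambda>. {-1, 1}"

lemma finite_patterns: "finite \<Lambda> \<Longrightarrow> finite (patterns \<Lambda>)"
  by (simp add: finite_PiE)

lemma local_indicator:
  assumes "finite \<Lambda>" "\<And>\<sigma> \<tau>. \<sigma> \<in> configs \<Longrightarrow> \<tau> \<in> configs \<Longrightarrow> (\<And>v. v \<in> \<Lambda> \<Longrightarrow> \<sigma> v = \<tau> v) \<Longrightarrow> \<sigma> \<in> S \<longleftrightarrow> \<tau> \<in> S"
  shows "local_function (indicator S)"
  unfolding local_function_def
proof (intro exI[of _ \<Lambda>] conjI ballI impI assms(1))
  fix \<sigma> \<tau> :: "'a \<Rightarrow> real" assume "\<sigma> \<in> configs" "\<tau> \<in> configs" "\<forall>v\<in>\<Lambda>. \<sigma> v = \<tau> v"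
  then have "\<sigma> \<in> S \<longleftrightarrow> \<tau> \<in> S" by (intro assms(2)) auto
  then show "indicator S \<sigma> = (indicator S \<tau> :: real)" by (simp add: indicator_def)
qed

lemma local_event_measurable:
  assumes "local_function (indicator S :: ('v \<Rightarrow> real) \<Rightarrow> real)" "S \<subseteq> configs"
  shows "S \<in> sets config_space"
proof -
  have "(indicator S :: ('v \<Rightarrow> real) \<Rightarrow> real) -` {1} \<inter> space config_space \<in> sets config_space"
    using quasi_local_measurable[OF quasi_local_local[OF assms(1)]] by (rule measurable_sets) simp
  moreover have "(indicator S :: ('v \<Rightarrow> real) \<Rightarrow> real) -` {1} \<inter> space config_space = S"
    using assms(2) by (auto simp: space_config_space indicator_def split: if_splits)
  ultimately show ?thesis by simp
qed

lemma cylinder_local: "finite \<Lambda> \<Longrightarrow> local_function (indicator (cylinder \<Lambda> \<xi>))"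
  by (rule local_indicator) (auto simp: cylinder_def)

lemma cylinder_measurable: "finite \<Lambda> \<Longrightarrow> cylinder \<Lambda> \<xi> \<in> sets config_space"
  by (rule local_event_measurable[OF cylinder_local]) (auto simp: cylinder_def)

lemma restrict_in_patterns: "\<sigma> \<in> configs \<Longrightarrow> restrict \<sigma> \<Lambda> \<in> patterns \<Lambda>"
  by (auto simp: configs_def)

lemma mem_cylinder_iff: "\<sigma> \<in> configs \<Longrightarrow> \<xi> \<in> patterns \<Lambda> \<Longrightarrow> \<sigma> \<in> cylinder \<Lambda> \<xi> \<longleftrightarrow> \<xi> = restrict \<sigma> \<Lambda>"
  by (auto simp: cylinder_def PiE_def extensional_def fun_eq_iff restrict_def)

text \<open>A pattern is \<open>undefined\<close> outside \<open>\<Lambda>\<close>;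
  \<open>freeze\<close> fills it up with 1 to a configuration at which \<open>f\<close> can be
  evaluated.\<close>

lemma local_function_eq_sum_cylinders:
  fixes f :: "('v \<Rightarrow> real) \<Rightarrow> real"
  assumes L: "finite \<Lambda>" "determined_up_to 0 \<Lambda> f" and \<sigma>: "\<sigma> \<in> configs"
  shows "f \<sigma> = (\<Sum>\<xi>\<in>patterns \<Lambda>. f (freeze \<Lambda> \<xi>) * indicator (cylinder \<Lambda> \<xi>) \<sigma>)"
proof -
  have "(\<Sum>\<xi>\<in>patterns \<Lambda>. f (freeze \<Lambda> \<xi>) * indicator (cylinder \<Lambda> \<xi>) \<sigma>) =
      (\<Sum>\<xi>\<in>patterns \<Lambda>. if \<xi> = restrict \<sigma> \<Lambda> then f (freeze \<Lambda> \<xi>) else 0)"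
    using mem_cylinder_iff[OF \<sigma>] by (intro sum.cong) (auto simp: indicator_def)
  also have "\<dots> = f (freeze \<Lambda> (restrict \<sigma> \<Lambda>))"
    using finite_patterns[OF L(1)] restrict_in_patterns[OF \<sigma>, of \<Lambda>] by (subst sum.delta) auto
  also have "freeze \<Lambda> (restrict \<sigma> \<Lambda>) = freeze \<Lambda> \<sigma>" by (auto simp: freeze_def)
  also have "f (freeze \<Lambda> \<sigma>) = f \<sigma>" using freeze_close[OF L(2) \<sigma>] by simp
  finally show ?thesis by simp
qed

lemma integral_local_function:
  fixes f :: "('v \<Rightarrow> real) \<Rightarrow> real"
  assumes \<mu>: "\<mu> \<in> space (prob_algebra config_space)" and L: "finite \<Lambda>" "determined_up_to 0 \<Lambda> f"
  shows "(\<integral>\<sigma>. f \<sigma> \<partial>\<mu>) = (\<Sum>\<xi>\<in>patterns \<Lambda>. f (freeze \<Lambda> \<xi>) * measure \<mu> (cylinder \<Lambda> \<xi>))"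
proof -
  interpret prob_space \<mu> by (rule prob_algebra_configD[OF \<mu>])
  have cyl: "cylinder \<Lambda> \<xi> \<in> sets \<mu>" for \<xi>
    using cylinder_measurable[OF L(1)] by (simp add: prob_algebra_configD[OF \<mu>])
  have "(\<integral>\<sigma>. f \<sigma> \<partial>\<mu>) = (\<integral>\<sigma>. (\<Sum>\<xi>\<in>patterns \<Lambda>. f (freeze \<Lambda> \<xi>) * indicator (cylinder \<Lambda> \<xi>) \<sigma>) \<partial>\<mu>)"
    by (rule Bochner_Integration.integral_cong[OF refl], rule local_function_eq_sum_cylinders[OF L])
      (simp add: prob_algebra_configD[OF \<mu>])
  also have "\<dots> = (\<Sum>\<xi>\<in>patterns \<Lambda>. (\<integral>\<sigma>. f (freeze \<Lambda> \<xi>) * indicator (cylinder \<Lambda> \<xi>) \<sigma> \<partial>\<mu>))"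
    using cyl by (intro Bochner_Integration.integral_sum integrable_mult_right integrable_real_indicator)
      (auto simp: emeasure_eq_measure)
  also have "\<dots> = (\<Sum>\<xi>\<in>patterns \<Lambda>. f (freeze \<Lambda> \<xi>) * measure \<mu> (cylinder \<Lambda> \<xi>))"
    using cyl by (intro sum.cong refl) simp
  finally show ?thesis .
qed

lemma measure_eq_integral_indicator:
  assumes \<mu>: "\<mu> \<in> space (prob_algebra config_space)" and S: "S \<in> sets config_space"
  shows "measure \<mu> S = (\<integral>\<sigma>. indicator S \<sigma> \<partial>\<mu>)"
  using S sets.sets_into_space[OF S] by (simp add: prob_algebra_configD[OF \<mu>] space_config_space Int_absorb2)

text \<open>Indicators of finite-dimensional boxes are local, and such boxes determine a measure on
  the product.\<close>

lemma prob_eqI_local: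
  assumes \<mu>: "\<mu> \<in> space (prob_algebra config_space)" and \<nu>: "\<nu> \<in> space (prob_algebra config_space)"
    and eq: "\<And>f. local_function f \<Longrightarrow> (\<integral>\<sigma>. f \<sigma> \<partial>\<mu>) = (\<integral>\<sigma>. f \<sigma> \<partial>\<nu>)"
  shows "\<mu> = \<nu>"
proof (rule measure_eqI_PiM_infinite[where I=UNIV and M="\<lambda>_. count_space {-1, 1}"])
  interpret \<mu>: prob_space \<mu> by (rule prob_algebra_configD[OF \<mu>])
  interpret \<nu>: prob_space \<nu> by (rule prob_algebra_configD[OF \<nu>])
  show "sets \<mu> = sets (Pi\<^sub>M UNIV (\<lambda>_. count_space {- 1, 1}))" "sets \<nu> = sets (Pi\<^sub>M UNIV (\<lambda>_. count_space {- 1, 1}))"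
    using prob_algebra_configD[OF \<mu>] prob_algebra_configD[OF \<nu>] by (simp_all add: config_space_def)
  show "finite_measure \<mu>" by (rule \<mu>.finite_measure_axioms)
  fix A :: "'a \<Rightarrow> real set" and J :: "'a set" assume J: "finite J"
  let ?S = "prod_emb UNIV (\<lambda>_. count_space {- 1, 1}) J (Pi\<^sub>E J A)"
  have S: "?S = {\<sigma> \<in> configs. \<forall>v\<in>J. \<sigma> v \<in> A v}"
    by (auto simp: prod_emb_def configs_def PiE_UNIV_domain PiE_def Pi_def extensional_def)
  have loc: "local_function (indicator ?S)"
    unfolding S by (rule local_indicator[OF J]) auto
  have m: "?S \<in> sets config_space" by (rule local_event_measurable[OF loc]) (auto simp: S)
  have "measure \<mu> ?S = measure \<nu> ?S"
    using eq[OF loc] by (simp add: measure_eq_integral_indicator[OF \<mu> m] measure_eq_integral_indicator[OF \<nu> m])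
  then show "emeasure \<mu> ?S = emeasure \<nu> ?S"
    by (simp add: \<mu>.emeasure_eq_measure \<nu>.emeasure_eq_measure)
qed

text \<open>The limits of the cylinder probabilities are consistent and extend to a measure by
  Kolmogorov's theorem. The extension takes place over real coordinates and is mapped back to spins
  at the end.\<close>

lemma local_limit_exists:
  fixes \<rho> :: "nat \<Rightarrow> ('v \<Rightarrow> real) measure"
  assumes \<rho>: "\<And>n. \<rho> n \<in> space (prob_algebra config_space)"
    and conv: "\<And>f. local_function f \<Longrightarrow> convergent (\<lambda>n. \<integral>\<sigma>. f \<sigma> \<partial>\<rho> n)"
  obtains \<nu> where "\<nu> \<in> space (prob_algebra config_space)"
    "\<And>f. local_function f \<Longrightarrow> (\<lambda>n. \<integral>\<sigma>. f \<sigma> \<partial>\<rho> n) \<longlonglongrightarrow> (\<integral>\<sigma>. f \<sigma> \<partial>\<nu>)"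
proof -
  interpret \<rho>: prob_space "\<rho> n" for n by (rule prob_algebra_configD[OF \<rho>])
  define w where "w \<Lambda> \<xi> = lim (\<lambda>n. measure (\<rho> n) (cylinder \<Lambda> \<xi>))" for \<Lambda> \<xi>
  have w: "(\<lambda>n. measure (\<rho> n) (cylinder \<Lambda> \<xi>)) \<longlonglongrightarrow> w \<Lambda> \<xi>" if "finite \<Lambda>" for \<Lambda> \<xi>
    unfolding w_def measure_eq_integral_indicator[OF \<rho> cylinder_measurable[OF that]]
    using conv[OF cylinder_local[OF that]] by (simp add: convergent_LIMSEQ_iff)
  have w0: "0 \<le> w \<Lambda> \<xi>" if "finite \<Lambda>" for \<Lambda> \<xi>
    by (rule LIMSEQ_le_const[OF w[OF that]]) simp
  \<comment> \<open>Arbitrary events on \<open>\<Lambda>\<close>, not only cylinders: consistency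
    compares one event described on two index sets.\<close>
  have w_sum: "(\<lambda>n. measure (\<rho> n) {\<sigma> \<in> configs. restrict \<sigma> \<Lambda> \<in> X}) \<longlonglongrightarrow> (\<Sum>\<xi>\<in>patterns \<Lambda> \<inter> X. w \<Lambda> \<xi>)"
    if L: "finite \<Lambda>" for \<Lambda> X
  proof -
    have "measure (\<rho> n) {\<sigma> \<in> configs. restrict \<sigma> \<Lambda> \<in> X} = (\<Sum>\<xi>\<in>patterns \<Lambda> \<inter> X. measure (\<rho> n) (cylinder \<Lambda> \<xi>))" for n
    proof -
      have "(\<exists>\<xi>\<in>patterns \<Lambda> \<inter> X. \<sigma> \<in> cylinder \<Lambda> \<xi>) \<longleftrightarrow> \<sigma> \<in> configs \<and> restrict \<sigma> \<Lambda> \<in> X" for \<sigma>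
      proof (cases "\<sigma> \<in> configs")
        case True
        have "(\<exists>\<xi>\<in>patterns \<Lambda> \<inter> X. \<sigma> \<in> cylinder \<Lambda> \<xi>) \<longleftrightarrow> (\<exists>\<xi>\<in>patterns \<Lambda> \<inter> X. \<xi> = restrict \<sigma> \<Lambda>)"
          using mem_cylinder_iff[OF True] by (intro bex_cong refl) simp
        then show ?thesis using True restrict_in_patterns[OF True, of \<Lambda>] by blast
      qed (simp add: cylinder_def)
      then have "{\<sigma> \<in> configs. restrict \<sigma> \<Lambda> \<in> X} = (\<Union>\<xi>\<in>patterns \<Lambda> \<inter> X. cylinder \<Lambda> \<xi>)"
        by blast
      moreover have "disjoint_family_on (cylinder \<Lambda>) (patterns \<Lambda> \<inter> X)"
      unfolding disjoint_family_on_def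
      proof (intro ballI impI)
        fix \<xi> \<xi>' assume *: "\<xi> \<in> patterns \<Lambda> \<inter> X" "\<xi>' \<in> patterns \<Lambda> \<inter> X" "\<xi> \<noteq> \<xi>'"
        have False if "\<sigma> \<in> cylinder \<Lambda> \<xi>" "\<sigma> \<in> cylinder \<Lambda> \<xi>'" for \<sigma>
        proof -
          have "\<sigma> \<in> configs" using that(1) by (simp add: cylinder_def)
          then have "\<xi> = restrict \<sigma> \<Lambda>" "\<xi>' = restrict \<sigma> \<Lambda>"
            using that *(1,2) mem_cylinder_iff[of \<sigma> _ \<Lambda>] by blast+
          then show False using *(3) by simp
        qed
        then show "cylinder \<Lambda> \<xi> \<inter> cylinder \<Lambda> \<xi>' = {}" by blast
      qed
      ultimately show ?thesis
        using finite_patterns[OF L] cylinder_measurable[OF L]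
        by (simp add: \<rho>.finite_measure_finite_Union prob_algebra_configD[OF \<rho>] image_subset_iff)
    qed
    then show ?thesis using w[OF L] by (auto intro!: tendsto_sum)
  qed
  \<comment> \<open>The limiting finite marginals, carried by the spin patterns but placed on Borel
    real coordinates as the extension theorem requires.\<close>
  define Q where "Q \<Lambda> = distr (point_measure (patterns \<Lambda>) (\<lambda>\<xi>. ennreal (w \<Lambda> \<xi>))) (PiM \<Lambda> (\<lambda>_. borel)) (\<lambda>\<xi>. \<xi>)" for \<Lambda> :: "'v set"
  have Q: "emeasure (Q \<Lambda>) X = ennreal (\<Sum>\<xi>\<in>patterns \<Lambda> \<inter> X. w \<Lambda> \<xi>)"
    if L: "finite \<Lambda>" and X: "X \<in> sets (PiM \<Lambda> (\<lambda>_. borel))" for \<Lambda> X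
  proof -
    have "(\<lambda>\<xi>. \<xi>) \<in> measurable (point_measure (patterns \<Lambda>) (\<lambda>\<xi>. ennreal (w \<Lambda> \<xi>))) (PiM \<Lambda> (\<lambda>_. borel :: real measure))"
      by (auto simp: measurable_def space_point_measure sets_point_measure space_PiM)
    then have "emeasure (Q \<Lambda>) X = (\<Sum>\<xi>\<in>X \<inter> patterns \<Lambda>. ennreal (w \<Lambda> \<xi>))"
      unfolding Q_def using X finite_patterns[OF L]
      by (simp add: emeasure_distr space_point_measure emeasure_point_measure_finite)
    also have "\<dots> = ennreal (\<Sum>\<xi>\<in>patterns \<Lambda> \<inter> X. w \<Lambda> \<xi>)"
      by (simp add: w0[OF L] Int_commute)
    finally show ?thesis .
  qed
  have sQ: "sets (Q \<Lambda>) = sets (PiM \<Lambda> (\<lambda>_. borel))" for \<Lambda> by (simp add: Q_def)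
  interpret PP: polish_projective UNIV Q
  proof (unfold polish_projective_def, rule projective_family.intro)
    fix J H :: "'v set" assume JH: "J \<subseteq> H" "finite H"
    have J: "finite J" using JH finite_subset by blast
    show "Q J = distr (Q H) (PiM J (\<lambda>_. borel)) (\<lambda>f. restrict f J)"
    proof (rule measure_eqI)
      fix X assume "X \<in> sets (Q J)"
      then have X: "X \<in> sets (PiM J (\<lambda>_. borel))" by (simp add: sQ)
      have r: "(\<lambda>f. restrict f J) \<in> measurable (Q H) (PiM J (\<lambda>_. borel))"
        using measurable_restrict_subset[OF JH(1), of "\<lambda>_. borel"] by (simp cong: measurable_cong_sets add: sQ)
      let ?Y = "(\<lambda>f. restrict f J) -` X \<inter> space (Q H)"
      have Y: "?Y \<in> sets (PiM H (\<lambda>_. borel))" using measurable_sets[OF r X] by (simp add: sQ)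
      have "restrict (restrict \<sigma> H) J = restrict \<sigma> J" for \<sigma> :: "'v \<Rightarrow> real"
        using JH(1) by (auto simp: fun_eq_iff restrict_def)
      then have "{\<sigma> \<in> configs. restrict \<sigma> H \<in> ?Y} = {\<sigma> \<in> configs. restrict \<sigma> J \<in> X}"
        using sets_eq_imp_space_eq[OF sQ[of H]] by (auto simp: space_PiM)
      \<comment> \<open>Both sums are limits of the probabilities of the same event.\<close>
      then have "(\<Sum>\<xi>\<in>patterns H \<inter> ?Y. w H \<xi>) = (\<Sum>\<xi>\<in>patterns J \<inter> X. w J \<xi>)"
        using w_sum[OF JH(2), of ?Y] w_sum[OF J, of X] by (intro LIMSEQ_unique) auto
      then show "emeasure (Q J) X = emeasure (distr (Q H) (PiM J (\<lambda>_. borel)) (\<lambda>f. restrict f J)) X"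
        by (simp add: emeasure_distr[OF r X] Q[OF J X] Q[OF JH(2) Y])
    qed (simp add: sQ)
  next
    fix J :: "'v set" assume J: "finite J"
    show "prob_space (Q J)"
    proof (rule prob_spaceI)
      have "(\<lambda>n. measure (\<rho> n) {\<sigma> \<in> configs. restrict \<sigma> J \<in> space (Q J)}) \<longlonglongrightarrow> 1"
      proof -
        have "{\<sigma> \<in> configs. restrict \<sigma> J \<in> space (Q J)} = configs"
          using sets_eq_imp_space_eq[OF sQ[of J]] by (auto simp: space_PiM)
        moreover have "measure (\<rho> n) configs = 1" for n
          using \<rho>.prob_space[of n] by (simp add: prob_algebra_configD(3)[OF \<rho>])
        ultimately show ?thesis by (simp only: tendsto_const)
      qed
      then have "(\<Sum>\<xi>\<in>patterns J \<inter> space (Q J). w J \<xi>) = 1"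
        by (rule LIMSEQ_unique[OF w_sum[OF J]])
      moreover have "space (Q J) \<in> sets (PiM J (\<lambda>_. borel))" using sets.top[of "Q J"] by (simp only: sQ)
      ultimately show "emeasure (Q J) (space (Q J)) = 1" by (simp add: Q[OF J])
    qed
  qed
  \<comment> \<open>The extended measure lives on all real functions. Clipping forces values in {-1,
    1} and fixes those already there, so the marginals keep their weights.\<close>
  let ?clip = "\<lambda>(\<omega> :: 'v \<Rightarrow> real) v. if \<omega> v = 1 then 1 else (-1 :: real)"
  define \<nu> where "\<nu> = distr PP.lim config_space ?clip"
  have clip1: "(\<lambda>x :: real. if x = 1 then 1 else (-1 :: real)) \<in> measurable borel (count_space {-1, 1})"
    by (rule measurable_If) auto
  have clip: "?clip \<in> measurable (PiM UNIV (\<lambda>_. borel)) config_space"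
    unfolding config_space_def
  proof (rule measurable_PiM_single')
    fix v :: 'v
    have "(\<lambda>\<omega>. \<omega> v) \<in> measurable (PiM UNIV (\<lambda>_. borel)) (borel :: real measure)"
      by (rule measurable_component_singleton) simp
    from measurable_compose[OF this clip1]
    show "(\<lambda>\<omega>. ?clip \<omega> v) \<in> measurable (PiM UNIV (\<lambda>_. borel)) (count_space {-1, 1})" .
  qed (auto simp: PiE_UNIV_domain)
  then have clip': "?clip \<in> measurable PP.lim config_space"
    by (simp cong: measurable_cong_sets)
  have \<nu>: "\<nu> \<in> space (prob_algebra config_space)"
    unfolding \<nu>_def space_prob_algebra using PP.P.prob_space_distr[OF clip'] by simp
  have \<nu>_cyl: "measure \<nu> (cylinder \<Lambda> \<xi>) = w \<Lambda> \<xi>" if L: "finite \<Lambda>" and \<xi>: "\<xi> \<in> patterns \<Lambda>" for \<Lambda> \<xi>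
  proof -
    let ?X = "{x :: 'v \<Rightarrow> real. x \<in> space (PiM \<Lambda> (\<lambda>_. borel)) \<and> (\<forall>v\<in>\<Lambda>. (if x v = 1 then 1 else (-1 :: real)) = \<xi> v)}"
    have X: "?X \<in> sets (PiM \<Lambda> (\<lambda>_. borel))"
    proof (rule sets.sets_Collect_finite_All[OF _ L])
      fix v assume v: "v \<in> \<Lambda>"
      have "(\<lambda>x :: 'v \<Rightarrow> real. if x v = 1 then 1 else (-1 :: real)) \<in> measurable (PiM \<Lambda> (\<lambda>_. borel)) (count_space {-1, 1})"
      proof -
        have "(\<lambda>x. x v) \<in> measurable (PiM \<Lambda> (\<lambda>_. borel)) (borel :: real measure)"
          by (rule measurable_component_singleton[OF v])
        from measurable_compose[OF this clip1] show ?thesis .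
      qed
      moreover have "{\<xi> v} \<in> sets (count_space {-1, 1})" using PiE_mem[OF \<xi> v] by simp
      ultimately have "(\<lambda>x :: 'v \<Rightarrow> real. if x v = 1 then 1 else (-1 :: real)) -` {\<xi> v} \<inter> space (PiM \<Lambda> (\<lambda>_. borel))
          \<in> sets (PiM \<Lambda> (\<lambda>_. borel))"
        by (rule measurable_sets)
      also have "(\<lambda>x :: 'v \<Rightarrow> real. if x v = 1 then 1 else (-1 :: real)) -` {\<xi> v} \<inter> space (PiM \<Lambda> (\<lambda>_. borel)) =
          {x :: 'v \<Rightarrow> real. x \<in> space (PiM \<Lambda> (\<lambda>_. borel)) \<and> (if x v = 1 then 1 else (-1 :: real)) = \<xi> v}"
        by blast
      finally show "{x :: 'v \<Rightarrow> real. x \<in> space (PiM \<Lambda> (\<lambda>_. borel)) \<and> (if x v = 1 then 1 else (-1 :: real)) = \<xi> v}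
          \<in> sets (PiM \<Lambda> (\<lambda>_. borel))" .
    qed
    have "measure \<nu> (cylinder \<Lambda> \<xi>) = measure PP.lim (?clip -` cylinder \<Lambda> \<xi> \<inter> space PP.lim)"
      unfolding \<nu>_def by (rule measure_distr[OF clip' cylinder_measurable[OF L]])
    also have "?clip -` cylinder \<Lambda> \<xi> \<inter> space PP.lim = prod_emb UNIV (\<lambda>_. borel) \<Lambda> ?X"
    proof -
      have "?clip \<omega> \<in> cylinder \<Lambda> \<xi> \<longleftrightarrow> restrict \<omega> \<Lambda> \<in> ?X" for \<omega> :: "'v \<Rightarrow> real"
        by (simp add: cylinder_def configs_def space_PiM)
      then show ?thesis by (simp add: prod_emb_def vimage_def space_PiM)
    qed
    also have "measure PP.lim \<dots> = measure (Q \<Lambda>) ?X"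
      using L X by (intro PP.measure_lim_emb) auto
    also have "\<dots> = (\<Sum>\<xi>'\<in>patterns \<Lambda> \<inter> ?X. w \<Lambda> \<xi>')"
      unfolding measure_def Q[OF L X] by (simp add: sum_nonneg w0[OF L])
    \<comment> \<open>Among spin patterns only \<open>\<xi>\<close> itself is clipped to
      \<open>\<xi>\<close>.\<close>
    also have "patterns \<Lambda> \<inter> ?X = {\<xi>}"
    proof (intro equalityI subsetI)
      fix x assume x: "x \<in> patterns \<Lambda> \<inter> ?X"
      have "x v = \<xi> v" if v: "v \<in> \<Lambda>" for v
      proof -
        have "x v = -1 \<or> x v = 1" using PiE_mem[of x \<Lambda> "\<lambda>_. {-1, 1}" v] x v by simp
        moreover have "(if x v = 1 then 1 else -1) = \<xi> v" using x v by simp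
        ultimately show ?thesis by auto
      qed
      then have "x = \<xi>" using x \<xi> by (intro PiE_ext[of x \<Lambda> "\<lambda>_. {-1, 1}" \<xi>]) auto
      then show "x \<in> {\<xi>}" by simp
    next
      fix x assume "x \<in> {\<xi>}"
      then have x: "x = \<xi>" by simp
      have "(if \<xi> v = 1 then 1 else -1) = \<xi> v" if v: "v \<in> \<Lambda>" for v
        using PiE_mem[OF \<xi> v] by auto
      then show "x \<in> patterns \<Lambda> \<inter> ?X" using \<xi> by (auto simp: x space_PiM PiE_def)
    qed
    finally show ?thesis by simp
  qed
  show ?thesis
  proof (rule that[OF \<nu>])
    fix f :: "('v \<Rightarrow> real) \<Rightarrow> real" assume "local_function f"
    then obtain \<Lambda> where L: "finite \<Lambda>" "determined_up_to 0 \<Lambda> f" by (auto simp: local_function_iff)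
    have "(\<lambda>n. \<Sum>\<xi>\<in>patterns \<Lambda>. f (freeze \<Lambda> \<xi>) * measure (\<rho> n) (cylinder \<Lambda> \<xi>)) \<longlonglongrightarrow>
        (\<Sum>\<xi>\<in>patterns \<Lambda>. f (freeze \<Lambda> \<xi>) * w \<Lambda> \<xi>)"
      by (intro tendsto_intros w L)
    also have "(\<Sum>\<xi>\<in>patterns \<Lambda>. f (freeze \<Lambda> \<xi>) * w \<Lambda> \<xi>) = (\<integral>\<sigma>. f \<sigma> \<partial>\<nu>)"
      using \<nu>_cyl[OF L(1)] by (simp add: integral_local_function[OF \<nu> L])
    finally show "(\<lambda>n. \<integral>\<sigma>. f \<sigma> \<partial>\<rho> n) \<longlonglongrightarrow> (\<integral>\<sigma>. f \<sigma> \<partial>\<nu>)"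
      by (simp add: integral_local_function[OF \<rho> L])
  qed
qed

section \<open>Path space\<close>

definition slice :: "nat \<Rightarrow> ('x \<times> nat \<Rightarrow> real) \<Rightarrow> 'x \<Rightarrow> real" where
  "slice n \<tau> x = \<tau> (x, n)"

definition set_slice :: "nat \<Rightarrow> ('x \<times> nat \<Rightarrow> real) \<Rightarrow> ('x \<Rightarrow> real) \<Rightarrow> 'x \<times> nat \<Rightarrow> real" where
  "set_slice n \<tau> \<sigma> = (\<lambda>(x, m). if m = n then \<sigma> x else \<tau> (x, m))"

text \<open>Draws slice \<open>Suc n\<close> afresh given slice \<open>n\<close>. For a function of
  the times up to n + 1 this is the conditional mean given the times up to n.\<close>

definition path_step ::
  "((int ^ 'd) set \<Rightarrow> real) \<Rightarrow> nat \<Rightarrow> (((int ^ 'd) \<times> nat \<Rightarrow> real) \<Rightarrow> real) \<Rightarrow> ((int ^ 'd) \<times> nat \<Rightarrow> real) \<Rightarrow> real" where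
  "path_step r n f \<tau> = (\<integral>\<sigma>. f (set_slice (Suc n) \<tau> \<sigma>) \<partial>pca_kernel r (slice n \<tau>))"

text \<open>Finite horizons are expressed by freezing later times, so that one path measure serves
  throughout the induction over time.\<close>

abbreviation freeze_after :: "nat \<Rightarrow> ('x \<times> nat \<Rightarrow> real) \<Rightarrow> 'x \<times> nat \<Rightarrow> real" where
  "freeze_after n \<equiv> freeze (UNIV \<times> {..n})"

text \<open>The counterpart of \<open>freeze_after\<close> for sequences of slices, as they occur in
  the iterated kernels.\<close>

definition stack :: "nat \<Rightarrow> (nat \<Rightarrow> 'x \<Rightarrow> real) \<Rightarrow> 'x \<times> nat \<Rightarrow> real" where
  "stack n \<omega> = (\<lambda>(x, m). if m \<le> n then \<omega> m x else 1)"

lemma slice_in_configs: "\<tau> \<in> configs \<Longrightarrow> slice n \<tau> \<in> configs"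
  by (simp add: configs_def slice_def)

lemma set_slice_in_configs: "\<tau> \<in> configs \<Longrightarrow> \<sigma> \<in> configs \<Longrightarrow> set_slice n \<tau> \<sigma> \<in> configs"
  by (simp add: configs_def set_slice_def split_beta)

lemma jointly_quasi_local_set_slice:
  assumes "quasi_local f"
  shows "jointly_quasi_local (\<lambda>\<tau> \<sigma>. f (set_slice n \<tau> \<sigma>))"
  unfolding jointly_quasi_local_def
proof (intro allI impI)
  fix \<epsilon> :: real assume "\<epsilon> > 0"
  then obtain \<Lambda> where L: "finite \<Lambda>" "determined_up_to \<epsilon> \<Lambda> f" by (rule quasi_localE[OF assms])
  have "jointly_determined_up_to \<epsilon> \<Lambda> (fst ` \<Lambda>) (\<lambda>\<tau> \<sigma>. f (set_slice n \<tau> \<sigma>))"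
    unfolding jointly_determined_up_to_def
    by (intro ballI impI determined_up_toD[OF L(2)] set_slice_in_configs) (auto simp: set_slice_def)
  then show "\<exists>\<Lambda> \<Lambda>'. finite \<Lambda> \<and> finite \<Lambda>' \<and> jointly_determined_up_to \<epsilon> \<Lambda> \<Lambda>' (\<lambda>\<tau> \<sigma>. f (set_slice n \<tau> \<sigma>))"
    using L(1) by blast
qed

lemma osc_le_set_slice:
  assumes f: "osc_le d f" and \<tau>: "\<tau> \<in> configs"
  shows "osc_le (\<lambda>x. d (x, n)) (\<lambda>\<sigma>. f (set_slice n \<tau> \<sigma>))"
  unfolding osc_le_def
proof (intro allI ballI)
  fix x and \<sigma> :: "'a \<Rightarrow> real" assume "\<sigma> \<in> configs"
  moreover have "set_slice n \<tau> (flip x \<sigma>) = flip (x, n) (set_slice n \<tau> \<sigma>)"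
    by (auto simp: set_slice_def flip_def)
  ultimately show "\<bar>f (set_slice n \<tau> (flip x \<sigma>)) - f (set_slice n \<tau> \<sigma>)\<bar> \<le> d (x, n)"
    using osc_leD[OF f set_slice_in_configs[OF \<tau>]] by simp
qed

text \<open>Slice \<open>n\<close> of the first argument is overwritten, so its oscillations drop
  out.\<close>

lemma osc_le_past:
  assumes f: "osc_le d f" and \<sigma>: "\<sigma> \<in> configs"
  shows "osc_le (\<lambda>(x, m). if m = n then 0 else d (x, m)) (\<lambda>\<tau>. f (set_slice n \<tau> \<sigma>))"
  unfolding osc_le_def
proof (intro allI ballI)
  fix v :: "'a \<times> nat" and \<tau> :: "'a \<times> nat \<Rightarrow> real" assume \<tau>: "\<tau> \<in> configs"
  obtain x m where v: "v = (x, m)" by (cases v)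
  show "\<bar>f (set_slice n (flip v \<tau>) \<sigma>) - f (set_slice n \<tau> \<sigma>)\<bar> \<le> (case v of (x, m) \<Rightarrow> if m = n then 0 else d (x, m))"
  proof (cases "m = n")
    case True
    then have "set_slice n (flip v \<tau>) \<sigma> = set_slice n \<tau> \<sigma>" by (auto simp: set_slice_def flip_def v)
    then show ?thesis by (simp add: v True)
  next
    case False
    then have "set_slice n (flip v \<tau>) \<sigma> = flip v (set_slice n \<tau> \<sigma>)" by (auto simp: set_slice_def flip_def v)
    then show ?thesis using osc_leD[OF f set_slice_in_configs[OF \<tau> \<sigma>], of v] by (simp add: v False)
  qed
qed

lemma quasi_local_slice:
  assumes "quasi_local g"
  shows "quasi_local (\<lambda>\<tau>. g (slice n \<tau>))"
  unfolding quasi_local_def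
proof (intro allI impI)
  fix \<epsilon> :: real assume "\<epsilon> > 0"
  then obtain \<Lambda> where L: "finite \<Lambda>" "determined_up_to \<epsilon> \<Lambda> g" by (rule quasi_localE[OF assms])
  have "determined_up_to \<epsilon> (\<Lambda> \<times> {n}) (\<lambda>\<tau>. g (slice n \<tau>))"
    unfolding determined_up_to_def
    by (intro ballI impI determined_up_toD[OF L(2)] slice_in_configs) (auto simp: slice_def)
  then show "\<exists>\<Lambda>. finite \<Lambda> \<and> determined_up_to \<epsilon> \<Lambda> (\<lambda>\<tau>. g (slice n \<tau>))"
    using L(1) by (intro exI[of _ "\<Lambda> \<times> {n}"]) simp
qed

lemma osc_le_slice:
  assumes "osc_le e g"
  shows "osc_le (\<lambda>(x, m). if m = n then e x else 0) (\<lambda>\<tau>. g (slice n \<tau>))"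
  unfolding osc_le_def
proof (intro allI ballI)
  fix v :: "'a \<times> nat" and \<tau> :: "'a \<times> nat \<Rightarrow> real" assume \<tau>: "\<tau> \<in> configs"
  obtain x m where v: "v = (x, m)" by (cases v)
  have "slice n (flip v \<tau>) = (if m = n then flip x (slice n \<tau>) else slice n \<tau>)"
    by (auto simp: slice_def flip_def v)
  then show "\<bar>g (slice n (flip v \<tau>)) - g (slice n \<tau>)\<bar> \<le> (case v of (x, m) \<Rightarrow> if m = n then e x else 0)"
    using osc_leD[OF assms slice_in_configs[OF \<tau>]] by (simp add: v)
qed

lemma quasi_local_path_step:
  fixes r :: "(int ^ 'd::finite) set \<Rightarrow> real"
  assumes r: "pca_coefficients r" and f: "quasi_local f"
  shows "quasi_local (path_step r n f)"
proof -
  obtain B where B: "osc_le (\<lambda>_. B) f" by (rule quasi_local_osc_le[OF f])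
  have "quasi_local (\<lambda>\<tau>. \<integral>\<sigma>. (\<lambda>\<tau> \<sigma>. f (set_slice (Suc n) \<tau> \<sigma>)) \<tau> \<sigma>
      \<partial>spin_product ((\<lambda>\<tau> x. local_field r x (slice n \<tau>)) \<tau>))"
    by (rule kernel_quasi_local[where b="\<lambda>_. B"])
      (use r f B in \<open>auto intro!: jointly_quasi_local_set_slice osc_le_set_slice[where d="\<lambda>_. B"] quasi_local_slice[where g="local_field r _"]
        quasi_local_local_field abs_local_field_le slice_in_configs\<close>)
  then show ?thesis by (simp add: path_step_def[abs_def] pca_kernel_eq)
qed

lemma osc_le_path_step:
  fixes r :: "(int ^ 'd::finite) set \<Rightarrow> real"
  assumes r: "pca_coefficients r" and f: "quasi_local f" "osc_le d f"
    and d: "\<And>y. (\<lambda>x. influence r (y - x) * d (x, Suc n)) summable_on UNIV"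
  shows "osc_le (\<lambda>(y, m). if m = Suc n then 0
      else if m = n then d (y, n) + (\<Sum>\<^sub>\<infinity>x. influence r (y - x) * d (x, Suc n)) else d (y, m)) (path_step r n f)"
proof -
  let ?a = "\<lambda>(x, m). if m = Suc n then 0 else d (x, m)"
  \<comment> \<open>The biases depend on the past through slice \<open>n\<close> alone, so flips at
    other times have no influence.\<close>
  let ?c = "\<lambda>(y, m) x. if m = n then influence r (y - x) else 0"
  have "osc_le (\<lambda>v. ?a v + (\<Sum>\<^sub>\<infinity>x. ?c v x * d (x, Suc n)))
      (\<lambda>\<tau>. \<integral>\<sigma>. (\<lambda>\<tau> \<sigma>. f (set_slice (Suc n) \<tau> \<sigma>)) \<tau> \<sigma> \<partial>spin_product ((\<lambda>\<tau> x. local_field r x (slice n \<tau>)) \<tau>))"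
  proof (rule kernel_osc_le[where b="\<lambda>x. d (x, Suc n)"])
    show "jointly_quasi_local (\<lambda>\<tau> \<sigma>. f (set_slice (Suc n) \<tau> \<sigma>))"
      by (rule jointly_quasi_local_set_slice[OF f(1)])
    show "osc_le (\<lambda>x. d (x, Suc n)) (\<lambda>\<sigma>. f (set_slice (Suc n) \<tau> \<sigma>))" if "\<tau> \<in> configs" for \<tau>
      by (rule osc_le_set_slice[OF f(2) that])
    show "osc_le ?a (\<lambda>\<tau>. f (set_slice (Suc n) \<tau> \<sigma>))" if "\<sigma> \<in> configs" for \<sigma>
      by (rule osc_le_past[OF f(2) that])
    show "\<bar>local_field r x (slice n \<tau>)\<bar> \<le> 1" if "\<tau> \<in> configs" for \<tau> x
      by (rule abs_local_field_le[OF r slice_in_configs[OF that]])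
    fix x
    have "(\<lambda>v. 2 * ?c v x) = (\<lambda>(y, m). if m = n then 2 * influence r (y - x) else 0)" by auto
    then show "osc_le (\<lambda>v. 2 * ?c v x) (\<lambda>\<tau>. local_field r x (slice n \<tau>))"
      using osc_le_slice[OF osc_le_local_field[OF r], of n x] by simp
  next
    fix v :: "(int ^ 'd) \<times> nat"
    obtain y m where v: "v = (y, m)" by (cases v)
    show "(\<lambda>x. ?c v x * d (x, Suc n)) summable_on UNIV"
      using d[of y] by (cases "m = n") (simp_all add: v)
  qed
  moreover have "(\<lambda>v. ?a v + (\<Sum>\<^sub>\<infinity>x. ?c v x * d (x, Suc n))) = (\<lambda>(y, m). if m = Suc n then 0
      else if m = n then d (y, n) + (\<Sum>\<^sub>\<infinity>x. influence r (y - x) * d (x, Suc n)) else d (y, m))"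
    by (auto simp: fun_eq_iff)
  ultimately show ?thesis by (simp add: path_step_def[abs_def] pca_kernel_eq)
qed

lemma quasi_local_freeze:
  assumes "quasi_local f"
  shows "quasi_local (\<lambda>\<tau>. f (freeze \<Gamma> \<tau>))"
  unfolding quasi_local_def
proof (intro allI impI)
  fix \<epsilon> :: real assume "\<epsilon> > 0"
  then obtain \<Lambda> where L: "finite \<Lambda>" "determined_up_to \<epsilon> \<Lambda> f" by (rule quasi_localE[OF assms])
  have "determined_up_to \<epsilon> \<Lambda> (\<lambda>\<tau>. f (freeze \<Gamma> \<tau>))"
    unfolding determined_up_to_def
    by (intro ballI impI determined_up_toD[OF L(2)] freeze_in_configs) (auto simp: freeze_def)
  then show "\<exists>\<Lambda>. finite \<Lambda> \<and> determined_up_to \<epsilon> \<Lambda> (\<lambda>\<tau>. f (freeze \<Gamma> \<tau>))"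
    using L(1) by blast
qed

lemma measurable_stack:
  assumes "{..n} \<subseteq> I"
  shows "stack n \<in> measurable (PiM I (\<lambda>_. config_space :: ('x \<Rightarrow> real) measure)) config_space"
  unfolding config_space_def[where 'v="'x \<times> nat"]
proof (rule measurable_PiM_single')
  have "\<omega> m x \<in> {-1, 1}" if "\<omega> \<in> space (PiM I (\<lambda>_. config_space :: ('x \<Rightarrow> real) measure))" "m \<le> n" for \<omega> m x
    using that assms by (auto simp: space_PiM space_config_space configs_def PiE_def Pi_def subset_eq)
  then have "stack n \<omega> v \<in> {-1, 1}" if "\<omega> \<in> space (PiM I (\<lambda>_. config_space :: ('x \<Rightarrow> real) measure))" for \<omega> v
    using that by (cases v) (simp add: stack_def)
  then show "(\<lambda>\<omega>. stack n \<omega>) \<in> space (PiM I (\<lambda>_. config_space :: ('x \<Rightarrow> real) measure)) \<rightarrow> (\<Pi>\<^sub>E i\<in>UNIV. space (count_space {-1, 1}))"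
    by (simp add: PiE_UNIV_domain Pi_def)
  fix v :: "'x \<times> nat"
  obtain x m where v: "v = (x, m)" by (cases v)
  show "(\<lambda>\<omega>. stack n \<omega> v) \<in> measurable (PiM I (\<lambda>_. config_space)) (count_space {-1, 1})"
  proof (cases "m \<le> n")
    case True
    then have "m \<in> I" using assms by auto
    moreover have "(\<lambda>\<eta>. \<eta> x) \<in> measurable config_space (count_space {-1, 1 :: real})"
      unfolding config_space_def by (rule measurable_component_singleton) simp
    ultimately show ?thesis
      using measurable_compose[OF measurable_component_singleton] True by (simp add: v stack_def)
  qed (simp add: v stack_def)
qed

section \<open>Path integrals through iterated kernels\<close>

context
  fixes r :: "(int ^ 'd::finite) set \<Rightarrow> real" and \<mu> :: "(int ^ 'd \<Rightarrow> real) measure"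
  assumes r: "pca_coefficients r" and \<mu>: "\<mu> \<in> space (prob_algebra config_space)"
begin

interpretation I: Ionescu_Tulcea "step_kernel r \<mu>" "\<lambda>_. config_space"
  by (rule Ionescu_Tulcea_step_kernel[OF r \<mu>])

lemma empty_path: "(\<lambda>_. undefined) \<in> space (PiM {0..<0::nat} (\<lambda>_. config_space))"
  by (simp add: space_PiM)

text \<open>The times 0 to n are n + 1 kernels, the one at time 0 being \<open>\<mu>\<close>, hence
  \<open>Suc n\<close>. The marginal of the infinite construction on these times is the finite
  composition of kernels.\<close>

lemma integral_path_eq_C:
  assumes f: "quasi_local f"
  shows "(\<integral>\<tau>. f (freeze_after n \<tau>) \<partial>path_measure r \<mu>) = (\<integral>\<omega>. f (stack n \<omega>) \<partial>I.C 0 (Suc n) (\<lambda>_. undefined))"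
proof -
  let ?J = "{0..<Suc n}" and ?M = "\<lambda>_::nat. config_space :: (int ^ 'd \<Rightarrow> real) measure"
  have st: "stack n \<in> measurable (PiM ?J ?M) config_space" by (rule measurable_stack) auto
  have fm: "(\<lambda>\<omega>. f (stack n \<omega>)) \<in> borel_measurable (PiM ?J ?M)"
    by (rule measurable_compose[OF st quasi_local_measurable[OF f]])
  have res: "(\<lambda>\<omega>. restrict \<omega> ?J) \<in> measurable I.PF.lim (PiM ?J ?M)"
    by (simp cong: measurable_cong_sets add: measurable_restrict_subset)
  have "(\<integral>\<tau>. f (freeze_after n \<tau>) \<partial>path_measure r \<mu>) = (\<integral>\<omega>. f (freeze_after n (\<lambda>(x, n). \<omega> n x)) \<partial>I.PF.lim)"
    unfolding path_measure_def
  proof (rule integral_distr)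
    show "(\<lambda>\<omega> (x, n). \<omega> n x) \<in> measurable I.PF.lim config_space"
      using measurable_space_time by (simp add: measurable_cong_sets[OF I.PF.sets_lim refl])
    show "(\<lambda>\<tau>. f (freeze_after n \<tau>)) \<in> borel_measurable config_space"
      by (rule quasi_local_measurable[OF quasi_local_freeze[OF f]])
  qed
  also have "\<dots> = (\<integral>\<omega>. f (stack n (restrict \<omega> ?J)) \<partial>I.PF.lim)"
  proof -
    have "freeze_after n (\<lambda>(x, n). \<omega> n x) = stack n (restrict \<omega> ?J)" for \<omega> :: "nat \<Rightarrow> int ^ 'd \<Rightarrow> real"
      by (auto simp: freeze_def stack_def fun_eq_iff)
    then show ?thesis by simp
  qed
  also have "\<dots> = (\<integral>\<omega>. f (stack n \<omega>) \<partial>distr I.PF.lim (PiM ?J ?M) (\<lambda>\<omega>. restrict \<omega> ?J))"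
    by (rule integral_distr[OF res fm, symmetric])
  also have "distr I.PF.lim (PiM ?J ?M) (\<lambda>\<omega>. restrict \<omega> ?J) = I.CI ?J"
    by (rule I.distr_lim) simp
  also have "I.CI ?J = distr (I.C 0 (Suc n) (\<lambda>_. undefined)) (PiM ?J ?M) (\<lambda>\<omega>. restrict \<omega> ?J)"
  proof -
    \<comment> \<open>The index set is already an initial segment, so the finite composition stops
      exactly at \<open>Suc n\<close> and the restriction is trivial.\<close>
    have "I.up_to ?J \<le> k \<longleftrightarrow> Suc n \<le> k" for k
      by (subst I.up_to_iff_Ico) auto
    then have "I.up_to ?J = Suc n" by (meson order_antisym order_refl)
    then show ?thesis by (simp add: I.CI_def)
  qed
  also have "\<dots> = I.C 0 (Suc n) (\<lambda>_. undefined)"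
    using I.distr_C[OF order_refl empty_path, of "Suc n"] by simp
  finally show ?thesis .
qed

lemma integral_path_0:
  assumes f: "quasi_local f"
  shows "(\<integral>\<tau>. f (freeze_after 0 \<tau>) \<partial>path_measure r \<mu>) = (\<integral>\<sigma>. f (set_slice 0 (\<lambda>_. 1) \<sigma>) \<partial>\<mu>)"
proof -
  let ?M = "\<lambda>_::nat. config_space :: (int ^ 'd \<Rightarrow> real) measure"
  let ?u = "\<lambda>_::nat. undefined :: int ^ 'd \<Rightarrow> real"
  have st: "stack 0 \<in> measurable (PiM {0..<Suc 0} ?M) config_space" by (rule measurable_stack) auto
  have fm: "(\<lambda>\<omega>. f (stack 0 \<omega>)) \<in> borel_measurable (PiM {0..<Suc 0} ?M)"
    by (rule measurable_compose[OF st quasi_local_measurable[OF f]])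
  have upd: "fun_upd ?u 0 \<in> measurable \<mu> (PiM {0..<Suc 0} ?M)"
  proof (rule measurable_fun_upd[where J="{}"])
    show "(\<lambda>x. x) \<in> measurable \<mu> config_space" using prob_algebra_configD(2)[OF \<mu>] by (simp cong: measurable_cong_sets)
  qed (auto simp: measurable_const space_PiM)
  have "I.C 0 (Suc 0) ?u = I.eP 0 ?u"
    using bind_return[OF I.measurable_eP[of 0] empty_path] by simp
  also have "\<dots> = distr \<mu> (PiM {0..<Suc 0} ?M) (fun_upd ?u 0)"
    by (simp add: I.eP_def step_kernel_def)
  finally have "(\<integral>\<tau>. f (freeze_after 0 \<tau>) \<partial>path_measure r \<mu>) =
      (\<integral>\<omega>. f (stack 0 \<omega>) \<partial>distr \<mu> (PiM {0..<Suc 0} ?M) (fun_upd ?u 0))"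
    by (simp only: integral_path_eq_C[OF f])
  also have "\<dots> = (\<integral>\<sigma>. f (stack 0 (fun_upd ?u 0 \<sigma>)) \<partial>\<mu>)"
    by (rule integral_distr[OF upd fm])
  also have "\<dots> = (\<integral>\<sigma>. f (set_slice 0 (\<lambda>_. 1) \<sigma>) \<partial>\<mu>)"
  proof -
    have "stack 0 (fun_upd ?u 0 \<sigma>) = set_slice 0 (\<lambda>_. 1) \<sigma>" for \<sigma>
      by (auto simp: stack_def set_slice_def fun_eq_iff)
    then show ?thesis by simp
  qed
  finally show ?thesis .
qed

text \<open>The Markov property: the composition up to time n + 1 is the one up to time n bound to
  the last kernel, which reads only slice n.\<close>

lemma integral_path_Suc:
  assumes f: "quasi_local f" "quasi_local (path_step r n f)"
  shows "(\<integral>\<tau>. f (freeze_after (Suc n) \<tau>) \<partial>path_measure r \<mu>) = (\<integral>\<tau>. path_step r n f (freeze_after n \<tau>) \<partial>path_measure r \<mu>)"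
proof -
  let ?M = "\<lambda>_::nat. config_space :: (int ^ 'd \<Rightarrow> real) measure"
  let ?C = "I.C 0 (Suc n) (\<lambda>_. undefined)"
  let ?K = "PiM {0..<Suc (Suc n)} ?M"
  obtain B where B: "\<And>\<sigma>. \<sigma> \<in> configs \<Longrightarrow> \<bar>f \<sigma>\<bar> \<le> B" by (rule quasi_local_bounded[OF f(1)]) blast
  interpret C: prob_space ?C by (rule I.prob_space_C[OF empty_path])
  have spC: "space ?C = space (PiM {0..<Suc n} ?M)" using I.space_C[OF empty_path, of "Suc n"] by simp
  have stC: "sets ?C = sets (PiM {0..<Suc n} ?M)" using I.sets_C[OF empty_path, of "Suc n"] by simp
  have st: "stack (Suc n) \<in> measurable ?K config_space" by (rule measurable_stack) auto
  have fm: "(\<lambda>\<omega>. f (stack (Suc n) \<omega>)) \<in> borel_measurable ?K"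
    by (rule measurable_compose[OF st quasi_local_measurable[OF f(1)]])
  have bd: "\<bar>f (stack (Suc n) \<omega>)\<bar> \<le> B" if "\<omega> \<in> space ?K" for \<omega>
    using B measurable_space[OF st that] by (simp add: space_config_space)
  have eP: "I.eP (Suc n) \<in> measurable ?C (subprob_algebra ?K)"
    by (simp only: measurable_cong_sets[OF stC refl] I.measurable_eP)
  have "emeasure (I.eP (Suc n) \<omega>) (space (I.eP (Suc n) \<omega>)) \<le> ennreal 1" if "\<omega> \<in> space ?C" for \<omega>
    using prob_space.emeasure_space_1[OF I.prob_space_eP[of \<omega> "Suc n"]] that[unfolded spC] by simp
  then have "(\<integral>\<omega>. f (stack (Suc n) \<omega>) \<partial>(?C \<bind> I.eP (Suc n))) = (\<integral>\<omega>. (\<integral>\<omega>'. f (stack (Suc n) \<omega>') \<partial>I.eP (Suc n) \<omega>) \<partial>?C)"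
    by (intro integral_bind[OF fm bd eP C.finite_measure_axioms, where B'=1] AE_I2)
  also have "\<dots> = (\<integral>\<omega>. path_step r n f (stack n \<omega>) \<partial>?C)"
  proof (rule Bochner_Integration.integral_cong[OF refl])
    fix \<omega> assume "\<omega> \<in> space ?C"
    then have \<omega>: "\<omega> \<in> space (PiM {0..<Suc n} ?M)" by (simp only: spC)
    have sets: "sets (step_kernel r \<mu> (Suc n) \<omega>) = sets config_space" by (rule I.sets_P[OF \<omega>])
    have upd: "fun_upd \<omega> (Suc n) \<in> measurable (step_kernel r \<mu> (Suc n) \<omega>) ?K"
    proof (rule measurable_fun_upd[where J="{0..<Suc n}"])
      show "(\<lambda>x. x) \<in> measurable (step_kernel r \<mu> (Suc n) \<omega>) config_space" using sets by (simp cong: measurable_cong_sets)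
      show "(\<lambda>x. \<omega>) \<in> measurable (step_kernel r \<mu> (Suc n) \<omega>) (PiM {0..<Suc n} ?M)" using \<omega> by (rule measurable_const)
    qed auto
    have "(\<integral>\<omega>'. f (stack (Suc n) \<omega>') \<partial>I.eP (Suc n) \<omega>) = (\<integral>\<sigma>. f (stack (Suc n) (fun_upd \<omega> (Suc n) \<sigma>)) \<partial>step_kernel r \<mu> (Suc n) \<omega>)"
      unfolding I.eP_def by (rule integral_distr[OF upd fm])
    also have "step_kernel r \<mu> (Suc n) \<omega> = pca_kernel r (slice n (stack n \<omega>))"
    proof -
      have "slice n (stack n \<omega>) = \<omega> n" by (simp add: slice_def stack_def fun_eq_iff)
      then show ?thesis by (simp add: step_kernel_def)
    qed
    also have "(\<lambda>\<sigma>. f (stack (Suc n) (fun_upd \<omega> (Suc n) \<sigma>))) = (\<lambda>\<sigma>. f (set_slice (Suc n) (stack n \<omega>) \<sigma>))"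
    proof
      fix \<sigma>
      have "stack (Suc n) (fun_upd \<omega> (Suc n) \<sigma>) = set_slice (Suc n) (stack n \<omega>) \<sigma>"
        by (auto simp: stack_def set_slice_def fun_eq_iff)
      then show "f (stack (Suc n) (fun_upd \<omega> (Suc n) \<sigma>)) = f (set_slice (Suc n) (stack n \<omega>) \<sigma>)" by simp
    qed
    finally show "(\<integral>\<omega>'. f (stack (Suc n) \<omega>') \<partial>I.eP (Suc n) \<omega>) = path_step r n f (stack n \<omega>)"
      by (simp add: path_step_def)
  qed
  finally show ?thesis
    using integral_path_eq_C[OF f(1), of "Suc n"] integral_path_eq_C[OF f(2), of n] by simp
qed

end

section \<open>Exponential moments on path space\<close>

lemma quasi_GCB_mono:
  assumes "quasi_GCB C \<mu>" "C \<le> D"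
  shows "quasi_GCB D \<mu>"
  unfolding quasi_GCB_def
proof (intro allI impI)
  fix g and d :: "'a \<Rightarrow> real"
  assume "quasi_local g" "osc_le d g" "(\<lambda>v. (d v)\<^sup>2) summable_on UNIV"
  then have "(\<integral>\<sigma>. exp (g \<sigma> - (\<integral>\<tau>. g \<tau> \<partial>\<mu>)) \<partial>\<mu>) \<le> exp (C / 2 * (\<Sum>\<^sub>\<infinity>v. (d v)\<^sup>2))"
    by (rule quasi_GCBD[OF assms(1)])
  also have "\<dots> \<le> exp (D / 2 * (\<Sum>\<^sub>\<infinity>v. (d v)\<^sup>2))"
    using assms(2) infsum_nonneg[of UNIV "\<lambda>v. (d v)\<^sup>2"] by (auto intro!: mult_right_mono)
  finally show "(\<integral>\<sigma>. exp (g \<sigma> - (\<integral>\<tau>. g \<tau> \<partial>\<mu>)) \<partial>\<mu>) \<le> exp (D / 2 * (\<Sum>\<^sub>\<infinity>v. (d v)\<^sup>2))" .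
qed

text \<open>Only slicewise square-summability is asked of \<open>d\<close>, since after one step the
  profile need not have finite support. The newest slice carries no factor 1 / (1 - \<gamma>); with
  it the induction would lose this factor at every step.\<close>

lemma path_exp_moment:
  fixes r :: "(int ^ 'd::finite) set \<Rightarrow> real"
  assumes r: "pca_coefficients r" "contractive r" and \<mu>: "\<mu> \<in> space (prob_algebra config_space)"
    and gcb: "quasi_GCB D \<mu>" and D: "1 \<le> 4 * D * (1 - total_influence r)" "D > 0"
    and f: "quasi_local f" "osc_le d f" and d: "\<And>m. (\<lambda>x. (d (x, m))\<^sup>2) summable_on UNIV"
  shows "(\<integral>\<tau>. exp (f (freeze_after n \<tau>) - (\<integral>\<tau>. f (freeze_after n \<tau>) \<partial>path_measure r \<mu>)) \<partial>path_measure r \<mu>)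
    \<le> exp (D / 2 * ((\<Sum>m<n. \<Sum>\<^sub>\<infinity>x. (d (x, m))\<^sup>2) / (1 - total_influence r) + (\<Sum>\<^sub>\<infinity>x. (d (x, n))\<^sup>2)))"
  using f d
proof (induction n arbitrary: f d)
  case 0
  let ?f = "\<lambda>\<sigma>. f (set_slice 0 (\<lambda>_. 1) \<sigma>)"
  let ?m = "\<integral>\<sigma>. ?f \<sigma> \<partial>\<mu>"
  have ql: "quasi_local ?f"
    by (rule jointly_quasi_local_section[OF jointly_quasi_local_set_slice[OF 0(1)] one_in_configs])
  have m: "(\<integral>\<tau>. f (freeze_after 0 \<tau>) \<partial>path_measure r \<mu>) = ?m" by (rule integral_path_0[OF r(1) \<mu> 0(1)])
  have "(\<integral>\<tau>. exp (f (freeze_after 0 \<tau>) - ?m) \<partial>path_measure r \<mu>) = (\<integral>\<sigma>. exp (?f \<sigma> - ?m) \<partial>\<mu>)"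
    using integral_path_0[OF r(1) \<mu> quasi_local_exp[OF 0(1), of "- ?m"]] by simp
  also have "\<dots> \<le> exp (D / 2 * (\<Sum>\<^sub>\<infinity>x. (d (x, 0))\<^sup>2))"
    by (rule quasi_GCBD[OF gcb ql osc_le_set_slice[OF 0(2) one_in_configs] 0(3)])
  finally show ?case unfolding m by simp
next
  case (Suc n)
  let ?\<gamma> = "total_influence r" and ?P = "path_measure r \<mu>"
  let ?S = "\<lambda>m. \<Sum>\<^sub>\<infinity>x. (d (x, m))\<^sup>2"
  let ?e = "\<lambda>y. d (y, n) + (\<Sum>\<^sub>\<infinity>x. influence r (y - x) * d (x, Suc n))"
  let ?d' = "\<lambda>(y, m). if m = Suc n then 0 else if m = n then ?e y else d (y, m)"
  let ?g = "path_step r n f"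
  have P: "?P \<in> space (prob_algebra config_space)" by (rule path_measure_in_prob_algebra[OF r(1) \<mu>])
  have \<gamma>: "?\<gamma> < 1" by (rule total_influence_less_1[OF r(2)])
  note cs = convolution_square_sum[OF influence_has_sum[OF r(2)] influence_nonneg \<gamma>
      Suc.prems(3)[of n] Suc.prems(3)[of "Suc n"] osc_le_nonneg[OF Suc.prems(2)]]
  have g: "quasi_local ?g" "osc_le ?d' ?g"
    by (rule quasi_local_path_step[OF r(1) Suc.prems(1)] osc_le_path_step[OF r(1) Suc.prems(1,2) cs(1)])+
  have d': "(\<lambda>x. (?d' (x, m))\<^sup>2) summable_on UNIV" for m
    using cs(2) Suc.prems(3)[of m] by (cases "m = Suc n"; cases "m = n") simp_all
  let ?m = "\<integral>\<tau>. f (freeze_after (Suc n) \<tau>) \<partial>?P"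
  have m: "?m = (\<integral>\<tau>. ?g (freeze_after n \<tau>) \<partial>?P)" by (rule integral_path_Suc[OF r(1) \<mu> Suc.prems(1) g(1)])
  let ?h = "\<lambda>\<tau>. exp (f \<tau> - ?m)"
  have h: "quasi_local ?h" using quasi_local_exp[OF Suc.prems(1), of "- ?m"] by simp
  have step: "path_step r n ?h \<tau> \<le> exp (1 / 8 * ?S (Suc n)) * exp (?g \<tau> - ?m)" if \<tau>: "\<tau> \<in> configs" for \<tau>
  proof -
    let ?F = "\<lambda>\<sigma>. f (set_slice (Suc n) \<tau> \<sigma>)"
    have F: "quasi_local ?F" "osc_le (\<lambda>x. d (x, Suc n)) ?F"
      by (rule jointly_quasi_local_section[OF jointly_quasi_local_set_slice[OF Suc.prems(1)] \<tau>]
          osc_le_set_slice[OF Suc.prems(2) \<tau>])+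
    \<comment> \<open>Recentring at the conditional mean separates the noise of slice
      \<open>Suc n\<close> from the fluctuation of the past.\<close>
    have "path_step r n ?h \<tau> = (\<integral>\<sigma>. exp (?F \<sigma> - ?g \<tau>) * exp (?g \<tau> - ?m) \<partial>pca_kernel r (slice n \<tau>))"
      unfolding path_step_def[of r n ?h] by (simp flip: exp_add)
    also have "\<dots> = exp (?g \<tau> - ?m) * (\<integral>\<sigma>. exp (?F \<sigma> - ?g \<tau>) \<partial>pca_kernel r (slice n \<tau>))" by simp
    also have "\<dots> \<le> exp (?g \<tau> - ?m) * exp (1 / 8 * ?S (Suc n))"
      unfolding path_step_def pca_kernel_eq
      by (intro mult_left_mono spin_product_exp_moment abs_local_field_le r(1) slice_in_configs \<tau> F Suc.prems(3)) simp
    finally show ?thesis by (simp add: mult.commute)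
  qed
  have qh: "quasi_local (path_step r n ?h)" by (rule quasi_local_path_step[OF r(1) h])
  have int_g: "integrable ?P (\<lambda>\<tau>. exp (1 / 8 * ?S (Suc n)) * exp (?g (freeze_after n \<tau>) - ?m))"
    using integrable_exp_quasi_local[OF P quasi_local_freeze[OF g(1)]] by simp
  have "(\<integral>\<tau>. exp (f (freeze_after (Suc n) \<tau>) - ?m) \<partial>?P) = (\<integral>\<tau>. path_step r n ?h (freeze_after n \<tau>) \<partial>?P)"
    by (rule integral_path_Suc[OF r(1) \<mu> h qh])
  also have "\<dots> \<le> (\<integral>\<tau>. exp (1 / 8 * ?S (Suc n)) * exp (?g (freeze_after n \<tau>) - ?m) \<partial>?P)"
    by (rule integral_mono'[OF int_g step]) (simp_all add: prob_algebra_configD(3)[OF P])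
  also have "\<dots> = exp (1 / 8 * ?S (Suc n)) * (\<integral>\<tau>. exp (?g (freeze_after n \<tau>) - (\<integral>\<tau>. ?g (freeze_after n \<tau>) \<partial>?P)) \<partial>?P)"
    by (simp add: m)
  also have "\<dots> \<le> exp (1 / 8 * ?S (Suc n)) *
      exp (D / 2 * ((\<Sum>m<n. \<Sum>\<^sub>\<infinity>x. (?d' (x, m))\<^sup>2) / (1 - ?\<gamma>) + (\<Sum>\<^sub>\<infinity>x. (?d' (x, n))\<^sup>2)))"
    by (intro mult_left_mono Suc.IH[OF g d']) simp
  \<comment> \<open>The indices m < n avoid both modified slices; only the last square sum sees the
    convolved profile.\<close>
  also have "\<dots> = exp (1 / 8 * ?S (Suc n)) * exp (D / 2 * ((\<Sum>m<n. ?S m) / (1 - ?\<gamma>) + (\<Sum>\<^sub>\<infinity>x. (?e x)\<^sup>2)))"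
    by simp
  also have "\<dots> \<le> exp (D / 2 * ((\<Sum>m<Suc n. ?S m) / (1 - ?\<gamma>) + ?S (Suc n)))"
  proof -
    have S0: "0 \<le> ?S (Suc n)" by (intro infsum_nonneg) simp
    have "?S (Suc n) \<le> (4 * D * (1 - ?\<gamma>)) * ?S (Suc n)" using mult_right_mono[OF D(1) S0] by simp
    \<comment> \<open>The cost of slice \<open>Suc n\<close> and what it passes to slice
      \<open>n\<close> stay within its own weight D / 2.\<close>
    then have "1 / 8 * ?S (Suc n) + D / 2 * (?\<gamma> * ?S (Suc n)) \<le> D / 2 * ?S (Suc n)" by (simp add: algebra_simps)
    moreover have "D / 2 * (\<Sum>\<^sub>\<infinity>x. (?e x)\<^sup>2) \<le> D / 2 * (?S n / (1 - ?\<gamma>) + ?\<gamma> * ?S (Suc n))"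
      using D(2) by (intro mult_left_mono cs(3)) simp
    ultimately show ?thesis by (simp add: distrib_left add_divide_distrib flip: exp_add)
  qed
  finally show ?case .
qed

text \<open>A local function has a last time \<open>n\<close> and is unchanged by freezing after it,
  so the finite-horizon bound applies with a constant free of \<open>n\<close>.\<close>

lemma GCB_path_measure:
  fixes r :: "(int ^ 'd::finite) set \<Rightarrow> real"
  assumes r: "pca_coefficients r" "contractive r" and \<mu>: "\<mu> \<in> space (prob_algebra config_space)"
    and gcb: "GCB C \<mu>" and D: "C \<le> D" "1 \<le> 4 * D * (1 - total_influence r)"
  shows "GCB (D / (1 - total_influence r)) (path_measure r \<mu>)"
proof (rule GCB_I)
  let ?\<gamma> = "total_influence r"
  have \<gamma>: "0 \<le> ?\<gamma>" "?\<gamma> < 1" using total_influence_nonneg total_influence_less_1[OF r(2)] by auto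
  have D0: "D > 0" using gcb D(1) by (simp add: GCB_def)
  show "path_measure r \<mu> \<in> space (prob_algebra config_space)" by (rule path_measure_in_prob_algebra[OF r(1) \<mu>])
  show "0 < D / (1 - ?\<gamma>)" using D0 \<gamma> by simp
  fix f :: "((int ^ 'd) \<times> nat \<Rightarrow> real) \<Rightarrow> real" assume f: "local_function f"
  then obtain \<Lambda> where L: "finite \<Lambda>" "determined_up_to 0 \<Lambda> f" by (auto simp: local_function_iff)
  let ?d = "\<lambda>v. oscillation v f"
  \<comment> \<open>Inserting 0 covers an empty \<open>\<Lambda>\<close>.\<close>
  define n where "n = Max (insert 0 (snd ` \<Lambda>))"
  have n: "m \<le> n" if "(x, m) \<in> \<Lambda>" for x m
    unfolding n_def using L(1) that by (intro Max_ge) (auto simp: image_iff intro: bexI[of _ "(x, m)"])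
  have f_eq: "f (freeze_after n \<tau>) = f \<tau>" if "\<tau> \<in> configs" for \<tau>
  proof -
    have "\<bar>f (freeze_after n \<tau>) - f \<tau>\<bar> \<le> 0"
      using that n by (intro determined_up_toD[OF L(2)]) (auto simp: freeze_def)
    then show ?thesis by simp
  qed
  have slice_sum: "((\<lambda>x. (?d (x, m))\<^sup>2) has_sum (\<Sum>x\<in>fst ` \<Lambda>. (?d (x, m))\<^sup>2)) UNIV" for m
  proof (rule has_sum_finite_neutralI)
    fix x assume "x \<in> UNIV - fst ` \<Lambda>"
    then have "(x, m) \<notin> \<Lambda>" by force
    then show "(?d (x, m))\<^sup>2 = 0" by (simp add: oscillation_outside[OF L(2)])
  qed (use L(1) in auto)
  have "(\<Sum>m\<le>n. \<Sum>x\<in>fst ` \<Lambda>. (?d (x, m))\<^sup>2) = (\<Sum>x\<in>fst ` \<Lambda>. \<Sum>m\<le>n. (?d (x, m))\<^sup>2)" by (rule sum.swap)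
  also have "\<dots> = (\<Sum>v\<in>fst ` \<Lambda> \<times> {..n}. (?d v)\<^sup>2)"
    by (simp add: sum.cartesian_product)
  also have "\<dots> \<le> osc_norm_sq f"
    unfolding osc_norm_sq_def using L(1) by (intro finite_sum_le_infsum summable_oscillation_sq[OF f]) auto
  finally have tot: "(\<Sum>m\<le>n. \<Sum>\<^sub>\<infinity>x. (?d (x, m))\<^sup>2) \<le> osc_norm_sq f"
    by (simp add: infsumI[OF slice_sum])
  let ?P = "path_measure r \<mu>"
  have spP: "space ?P = configs"
    by (rule prob_algebra_configD(3)[OF path_measure_in_prob_algebra[OF r(1) \<mu>]])
  have m: "(\<integral>\<tau>. f (freeze_after n \<tau>) \<partial>?P) = (\<integral>\<tau>. f \<tau> \<partial>?P)"
    by (intro Bochner_Integration.integral_cong refl f_eq) (simp add: spP)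
  have "(\<integral>\<tau>. exp (f \<tau> - (\<integral>\<tau>. f \<tau> \<partial>?P)) \<partial>?P) =
      (\<integral>\<tau>. exp (f (freeze_after n \<tau>) - (\<integral>\<tau>. f (freeze_after n \<tau>) \<partial>?P)) \<partial>?P)"
    unfolding m by (intro Bochner_Integration.integral_cong refl) (simp add: f_eq spP)
  also have "\<dots> \<le> exp (D / 2 * ((\<Sum>m<n. \<Sum>\<^sub>\<infinity>x. (?d (x, m))\<^sup>2) / (1 - ?\<gamma>) + (\<Sum>\<^sub>\<infinity>x. (?d (x, n))\<^sup>2)))"
    by (rule path_exp_moment[OF r \<mu> quasi_GCB_mono[OF GCB_imp_quasi_GCB[OF \<mu> gcb] D(1)] D(2) D0
        quasi_local_local[OF f] osc_le_oscillation[OF f] has_sum_imp_summable[OF slice_sum]])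
  also have "\<dots> \<le> exp (D / (1 - ?\<gamma>) / 2 * osc_norm_sq f)"
  proof -
    let ?S = "\<lambda>m. \<Sum>\<^sub>\<infinity>x. (?d (x, m))\<^sup>2"
    have "0 \<le> ?S n" by (intro infsum_nonneg) simp
    \<comment> \<open>The newest slice is raised to the weight of the others, which gives a single
      constant.\<close>
    then have "?S n \<le> ?S n / (1 - ?\<gamma>)" using \<gamma> by (simp add: field_simps mult_left_le)
    then have "(\<Sum>m<n. ?S m) / (1 - ?\<gamma>) + ?S n \<le> (\<Sum>m\<le>n. ?S m) / (1 - ?\<gamma>)"
      by (simp add: lessThan_Suc_atMost[symmetric] add_divide_distrib)
    also have "\<dots> \<le> osc_norm_sq f / (1 - ?\<gamma>)" using tot \<gamma> by (intro divide_right_mono) auto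
    finally have "D / 2 * ((\<Sum>m<n. ?S m) / (1 - ?\<gamma>) + ?S n) \<le> D / 2 * (osc_norm_sq f / (1 - ?\<gamma>))"
      using D0 by (intro mult_left_mono) auto
    then show ?thesis by (simp add: mult.commute)
  qed
  finally show "(\<integral>\<tau>. exp (f \<tau> - (\<integral>\<tau>. f \<tau> \<partial>?P)) \<partial>?P) \<le> exp (D / (1 - ?\<gamma>) / 2 * osc_norm_sq f)" .
qed

section \<open>Uniqueness and existence of the stationary measure\<close>

lemma stationary_unique:
  fixes r :: "(int ^ 'd::finite) set \<Rightarrow> real"
  assumes r: "pca_coefficients r" "contractive r" and "stationary r \<nu>" "stationary r \<nu>'"
  shows "\<nu> = \<nu>'"
proof (rule prob_eqI_local)
  show "\<nu> \<in> space (prob_algebra config_space)" "\<nu>' \<in> space (prob_algebra config_space)"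
    using assms(3,4) by (simp_all add: stationary_def)
  show "(\<integral>\<sigma>. f \<sigma> \<partial>\<nu>) = (\<integral>\<sigma>. f \<sigma> \<partial>\<nu>')" if "local_function f" for f
    using stationary_limit[OF r assms(3) that] stationary_limit[OF r assms(4) that] by (rule LIMSEQ_unique)
qed

text \<open>Needed because invariance of the limit tests \<open>pca_step r f\<close>, which is only
  quasi-local even for local \<open>f\<close>. Freezing costs e / 3 under each measure.\<close>

lemma local_limit_quasi_local:
  fixes \<rho> :: "nat \<Rightarrow> ('v \<Rightarrow> real) measure"
  assumes \<rho>: "\<And>n. \<rho> n \<in> space (prob_algebra config_space)" and \<nu>: "\<nu> \<in> space (prob_algebra config_space)"
    and lim: "\<And>f. local_function f \<Longrightarrow> (\<lambda>n. \<integral>\<sigma>. f \<sigma> \<partial>\<rho> n) \<longlonglongrightarrow> (\<integral>\<sigma>. f \<sigma> \<partial>\<nu>)"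
    and g: "quasi_local g"
  shows "(\<lambda>n. \<integral>\<sigma>. g \<sigma> \<partial>\<rho> n) \<longlonglongrightarrow> (\<integral>\<sigma>. g \<sigma> \<partial>\<nu>)"
proof (rule LIMSEQ_I)
  fix e :: real assume e: "e > 0"
  then have "e / 3 > 0" by simp
  then obtain \<Lambda> where L: "finite \<Lambda>" "determined_up_to (e / 3) \<Lambda> g" by (rule quasi_localE[OF g])
  let ?g = "\<lambda>\<sigma>. g (freeze \<Lambda> \<sigma>)"
  have loc: "local_function ?g" by (rule local_freeze[OF L(1)])
  have close: "\<bar>(\<integral>\<sigma>. ?g \<sigma> \<partial>\<mu>) - (\<integral>\<sigma>. g \<sigma> \<partial>\<mu>)\<bar> \<le> e / 3" if "\<mu> \<in> space (prob_algebra config_space)" for \<mu>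
    by (rule integral_diff_le[OF that quasi_local_integrable[OF that quasi_local_local[OF loc]]
        quasi_local_integrable[OF that g]]) (rule freeze_close[OF L(2)])
  obtain N where N: "\<And>n. n \<ge> N \<Longrightarrow> norm ((\<integral>\<sigma>. ?g \<sigma> \<partial>\<rho> n) - (\<integral>\<sigma>. ?g \<sigma> \<partial>\<nu>)) < e / 3"
    using LIMSEQ_D[OF lim[OF loc] \<open>e / 3 > 0\<close>] by blast
  have "norm ((\<integral>\<sigma>. g \<sigma> \<partial>\<rho> n) - (\<integral>\<sigma>. g \<sigma> \<partial>\<nu>)) < e" if "n \<ge> N" for n
    using N[OF that] close[OF \<rho>[of n]] close[OF \<nu>] unfolding real_norm_def by linarith
  then show "\<exists>N. \<forall>n\<ge>N. norm ((\<integral>\<sigma>. g \<sigma> \<partial>\<rho> n) - (\<integral>\<sigma>. g \<sigma> \<partial>\<nu>)) < e" by blast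
qed

text \<open>The mean of \<open>f\<close> at time n + 1 is that of \<open>pca_step r f\<close> at
  time n; both sides of the invariance equation are limits of this one sequence.\<close>

lemma stationary_exists:
  fixes r :: "(int ^ 'd::finite) set \<Rightarrow> real"
  assumes r: "pca_coefficients r" "contractive r"
  shows "\<exists>\<nu>. stationary r \<nu>"
proof -
  note law = pca_law_in_prob_algebra[OF r(1)]
  obtain \<nu> where \<nu>: "\<nu> \<in> space (prob_algebra config_space)"
    and lim: "\<And>f. local_function f \<Longrightarrow> (\<lambda>n. \<integral>\<sigma>. f \<sigma> \<partial>pca_law r n) \<longlonglongrightarrow> (\<integral>\<sigma>. f \<sigma> \<partial>\<nu>)"
    using local_limit_exists[OF law pca_law_convergent[OF r]] by blast
  have "\<nu> \<bind> pca_kernel r = \<nu>"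
  proof (rule prob_eqI_local[OF bind_pca_kernel_in_prob_algebra[OF r(1) \<nu>] \<nu>])
    fix f :: "(int ^ 'd \<Rightarrow> real) \<Rightarrow> real" assume f: "local_function f"
    note ql = quasi_local_local[OF f]
    have "(\<lambda>n. \<integral>\<eta>. pca_step r f \<eta> \<partial>pca_law r n) \<longlonglongrightarrow> (\<integral>\<eta>. pca_step r f \<eta> \<partial>\<nu>)"
      by (rule local_limit_quasi_local[OF law \<nu> lim quasi_local_pca_step[OF r(1) ql]])
    then have "(\<lambda>n. \<integral>\<sigma>. f \<sigma> \<partial>pca_law r (Suc n)) \<longlonglongrightarrow> (\<integral>\<sigma>. f \<sigma> \<partial>(\<nu> \<bind> pca_kernel r))"
      by (simp add: integral_bind_pca_kernel[OF r(1) law ql] integral_bind_pca_kernel[OF r(1) \<nu> ql])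
    then show "(\<integral>\<sigma>. f \<sigma> \<partial>(\<nu> \<bind> pca_kernel r)) = (\<integral>\<sigma>. f \<sigma> \<partial>\<nu>)"
      by (rule LIMSEQ_unique[OF _ LIMSEQ_Suc[OF lim[OF f]]])
  qed
  then show ?thesis using \<nu> by (auto simp: stationary_def)
qed

theorem theorem3p2:
  fixes r :: "(int ^ 'd::finite) set \<Rightarrow> real"
  assumes "pca_coefficients r" and "contractive r"
  shows "(\<forall>\<mu> C. \<mu> \<in> space (prob_algebra config_space) \<and> GCB C \<mu> \<longrightarrow>
            (\<exists>C'. GCB C' (path_measure r \<mu>)))
       \<and> (\<exists>!\<nu>. stationary r \<nu>)
       \<and> (\<forall>\<nu>. stationary r \<nu> \<longrightarrow> (\<exists>C'. GCB C' (path_measure r \<nu>)))"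
proof -
  \<comment> \<open>The least constant with 4 K (1 - \<gamma>) \<ge> 1, and already a constant for
    the stationary measure.\<close>
  define K where "K = 1 / (4 * (1 - total_influence r))"
  have \<gamma>: "total_influence r < 1" by (rule total_influence_less_1[OF assms(2)])
  have K0: "K > 0" using \<gamma> by (simp add: K_def)
  have K: "1 \<le> 4 * D * (1 - total_influence r)" if "K \<le> D" for D
    using that \<gamma> by (simp add: K_def field_simps)
  have path: "\<exists>C'. GCB C' (path_measure r \<mu>)"
    if "\<mu> \<in> space (prob_algebra config_space)" "GCB C \<mu>" for \<mu> C
    \<comment> \<open>Here D is the maximum of \<open>K\<close> and \<open>C\<close>.\<close>
    using GCB_path_measure[OF assms that max.cobounded1 K[OF max.cobounded2[of K C]]] by blast
  moreover have "\<exists>!\<nu>. stationary r \<nu>"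
    using stationary_exists[OF assms] stationary_unique[OF assms] by blast
  moreover have "\<exists>C'. GCB C' (path_measure r \<nu>)" if \<nu>: "stationary r \<nu>" for \<nu>
    using path GCB_stationary[OF assms \<nu> K[OF order_refl] K0] \<nu> by (auto simp: stationary_def)
  ultimately show ?thesis by blast
qed

end
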